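(* Let $u\in\mathcal{W}(I)$ be a solution of the unsteady obstacle problem described in the context and let $\Lambda\coloneqq f-\partial_tu-L^*\nabla u\in L^2(I;V^* )$. Then, for every $v\in\mathcal{W}(I)$ with $v(0)=u_0$ in $H$ and $v(t)\in K(t)$ for a.e. $t\in I$, $$\begin{aligned}&\tfrac12\|\nabla(v-u)\|_Q^2+\langle-\Lambda,v-u\rangle_{L^2(I;V)}+\tfrac12\|(v-u)(T)\|_H^2\\&\quad+\inf_{y\in L^2(I;Y^* )}\bigl\{\tfrac12\|y-\nabla u\|_Q^2+I_{\chi_K^*}(f-\partial_tv-L^*y)-\langle f-\partial_tv-L^*y,u\rangle_{L^2(I;V)}\bigr\}\\&=\inf_{y\in L^2(I;Y^* )}\bigl\{\tfrac12\|y-\nabla v\|_Q^2+I_{\chi_K^*}(f-\partial_tv-L^*y)-\langle f-\partial_tv-L^*y,v\rangle_{L^2(I;V)}\bigr\}\\&=\inf_{\eta\in L^2(I;V^* )}\bigl\{\tfrac12\|\partial_tv+(-\Delta)v+\eta-f\|_{L^2(I;V^* )}^2+I_{\chi_K^*}(\eta)+\langle-\eta,v\rangle_{L^2(I;V)}\bigr\}.\end{aligned}$$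
   Context: $\Omega\subseteq\mathbb{R}^d$ is a bounded Lipschitz domain with boundary split into disjoint relatively open sets $\Gamma_D\ne\emptyset$ and $\Gamma_N$, $\overline\Gamma_D\cup\overline\Gamma_N=\partial\Omega$; $I=(0,T)$, $0<T<\infty$; $Q=I\times\Omega$. $V=W^{1,2}_D(\Omega)$ (zero trace on $\Gamma_D$) with norm $\|v\|_V=\|\nabla v\|_{L^2(\Omega)}$, $V^*$ with the dual norm, $H=L^2(\Omega)$, $Y=Y^*=L^2(\Omega;\mathbb{R}^d)$. $V\hookrightarrow H\cong H^*\hookrightarrow V^*$ is the usual evolution triple and $\mathcal{W}(I)=\{v\in L^2(I;V)\mid\partial_tv\in L^2(I;V^* )\}\hookrightarrow C^0(\overline I;H)$. $L=\nabla\colon V\to Y$, $\langle L^*y,v\rangle_V=\int_\Omega y\cdot\nabla v\,dx$; $-\Delta=L^*\circ\nabla\colon V\to V^*$ (pointwise in time). $\|\cdot\|_Q$ is the $L^2(Q)$-norm. Obstacle: $\zeta\in L^2(I;V)\cap C^0(\overline I;H)$, $K(t)=\{v\in V\mid v\ge\zeta(t)\text{ a.e. in }\Omega\}$, $\chi_{K(t)}$ is the indicator functional of $K(t)$ on $V$ ($0$ on $K(t)$, $+\infty$ elsewhere), $\chi_{K(t)}^*$ its Fenchel conjugate on $V^*$, and $I_{\chi_K^*}(v^* )=\int_I\chi_{K(t)}^*(v^*(t))\,dt$ for $v^*\in L^2(I;V^* )$. Equivalently, $I_{\chi_K^*}(v^* )=\langle v^*,\zeta\rangle_{L^2(I;V)}$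 if for a.e. $t$ one has $\langle v^*(t),w\rangle_V\le0$ for all $w\in V$ with $w\ge0$ a.e., and $+\infty$ otherwise; it is the Fenchel conjugate of $v\mapsto I_{\chi_K}(v)=\int_I\chi_{K(t)}(v(t))\,dt$ on $L^2(I;V)$. Problem: $f\in L^2(I;V^* )$, $u_0\in K(0)$. It is assumed that there is a solution $u\in\mathcal{W}(I)$ of $\partial_tu(t)+(-\Delta)u(t)+N_{K(t)}(u(t))\ni f(t)$ in $V^*$ for a.e. $t\in I$, $u(0)=u_0$ in $H$, where $N_{K(t)}(v)=\partial\chi_{K(t)}(v)$ is the normal cone; hence $\Lambda(t)\in N_{K(t)}(u(t))$ for a.e. $t\in I$. *)

theory Defs
  imports "HOL-Analysis.Analysis" "HOL-Library.Function_Algebras"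
begin

text \<open>
  Elements of Lebesgue, Sobolev, dual and Bochner spaces are represented by functions rather than
  by equivalence classes: a space is a carrier set together with a seminorm whose kernel is the
  equality of the space (equality almost everywhere; agreement on \<open>V\<close> for functionals).
  Function types carry their pointwise vector operations.
\<close>

subsection \<open>Square-integrable functions\<close>

definition L2 :: "'c measure \<Rightarrow> ('c \<Rightarrow> 'b::euclidean_space) set" where
  "L2 M = {f. f \<in> borel_measurable M \<and> integrable M (\<lambda>x. (norm (f x))\<^sup>2)}"

definition L2_norm :: "'c measure \<Rightarrow> ('c \<Rightarrow> 'b::euclidean_space) \<Rightarrow> real" where
  "L2_norm M f = sqrt (\<integral>x. (norm (f x))\<^sup>2 \<partial>M)"

definition L2_tendsto ::
    "'c measure \<Rightarrow> (nat \<Rightarrow> 'c \<Rightarrow> 'b::euclidean_space) \<Rightarrow> ('c \<Rightarrow> 'b) \<Rightarrow> bool" where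
  "L2_tendsto M F f \<longleftrightarrow>
     (\<forall>n. F n \<in> L2 M) \<and> f \<in> L2 M \<and> (\<lambda>n. L2_norm M (F n - f)) \<longlonglongrightarrow> 0"

subsection \<open>Smooth functions and weak gradients\<close>

fun Ck :: "nat \<Rightarrow> ('a::euclidean_space \<Rightarrow> real) \<Rightarrow> bool" where
  "Ck 0 f \<longleftrightarrow> continuous_on UNIV f"
| "Ck (Suc k) f \<longleftrightarrow>
     (\<forall>x. f differentiable at x) \<and> (\<forall>b\<in>Basis. Ck k (\<lambda>x. frechet_derivative f (at x) b))"

definition smooth :: "('a::euclidean_space \<Rightarrow> real) \<Rightarrow> bool" where
  "smooth f \<longleftrightarrow> (\<forall>k. Ck k f)"

definition test_functions :: "'a::euclidean_space set \<Rightarrow> ('a \<Rightarrow> real) set" where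
  "test_functions \<Omega> = {\<phi>. smooth \<phi> \<and> (\<exists>C. compact C \<and> C \<subseteq> \<Omega> \<and> (\<forall>x. x \<notin> C \<longrightarrow> \<phi> x = 0))}"

definition grad :: "('a::euclidean_space \<Rightarrow> real) \<Rightarrow> 'a \<Rightarrow> 'a" where
  "grad \<phi> x = (\<Sum>b\<in>Basis. frechet_derivative \<phi> (at x) b *\<^sub>R b)"

definition is_weak_grad :: "'a::euclidean_space set \<Rightarrow> ('a \<Rightarrow> real) \<Rightarrow> ('a \<Rightarrow> 'a) \<Rightarrow> bool" where
  "is_weak_grad \<Omega> v g \<longleftrightarrow>
     (\<forall>\<phi>\<in>test_functions \<Omega>. \<forall>b\<in>Basis.
        (\<integral>x. v x * (grad \<phi> x \<bullet> b) \<partial>lebesgue_on \<Omega>) = - (\<integral>x. (g x \<bullet> b) * \<phi> x \<partial>lebesgue_on \<Omega>))"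

definition W12 :: "'a::euclidean_space set \<Rightarrow> ('a \<Rightarrow> real) set" where
  "W12 \<Omega> = {v \<in> L2 (lebesgue_on \<Omega>). \<exists>g \<in> L2 (lebesgue_on \<Omega>). is_weak_grad \<Omega> v g}"

text \<open>A representative of the weak gradient, which is unique up to null sets.\<close>

definition wgrad :: "'a::euclidean_space set \<Rightarrow> ('a \<Rightarrow> real) \<Rightarrow> 'a \<Rightarrow> 'a" where
  "wgrad \<Omega> v = (SOME g. g \<in> L2 (lebesgue_on \<Omega>) \<and> is_weak_grad \<Omega> v g)"

subsection \<open>Lipschitz domains, surface measure and traces\<close>

text \<open>
  Near each boundary point, \<open>\<Omega>\<close> is the strict epigraph, in some direction \<open>\<nu>\<close>, of a Lipschitz
  function of the component orthogonal to \<open>\<nu>\<close>.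
\<close>

definition bounded_lipschitz_domain :: "'a::euclidean_space set \<Rightarrow> bool" where
  "bounded_lipschitz_domain \<Omega> \<longleftrightarrow>
     \<Omega> \<noteq> {} \<and> open \<Omega> \<and> connected \<Omega> \<and> bounded \<Omega> \<and>
     (\<forall>x0\<in>frontier \<Omega>. \<exists>\<nu> r \<gamma> L. norm \<nu> = 1 \<and> 0 < r \<and> L-lipschitz_on UNIV (\<gamma> :: 'a \<Rightarrow> real) \<and>
        \<Omega> \<inter> ball x0 r = {x \<in> ball x0 r. \<gamma> (x - (x \<bullet> \<nu>) *\<^sub>R \<nu>) < x \<bullet> \<nu>})"

definition boundary_split :: "'a::euclidean_space set \<Rightarrow> 'a set \<Rightarrow> 'a set \<Rightarrow> bool" where
  "boundary_split \<Omega> \<Gamma>D \<Gamma>N \<longleftrightarrow>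
     openin (top_of_set (frontier \<Omega>)) \<Gamma>D \<and> openin (top_of_set (frontier \<Omega>)) \<Gamma>N \<and>
     \<Gamma>D \<inter> \<Gamma>N = {} \<and> \<Gamma>D \<noteq> {} \<and> closure \<Gamma>D \<union> closure \<Gamma>N = frontier \<Omega>"

text \<open>
  \<open>s\<close>-dimensional Hausdorff measure, normalised to agree with \<open>s\<close>-dimensional volume.  For
  \<open>s = 0\<close> it counts points, since \<open>0 ^ 0 = 1\<close>; hence the separate treatment of empty covering sets.
\<close>

definition hausdorff_weight :: "nat \<Rightarrow> 'a::euclidean_space set \<Rightarrow> ennreal" where
  "hausdorff_weight s C =
     (if C = {} then 0 else ennreal (unit_ball_vol (real s) * (diameter C / 2) ^ s))"

definition hausdorff_outer :: "nat \<Rightarrow> 'a::euclidean_space set \<Rightarrow> ennreal" where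
  "hausdorff_outer s A =
     (SUP \<delta>\<in>{0<..}. INF C\<in>{C :: nat \<Rightarrow> 'a set.
          A \<subseteq> (\<Union>i. C i) \<and> (\<forall>i. bounded (C i) \<and> diameter (C i) \<le> \<delta>)}.
        (\<Sum>i. hausdorff_weight s (C i)))"

definition hausdorff_measure :: "nat \<Rightarrow> 'a::euclidean_space measure" where
  "hausdorff_measure s = measure_of UNIV (sets borel) (hausdorff_outer s)"

definition surface :: "'a::euclidean_space set \<Rightarrow> 'a measure" where
  "surface \<Omega> = restrict_space (hausdorff_measure (DIM('a) - 1)) (frontier \<Omega>)"

text \<open>
  The trace operator \<open>W\<^sup>1\<^sup>,\<^sup>2(\<Omega>) \<rightarrow> L\<^sup>2(\<partial>\<Omega>)\<close> is the continuous extension of the restriction to the boundary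
  from the dense subspace of functions that are smooth up to the boundary; here it is given by its graph.
\<close>

definition is_trace :: "'a::euclidean_space set \<Rightarrow> ('a \<Rightarrow> real) \<Rightarrow> ('a \<Rightarrow> real) \<Rightarrow> bool" where
  "is_trace \<Omega> v g \<longleftrightarrow>
     (\<exists>\<phi>. (\<forall>n. smooth (\<phi> n)) \<and>
        L2_tendsto (lebesgue_on \<Omega>) \<phi> v \<and>
        L2_tendsto (lebesgue_on \<Omega>) (\<lambda>n. grad (\<phi> n)) (wgrad \<Omega> v) \<and>
        L2_tendsto (surface \<Omega>) \<phi> g)"

subsection \<open>The space \<open>V = W\<^sup>1\<^sup>,\<^sup>2\<^sub>D(\<Omega>)\<close>, its dual and the operator \<open>L\<^sup>*\<close>\<close>

definition V :: "'a::euclidean_space set \<Rightarrow> 'a set \<Rightarrow> ('a \<Rightarrow> real) set" where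
  "V \<Omega> \<Gamma>D = {v \<in> W12 \<Omega>. \<exists>g. is_trace \<Omega> v g \<and> (AE x in surface \<Omega>. x \<in> \<Gamma>D \<longrightarrow> g x = 0)}"

definition V_norm :: "'a::euclidean_space set \<Rightarrow> ('a \<Rightarrow> real) \<Rightarrow> real" where
  "V_norm \<Omega> v = L2_norm (lebesgue_on \<Omega>) (wgrad \<Omega> v)"

definition V_dual :: "'a::euclidean_space set \<Rightarrow> 'a set \<Rightarrow> (('a \<Rightarrow> real) \<Rightarrow> real) set" where
  "V_dual \<Omega> \<Gamma>D =
     {F. (\<forall>v\<in>V \<Omega> \<Gamma>D. \<forall>w\<in>V \<Omega> \<Gamma>D. F (v + w) = F v + F w) \<and>
         (\<forall>c. \<forall>v\<in>V \<Omega> \<Gamma>D. F (\<lambda>x. c * v x) = c * F v) \<and>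
         (\<exists>C. \<forall>v\<in>V \<Omega> \<Gamma>D. \<bar>F v\<bar> \<le> C * V_norm \<Omega> v)}"

definition V_dual_norm :: "'a::euclidean_space set \<Rightarrow> 'a set \<Rightarrow> (('a \<Rightarrow> real) \<Rightarrow> real) \<Rightarrow> real" where
  "V_dual_norm \<Omega> \<Gamma>D F = (SUP v\<in>{v \<in> V \<Omega> \<Gamma>D. V_norm \<Omega> v \<le> 1}. \<bar>F v\<bar>)"

definition Lstar :: "'a::euclidean_space set \<Rightarrow> ('a \<Rightarrow> 'a) \<Rightarrow> ('a \<Rightarrow> real) \<Rightarrow> real" where
  "Lstar \<Omega> y = (\<lambda>v. \<integral>x. y x \<bullet> wgrad \<Omega> v x \<partial>lebesgue_on \<Omega>)"

definition neg_laplace :: "'a::euclidean_space set \<Rightarrow> ('a \<Rightarrow> real) \<Rightarrow> ('a \<Rightarrow> real) \<Rightarrow> real" where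
  "neg_laplace \<Omega> v = Lstar \<Omega> (wgrad \<Omega> v)"

subsection \<open>Bochner spaces over \<open>I = (0, T)\<close>\<close>

definition strongly_measurable :: "real \<Rightarrow> 'b::minus set \<Rightarrow> ('b \<Rightarrow> real) \<Rightarrow> (real \<Rightarrow> 'b) \<Rightarrow> bool" where
  "strongly_measurable T X N f \<longleftrightarrow>
     (\<exists>s. (\<forall>n. simple_function (lebesgue_on {0<..<T}) (s n) \<and> (\<forall>t\<in>{0<..<T}. s n t \<in> X)) \<and>
          (AE t in lebesgue_on {0<..<T}. (\<lambda>n. N (f t - s n t)) \<longlonglongrightarrow> 0))"

definition bochner_L2 :: "real \<Rightarrow> 'b::minus set \<Rightarrow> ('b \<Rightarrow> real) \<Rightarrow> (real \<Rightarrow> 'b) set" where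
  "bochner_L2 T X N =
     {f. (AE t in lebesgue_on {0<..<T}. f t \<in> X) \<and> strongly_measurable T X N f \<and>
         integrable (lebesgue_on {0<..<T}) (\<lambda>t. (N (f t))\<^sup>2)}"

definition bochner_norm :: "real \<Rightarrow> ('b \<Rightarrow> real) \<Rightarrow> (real \<Rightarrow> 'b) \<Rightarrow> real" where
  "bochner_norm T N f = sqrt (\<integral>t. (N (f t))\<^sup>2 \<partial>lebesgue_on {0<..<T})"

definition L2V :: "real \<Rightarrow> 'a::euclidean_space set \<Rightarrow> 'a set \<Rightarrow> (real \<Rightarrow> 'a \<Rightarrow> real) set" where
  "L2V T \<Omega> \<Gamma>D = bochner_L2 T (V \<Omega> \<Gamma>D) (V_norm \<Omega>)"

definition L2V_dual ::
    "real \<Rightarrow> 'a::euclidean_space set \<Rightarrow> 'a set \<Rightarrow> (real \<Rightarrow> ('a \<Rightarrow> real) \<Rightarrow> real) set" where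
  "L2V_dual T \<Omega> \<Gamma>D = bochner_L2 T (V_dual \<Omega> \<Gamma>D) (V_dual_norm \<Omega> \<Gamma>D)"

definition L2V_dual_norm ::
    "real \<Rightarrow> 'a::euclidean_space set \<Rightarrow> 'a set \<Rightarrow> (real \<Rightarrow> ('a \<Rightarrow> real) \<Rightarrow> real) \<Rightarrow> real" where
  "L2V_dual_norm T \<Omega> \<Gamma>D = bochner_norm T (V_dual_norm \<Omega> \<Gamma>D)"

definition L2Y :: "real \<Rightarrow> 'a::euclidean_space set \<Rightarrow> (real \<Rightarrow> 'a \<Rightarrow> 'a) set" where
  "L2Y T \<Omega> = bochner_L2 T (L2 (lebesgue_on \<Omega>)) (L2_norm (lebesgue_on \<Omega>))"

text \<open>
  The norm of \<open>L\<^sup>2(Q; \<real>\<^sup>d) = L\<^sup>2(I; Y)\<close> as an iterated integral: pointwise in time the representatives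
  are only fixed up to null sets, so they need not be jointly measurable on \<open>Q = I \<times> \<Omega>\<close>.
\<close>

definition Q_norm :: "real \<Rightarrow> 'a::euclidean_space set \<Rightarrow> (real \<Rightarrow> 'a \<Rightarrow> 'a) \<Rightarrow> real" where
  "Q_norm T \<Omega> = bochner_norm T (L2_norm (lebesgue_on \<Omega>))"

definition pairing :: "real \<Rightarrow> (real \<Rightarrow> ('a \<Rightarrow> real) \<Rightarrow> real) \<Rightarrow> (real \<Rightarrow> 'a \<Rightarrow> real) \<Rightarrow> real" where
  "pairing T F v = (\<integral>t. F t (v t) \<partial>lebesgue_on {0<..<T})"

definition C0H :: "real \<Rightarrow> 'a::euclidean_space set \<Rightarrow> (real \<Rightarrow> 'a \<Rightarrow> real) set" where
  "C0H T \<Omega> =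
     {v. \<forall>t\<in>{0..T}. v t \<in> L2 (lebesgue_on \<Omega>) \<and>
          ((\<lambda>s. L2_norm (lebesgue_on \<Omega>) (v s - v t)) \<longlongrightarrow> 0) (at t within {0..T})}"

subsection \<open>Weak time derivatives and \<open>\<W>(I)\<close>\<close>

text \<open>
  \<open>\<partial>\<^sub>t v = v'\<close> in \<open>L\<^sup>2(I; V\<^sup>*)\<close>, where \<open>h \<in> H\<close> is identified with the functional
  \<open>w \<mapsto> \<integral>\<^sub>\<Omega> h w\<close> on \<open>V\<close>.
\<close>

definition is_time_deriv :: "real \<Rightarrow> 'a::euclidean_space set \<Rightarrow> 'a set \<Rightarrow>
    (real \<Rightarrow> 'a \<Rightarrow> real) \<Rightarrow> (real \<Rightarrow> ('a \<Rightarrow> real) \<Rightarrow> real) \<Rightarrow> bool" where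
  "is_time_deriv T \<Omega> \<Gamma>D v v' \<longleftrightarrow>
     v' \<in> L2V_dual T \<Omega> \<Gamma>D \<and>
     (\<forall>\<phi>\<in>test_functions {0<..<T}. \<forall>w\<in>V \<Omega> \<Gamma>D.
        (\<integral>t. deriv \<phi> t * (\<integral>x. v t x * w x \<partial>lebesgue_on \<Omega>) \<partial>lebesgue_on {0<..<T}) =
        - (\<integral>t. \<phi> t * v' t w \<partial>lebesgue_on {0<..<T}))"

text \<open>
  Since \<open>\<W>(I)\<close> embeds into \<open>C\<^sup>0([0, T]; H)\<close>, its elements are represented by their
  continuous representatives; this gives meaning to \<open>v 0\<close> and \<open>v T\<close>.
\<close>

definition W :: "real \<Rightarrow> 'a::euclidean_space set \<Rightarrow> 'a set \<Rightarrow> (real \<Rightarrow> 'a \<Rightarrow> real) set" where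
  "W T \<Omega> \<Gamma>D = {v \<in> L2V T \<Omega> \<Gamma>D \<inter> C0H T \<Omega>. \<exists>v'. is_time_deriv T \<Omega> \<Gamma>D v v'}"

text \<open>A representative of the time derivative, which is unique for almost every time.\<close>

definition time_deriv :: "real \<Rightarrow> 'a::euclidean_space set \<Rightarrow> 'a set \<Rightarrow>
    (real \<Rightarrow> 'a \<Rightarrow> real) \<Rightarrow> real \<Rightarrow> ('a \<Rightarrow> real) \<Rightarrow> real" where
  "time_deriv T \<Omega> \<Gamma>D v = (SOME v'. is_time_deriv T \<Omega> \<Gamma>D v v')"

subsection \<open>Convex analysis on \<open>V\<close> and the obstacle problem\<close>

definition obstacle_set :: "'a::euclidean_space set \<Rightarrow> 'a set \<Rightarrow> ('a \<Rightarrow> real) \<Rightarrow> ('a \<Rightarrow> real) set" where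
  "obstacle_set \<Omega> \<Gamma>D z = {v \<in> V \<Omega> \<Gamma>D. AE x in lebesgue_on \<Omega>. z x \<le> v x}"

definition chi :: "'b set \<Rightarrow> 'b \<Rightarrow> ereal" where
  "chi K v = (if v \<in> K then 0 else \<infinity>)"

definition fenchel_conj :: "'b set \<Rightarrow> ('b \<Rightarrow> ereal) \<Rightarrow> ('b \<Rightarrow> real) \<Rightarrow> ereal" where
  "fenchel_conj X \<Phi> F = (SUP v\<in>X. ereal (F v) - \<Phi> v)"

definition subdiff :: "'a::euclidean_space set \<Rightarrow> 'a set \<Rightarrow>
    (('a \<Rightarrow> real) \<Rightarrow> ereal) \<Rightarrow> ('a \<Rightarrow> real) \<Rightarrow> (('a \<Rightarrow> real) \<Rightarrow> real) set" where
  "subdiff \<Omega> \<Gamma>D \<Phi> v =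
     {F \<in> V_dual \<Omega> \<Gamma>D. v \<in> V \<Omega> \<Gamma>D \<and> \<bar>\<Phi> v\<bar> \<noteq> \<infinity> \<and>
        (\<forall>w\<in>V \<Omega> \<Gamma>D. \<Phi> v + ereal (F (w - v)) \<le> \<Phi> w)}"

definition normal_cone :: "'a::euclidean_space set \<Rightarrow> 'a set \<Rightarrow>
    ('a \<Rightarrow> real) set \<Rightarrow> ('a \<Rightarrow> real) \<Rightarrow> (('a \<Rightarrow> real) \<Rightarrow> real) set" where
  "normal_cone \<Omega> \<Gamma>D K v = subdiff \<Omega> \<Gamma>D (chi K) v"

text \<open>
  Integral of an extended-real function, equal to \<open>\<infinity>\<close> whenever the positive part has infinite
  integral (note that \<open>\<infinity> - \<infinity> = \<infinity>\<close> in type \<open>ereal\<close>).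
\<close>

definition ext_integral :: "'c measure \<Rightarrow> ('c \<Rightarrow> ereal) \<Rightarrow> ereal" where
  "ext_integral M g =
     enn2ereal (\<integral>\<^sup>+t. e2ennreal (g t) \<partial>M) - enn2ereal (\<integral>\<^sup>+t. e2ennreal (- g t) \<partial>M)"

definition I_conj :: "real \<Rightarrow> 'a::euclidean_space set \<Rightarrow> 'a set \<Rightarrow>
    (real \<Rightarrow> 'a \<Rightarrow> real) \<Rightarrow> (real \<Rightarrow> ('a \<Rightarrow> real) \<Rightarrow> real) \<Rightarrow> ereal" where
  "I_conj T \<Omega> \<Gamma>D \<zeta> F =
     ext_integral (lebesgue_on {0<..<T})
       (\<lambda>t. fenchel_conj (V \<Omega> \<Gamma>D) (chi (obstacle_set \<Omega> \<Gamma>D (\<zeta> t))) (F t))"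

text \<open>
  The inclusion \<open>\<partial>\<^sub>t u + (-\<Delta>) u + N\<^sub>K(u) \<ni> f\<close> with equality in \<open>V\<^sup>*\<close>, i.e. tested with
  all \<open>w \<in> V\<close>.
\<close>

definition obstacle_solution :: "real \<Rightarrow> 'a::euclidean_space set \<Rightarrow> 'a set \<Rightarrow>
    (real \<Rightarrow> 'a \<Rightarrow> real) \<Rightarrow> (real \<Rightarrow> ('a \<Rightarrow> real) \<Rightarrow> real) \<Rightarrow> ('a \<Rightarrow> real) \<Rightarrow>
    (real \<Rightarrow> 'a \<Rightarrow> real) \<Rightarrow> bool" where
  "obstacle_solution T \<Omega> \<Gamma>D \<zeta> f u0 u \<longleftrightarrow>
     u \<in> W T \<Omega> \<Gamma>D \<and>
     (AE t in lebesgue_on {0<..<T}.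
        \<exists>\<xi>\<in>normal_cone \<Omega> \<Gamma>D (obstacle_set \<Omega> \<Gamma>D (\<zeta> t)) (u t).
          \<forall>w\<in>V \<Omega> \<Gamma>D. time_deriv T \<Omega> \<Gamma>D u t w + neg_laplace \<Omega> (u t) w + \<xi> w = f t w) \<and>
     (AE x in lebesgue_on \<Omega>. u 0 x = u0 x)"

end

theory Submission
  imports Defs
begin

text \<open>
  For fixed \<open>y\<close>, expanding the squares shows that the integrands of the two functionals of \<open>y\<close>
  differ, at almost every time, by an expression free of \<open>y\<close>, namely
  \<open>1/2 \<parallel>\<nabla>(v - u)\<parallel>\<^sup>2 - \<langle>\<Lambda>, v - u\<rangle> + \<langle>\<partial>\<^sub>t(v - u), v - u\<rangle>\<close>.  The last term integrates to
  \<open>1/2 \<parallel>(v - u)(T)\<parallel>\<^sup>2\<close> by the energy identity in \<open>\<W>(I)\<close>.  With \<open>w = v - u\<close>, that identity holds because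
  \<open>\<Phi>(t) = \<parallel>w(t)\<parallel>\<^sup>2 - 2 \<integral>\<^sub>0\<^sup>t \<langle>\<partial>\<^sub>t w, w\<rangle>\<close> changes over \<open>[t, t']\<close> by at most
  \<open>\<integral> \<parallel>\<partial>\<^sub>t w(s)\<parallel> (\<parallel>w(s) - w(t)\<parallel> + \<parallel>w(s) - w(t')\<parallel>) ds\<close>, which is negligible on average, translations being
  continuous in \<open>L\<^sup>2(I; V)\<close>.  The two infima over \<open>y\<close> and \<open>\<eta>\<close> agree since \<open>\<parallel>L\<^sup>* y\<parallel> \<le> \<parallel>y\<parallel>\<close>, with equality
  for a Riesz representative \<open>y\<close>.
\<close>

subsection \<open>Smooth functions\<close>

text \<open>The obstacle is that \<open>w(t)\<close> lies in \<open>V\<close> only for almost every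
  \<open>t\<close>, and that the chosen representatives need not be jointly measurable in time and
  space. What the weak derivative does provide is the increment of the inner product of
  \<open>w\<close> with one fixed \<open>z\<close> in \<open>V\<close>; the choice
  \<open>z = w(t) + w(t')\<close> turns it into the increment of the squared norm. Hence the
  argument compares pairs of good times, and smallness is asked only of averages over
  \<open>t\<close>. Smooth functions are built from \<open>exp (- 1/x)\<close> and serve twice: as
  bumps on boxes, which make the arbitrarily chosen \<open>wgrad\<close> linear up to null sets, and
  as steps in time, which turn the weak derivative into increments. A Riesz representative is chosen
  separately at each time. Strong measurability in time survives because the difference of two
  representatives has exactly the dual norm of the difference of the functionals. The conjugate term
  may be infinite. It is the same on both sides for each \<open>y\<close>, and adding a real
  constant commutes with infima in \<open>ereal\<close>, so it never has to be evaluated.\<close>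

lemma Ck_SucI:
  fixes f :: "'a::euclidean_space \<Rightarrow> real"
  assumes "\<And>x. (f has_derivative f' x) (at x)" "\<And>b. b \<in> Basis \<Longrightarrow> Ck k (\<lambda>x. f' x b)"
  shows "Ck (Suc k) f"
proof -
  have "frechet_derivative f (at x) = f' x" for x
    using frechet_derivative_at[OF assms(1)] by simp
  with assms show ?thesis
    by (auto simp: differentiable_def)
qed

lemma Ck_SucD: "Ck (Suc k) f \<Longrightarrow> (f has_derivative frechet_derivative f (at x)) (at x)"
  by (simp add: frechet_derivative_works)

text \<open>\<open>Ck (Suc k)\<close> speaks only of differentiability and of the regularity of the
  partial derivatives, so passing to a lower order needs an induction that starts from continuity of
  differentiable functions.\<close>

lemma Ck_Suc_imp_Ck: "Ck (Suc k) f \<Longrightarrow> Ck k f"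
proof (induction k arbitrary: f)
  case 0
  then show ?case
    by (auto simp: continuous_on_eq_continuous_at differentiable_imp_continuous_within)
next
  case (Suc k)
  then show ?case by (metis Ck.simps(2))
qed

lemma Ck_const [simp]: "Ck k (\<lambda>x. c)"
  by (induction k arbitrary: c) auto

lemma Ck_add: "Ck k f \<Longrightarrow> Ck k g \<Longrightarrow> Ck k (\<lambda>x. f x + g x)"
proof (induction k arbitrary: f g)
  case 0
  then show ?case by (auto intro: continuous_on_add)
next
  case (Suc k)
  show ?case
    by (rule Ck_SucI[OF has_derivative_add[OF Ck_SucD[OF Suc.prems(1)] Ck_SucD[OF Suc.prems(2)]]])
      (use Suc in auto)
qed

lemma Ck_mult: "Ck k f \<Longrightarrow> Ck k g \<Longrightarrow> Ck k (\<lambda>x. f x * g x)"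
proof (induction k arbitrary: f g)
  case 0
  then show ?case by (auto intro: continuous_on_mult)
next
  case (Suc k)
  show ?case
    by (rule Ck_SucI[OF has_derivative_mult[OF Ck_SucD[OF Suc.prems(1)] Ck_SucD[OF Suc.prems(2)]]])
      (use Suc Ck_Suc_imp_Ck[OF Suc.prems(1)] Ck_Suc_imp_Ck[OF Suc.prems(2)] in
        \<open>auto intro!: Ck_add Suc.IH\<close>)
qed

lemma Ck_cmult: "Ck k f \<Longrightarrow> Ck k (\<lambda>x. c * f x)"
  by (rule Ck_mult) auto

lemma Ck_uminus: "Ck k f \<Longrightarrow> Ck k (\<lambda>x. - f x)"
  using Ck_cmult[of k f "-1"] by simp

lemma Ck_prod: "(\<And>i. i \<in> I \<Longrightarrow> Ck k (f i)) \<Longrightarrow> Ck k (\<lambda>x. \<Prod>i\<in>I. f i x)"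
  by (induction I rule: infinite_finite_induct) (auto intro!: Ck_mult)

lemma Ck_inverse: "Ck k f \<Longrightarrow> (\<And>x. f x \<noteq> 0) \<Longrightarrow> Ck k (\<lambda>x. inverse (f x))"
proof (induction k arbitrary: f)
  case 0
  then show ?case by (auto intro: continuous_on_inverse)
next
  case (Suc k)
  \<comment> \<open>The derivative of \<open>1/f\<close> contains \<open>1/f\<close> again as a
    factor; its regularity of order \<open>k\<close> is the induction hypothesis for the same
    \<open>f\<close>.\<close>
  note inv = Suc.IH[OF Ck_Suc_imp_Ck[OF Suc.prems(1)] Suc.prems(2)]
  show ?case
    by (rule Ck_SucI[OF Deriv.has_derivative_inverse[OF Suc.prems(2) Ck_SucD[OF Suc.prems(1)]]])
      (use Suc in \<open>auto intro!: Ck_uminus Ck_mult inv\<close>)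
qed

lemma Ck_real_derivI:
  fixes \<phi> :: "real \<Rightarrow> real"
  assumes "\<And>x. (\<phi> has_real_derivative \<phi>' x) (at x)" "Ck k \<phi>'"
  shows "Ck (Suc k) \<phi>"
  by (rule Ck_SucI[OF assms(1)[unfolded has_field_derivative_def]]) (use assms in auto)

lemma Ck_real_derivD:
  fixes \<phi> :: "real \<Rightarrow> real"
  assumes "Ck (Suc k) \<phi>"
  shows "(\<phi> has_real_derivative deriv \<phi> x) (at x)" "Ck k (deriv \<phi>)"
proof -
  have *: "(\<phi> has_real_derivative frechet_derivative \<phi> (at x) 1) (at x)" for x
  proof -
    have "linear (frechet_derivative \<phi> (at x))"
      using Ck_SucD[OF assms] has_derivative_linear by blast
    then have "frechet_derivative \<phi> (at x) = (*) (frechet_derivative \<phi> (at x) 1)"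
      by (metis (no_types, opaque_lifting) ext linear_scale mult.commute mult.right_neutral real_scaleR_def)
    then show ?thesis
      using Ck_SucD[OF assms, of x] by (simp add: has_field_derivative_def)
  qed
  then show "(\<phi> has_real_derivative deriv \<phi> x) (at x)"
    using DERIV_imp_deriv by metis
  have "deriv \<phi> = (\<lambda>x. frechet_derivative \<phi> (at x) 1)"
    using * DERIV_imp_deriv by blast
  then show "Ck k (deriv \<phi>)"
    using assms by simp
qed

text \<open>Carries one-dimensional profiles to functions on the whole space. The chain rule
  reproduces the same shape with \<open>deriv \<phi>\<close>, hence the induction over arbitrary
  \<open>\<phi>\<close>.\<close>

lemma Ck_compose_affine:
  fixes \<phi> :: "real \<Rightarrow> real" and a :: "'a::euclidean_space"
  shows "Ck k \<phi> \<Longrightarrow> Ck k (\<lambda>x. \<phi> (x \<bullet> a + c))"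
proof (induction k arbitrary: \<phi>)
  case 0
  then show ?case
    by (auto intro!: continuous_intros continuous_on_compose2[of UNIV \<phi>])
next
  case (Suc k)
  have "((\<lambda>x. x \<bullet> a + c) has_derivative (\<lambda>h. h \<bullet> a)) (at x)" for x
    by (auto intro!: derivative_eq_intros)
  from has_derivative_compose[OF this Ck_real_derivD(1)[OF Suc.prems, unfolded has_field_derivative_def]]
  have "((\<lambda>x. \<phi> (x \<bullet> a + c)) has_derivative (\<lambda>h. deriv \<phi> (x \<bullet> a + c) * (h \<bullet> a))) (at x)" for x
    by simp
  moreover have "Ck k (\<lambda>x. deriv \<phi> (x \<bullet> a + c) * (b \<bullet> a))" for b
    by (intro Ck_mult Suc.IH[OF Ck_real_derivD(2)[OF Suc.prems]]) auto
  ultimately show ?case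
    by (rule Ck_SucI)
qed

text \<open>The case \<open>n = 0\<close> is the classical flat function \<open>exp (- 1/x)\<close>.
  The powers of \<open>1/x\<close> are those that its derivatives produce, so that the whole family
  is closed under differentiation and one induction shows all members smooth.\<close>

definition exp_flat :: "nat \<Rightarrow> real \<Rightarrow> real" where
  "exp_flat n x = (if 0 < x then inverse x ^ n * exp (- inverse x) else 0)"

text \<open>From the right, the substitution \<open>y = 1/x\<close> turns this into the decay of
  \<open>y^n / exp y\<close> at infinity.\<close>

lemma exp_flat_tendsto_0: "(exp_flat n \<longlongrightarrow> 0) (at 0)"
proof -
  have "((\<lambda>y::real. y ^ n / exp y) \<longlongrightarrow> 0) at_top"
    by (rule tendsto_power_div_exp_0)
  then have "((\<lambda>x::real. inverse x ^ n / exp (inverse x)) \<longlongrightarrow> 0) (at_right 0)"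
    by (rule filterlim_compose[OF _ filterlim_inverse_at_top_right])
  then have "(exp_flat n \<longlongrightarrow> 0) (at_right 0)"
    by (rule Lim_transform_eventually)
      (auto simp: exp_flat_def exp_minus divide_inverse
        intro: eventually_mono[OF eventually_at_right_less])
  moreover have "(exp_flat n \<longlongrightarrow> 0) (at_left 0)"
    by (rule Lim_transform_eventually[of "\<lambda>_. 0"])
      (auto simp: exp_flat_def eventually_at_filter)
  ultimately show ?thesis
    by (simp add: filterlim_at_split)
qed

lemma exp_flat_deriv:
  "(exp_flat n has_real_derivative exp_flat (Suc (Suc n)) x - real n * exp_flat (Suc n) x) (at x)"
proof -
  consider "0 < x" | "x = 0" | "x < 0" by linarith
  then show ?thesis
  proof cases
    case 1
    have "((\<lambda>x. inverse x ^ n * exp (- inverse x)) has_real_derivative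
        exp_flat (Suc (Suc n)) x - real n * exp_flat (Suc n) x) (at x)"
      using 1
      by (cases n)
        (auto intro!: derivative_eq_intros simp: exp_flat_def algebra_simps,
          metis One_nat_def Suc_pred neq0_conv power_Suc)
    moreover have "eventually (\<lambda>y. y > 0) (nhds x)"
      using 1 by (simp add: eventually_nhds_in_open[of "{0<..}" x, simplified])
    ultimately show ?thesis
      by (subst DERIV_cong_ev[OF refl _ refl, of _ "\<lambda>x. inverse x ^ n * exp (- inverse x)"])
        (auto simp: exp_flat_def elim!: eventually_mono)
  next
    case 2
    \<comment> \<open>At the origin the difference quotient of one member is the next member of the
      family, whose limit is already known.\<close>
    have "(\<lambda>h. (exp_flat n (0 + h) - exp_flat n 0) / h) = exp_flat (Suc n)"
      by (auto simp: exp_flat_def fun_eq_iff field_simps)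
    then have "(exp_flat n has_real_derivative 0) (at 0)"
      using exp_flat_tendsto_0[of "Suc n"] unfolding DERIV_def by simp
    then show ?thesis
      using 2 by (simp add: exp_flat_def)
  next
    case 3
    have "eventually (\<lambda>y. y < 0) (nhds x)"
      using 3 by (simp add: eventually_nhds_in_open[of "{..<0}" x, simplified])
    then show ?thesis
      using 3 by (subst DERIV_cong_ev[OF refl _ refl, of _ "\<lambda>x. 0"])
        (auto simp: exp_flat_def elim!: eventually_mono)
  qed
qed

lemma Ck_exp_flat: "Ck k (exp_flat n)"
proof (induction k arbitrary: n)
  case 0
  then show ?case
    using exp_flat_deriv DERIV_continuous by (force simp: continuous_on_eq_continuous_at)
next
  case (Suc k)
  have "Ck k (\<lambda>x. exp_flat (Suc (Suc n)) x + - (real n * exp_flat (Suc n) x))"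
    by (intro Ck_add Ck_uminus Ck_cmult Suc.IH)
  then show ?case
    by (intro Ck_real_derivI[OF exp_flat_deriv]) simp
qed

text \<open>The usual smooth transition from 0 on the nonpositive axis to 1 beyond 1. The
  denominator is positive because \<open>x\<close> and \<open>1 - x\<close> cannot both be
  nonpositive.\<close>

definition smooth_step :: "real \<Rightarrow> real" where
  "smooth_step x = exp_flat 0 x * inverse (exp_flat 0 x + exp_flat 0 (1 - x))"

lemma exp_flat_nonneg: "0 \<le> exp_flat n x"
  by (auto simp: exp_flat_def)

lemma exp_flat_pos: "0 < x \<Longrightarrow> 0 < exp_flat n x"
  by (auto simp: exp_flat_def)

lemma smooth_step_denom_pos: "0 < exp_flat 0 x + exp_flat 0 (1 - x)"
proof (cases "0 < x")
  case True
  then show ?thesis using exp_flat_pos[of x 0] exp_flat_nonneg[of 0 "1 - x"] by linarith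
next
  case False
  then show ?thesis using exp_flat_pos[of "1 - x" 0] exp_flat_nonneg[of 0 x] by linarith
qed

lemma Ck_smooth_step: "Ck k smooth_step"
proof -
  \<comment> \<open>The reflection \<open>1 - x\<close> is the affine map with direction
    \<open>-1\<close>.\<close>
  have "Ck k (\<lambda>x::real. exp_flat 0 (x \<bullet> (-1) + 1))"
    by (intro Ck_compose_affine Ck_exp_flat)
  then have "Ck k (\<lambda>x. exp_flat 0 (1 - x))"
    by (simp add: add.commute)
  then have "Ck k (\<lambda>x. exp_flat 0 x * inverse (exp_flat 0 x + exp_flat 0 (1 - x)))"
    by (intro Ck_mult Ck_inverse Ck_add Ck_exp_flat smooth_step_denom_pos[THEN less_imp_neq, THEN not_sym])
  then show ?thesis
    by (simp add: smooth_step_def[abs_def])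
qed

lemma smooth_step_eq_0: "x \<le> 0 \<Longrightarrow> smooth_step x = 0"
  by (auto simp: smooth_step_def exp_flat_def)

lemma smooth_step_eq_1: "1 \<le> x \<Longrightarrow> smooth_step x = 1"
  by (auto simp: smooth_step_def exp_flat_def)

lemma smooth_step_bounds: "0 \<le> smooth_step x" "smooth_step x \<le> 1"
  using smooth_step_denom_pos[of x] exp_flat_nonneg[of 0 x] exp_flat_nonneg[of 0 "1 - x"]
  by (auto simp: smooth_step_def field_simps)

text \<open>The shift by 1 confines the transition to the interval from \<open>1/n\<close> to
  \<open>2/n\<close>. Thus the limit is 0 at the origin itself, and cut-offs made from these steps
  have compact support inside an open interval.\<close>

lemma smooth_step_scaled_tendsto:
  "(\<lambda>n. smooth_step (real n * x - 1)) \<longlonglongrightarrow> (if 0 < x then 1 else 0)"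
proof (cases "0 < x")
  case True
  obtain m where m: "2 / x < real m" using reals_Archimedean2 by blast
  have "smooth_step (real n * x - 1) = 1" if "n \<ge> m" for n
  proof -
    have "2 / x < real n" using m that by linarith
    then show ?thesis using True by (intro smooth_step_eq_1) (simp add: field_simps)
  qed
  then have "eventually (\<lambda>n. smooth_step (real n * x - 1) = 1) sequentially"
    by (auto simp: eventually_sequentially)
  then show ?thesis using True by (simp add: tendsto_eventually)
next
  case False
  then have "real n * x - 1 \<le> 0" for n
    using mult_nonneg_nonpos[of "real n" x] by simp
  with False show ?thesis by (simp add: smooth_step_eq_0)
qed

lemma Ck_scaled_smooth_step:
  fixes a :: "'a::euclidean_space"
  shows "Ck k (\<lambda>x. smooth_step (r * (x \<bullet> a - c) - 1))"
  using Ck_compose_affine[OF Ck_smooth_step, of k "r *\<^sub>R a" "- r * c - 1"]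
  by (simp add: algebra_simps)

text \<open>Approximates the indicator of the open box from inside: each coordinate carries a step
  that rises after \<open>a\<close> and another that falls before \<open>b\<close>.\<close>

definition box_bump :: "'a::euclidean_space \<Rightarrow> 'a \<Rightarrow> nat \<Rightarrow> 'a \<Rightarrow> real" where
  "box_bump a b n x = (\<Prod>i\<in>Basis. smooth_step (real n * (x \<bullet> i - a \<bullet> i) - 1) *
     smooth_step (- real n * (x \<bullet> i - b \<bullet> i) - 1))"

lemma box_bump_bounds: "0 \<le> box_bump a b n x" "box_bump a b n x \<le> 1"
  unfolding box_bump_def
  by (auto intro!: prod_nonneg prod_le_1 mult_nonneg_nonneg mult_le_one smooth_step_bounds)

lemma box_bump_tendsto: "(\<lambda>n. box_bump a b n x) \<longlonglongrightarrow> indicator (box a b) x"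
proof -
  have *: "(\<Prod>i\<in>Basis. (if 0 < x \<bullet> i - a \<bullet> i then 1 else 0) * (if 0 < b \<bullet> i - x \<bullet> i then 1 else 0))
      = (indicator (box a b) x :: real)"
  proof (cases "x \<in> box a b")
    case True
    then show ?thesis by (auto simp: mem_box intro!: prod.neutral)
  next
    case False
    then obtain i where "i \<in> Basis" "\<not> (a \<bullet> i < x \<bullet> i \<and> x \<bullet> i < b \<bullet> i)"
      by (auto simp: mem_box)
    then show ?thesis using False by (auto intro!: prod_zero)
  qed
  have "(\<lambda>n. box_bump a b n x) \<longlonglongrightarrow>
      (\<Prod>i\<in>Basis. (if 0 < x \<bullet> i - a \<bullet> i then 1 else 0) * (if 0 < b \<bullet> i - x \<bullet> i then 1 else 0))"
    unfolding box_bump_def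
  proof (intro tendsto_prod tendsto_mult)
    show "(\<lambda>n. smooth_step (real n * (x \<bullet> i - a \<bullet> i) - 1)) \<longlonglongrightarrow> (if 0 < x \<bullet> i - a \<bullet> i then 1 else 0)" for i
      by (rule smooth_step_scaled_tendsto)
    show "(\<lambda>n. smooth_step (- real n * (x \<bullet> i - b \<bullet> i) - 1)) \<longlonglongrightarrow> (if 0 < b \<bullet> i - x \<bullet> i then 1 else 0)" for i
      using smooth_step_scaled_tendsto[of "b \<bullet> i - x \<bullet> i"] by (simp add: algebra_simps)
  qed
  then show ?thesis unfolding * .
qed

lemma box_bump_test_function:
  assumes "box a b \<subseteq> \<Omega>" "0 < n"
  shows "box_bump a b n \<in> test_functions \<Omega>"
proof -
  \<comment> \<open>Every transition starts at distance \<open>1/n\<close> from its face, so the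
    closed box shrunk by \<open>1/n\<close> on all sides is a compact set outside which the bump
    vanishes.\<close>
  define c d where "c = a + (1 / real n) *\<^sub>R One" and "d = b - (1 / real n) *\<^sub>R One"
  have "cbox c d \<subseteq> box a b"
  proof
    fix x assume x: "x \<in> cbox c d"
    have "a \<bullet> i < x \<bullet> i \<and> x \<bullet> i < b \<bullet> i" if "i \<in> Basis" for i
    proof -
      have "c \<bullet> i \<le> x \<bullet> i" "x \<bullet> i \<le> d \<bullet> i" using x that by (auto simp: mem_box)
      moreover have "a \<bullet> i < c \<bullet> i" "d \<bullet> i < b \<bullet> i"
        using that \<open>0 < n\<close> by (simp_all add: c_def d_def inner_add_left inner_diff_left)
      ultimately show ?thesis by linarith
    qed
    then show "x \<in> box a b" by (simp add: mem_box)
  qed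
  moreover have "box_bump a b n x = 0" if "x \<notin> cbox c d" for x
  proof -
    from that obtain i where i: "i \<in> Basis" "x \<bullet> i < c \<bullet> i \<or> d \<bullet> i < x \<bullet> i"
      by (auto simp: mem_box not_le)
    then have "real n * (x \<bullet> i - a \<bullet> i) - 1 \<le> 0 \<or> - real n * (x \<bullet> i - b \<bullet> i) - 1 \<le> 0"
      using \<open>0 < n\<close> by (auto simp: c_def d_def inner_add_left inner_diff_left field_simps)
    then have "smooth_step (real n * (x \<bullet> i - a \<bullet> i) - 1) *
        smooth_step (- real n * (x \<bullet> i - b \<bullet> i) - 1) = 0"
      using smooth_step_eq_0 by fastforce
    then show ?thesis
      unfolding box_bump_def using i(1) by (intro prod_zero) auto
  qed
  moreover have "smooth (box_bump a b n)"
    unfolding smooth_def box_bump_def[abs_def]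
    by (intro allI Ck_prod Ck_mult Ck_scaled_smooth_step)
  ultimately show ?thesis
    using assms unfolding test_functions_def by (auto intro!: exI[of _ "cbox c d"])
qed

section \<open>Gradients of smooth functions and bounds for test functions\<close>

lemma smooth_add: "smooth f \<Longrightarrow> smooth g \<Longrightarrow> smooth (\<lambda>x. f x + g x)"
  by (auto simp: smooth_def intro: Ck_add)

lemma smooth_cmult: "smooth f \<Longrightarrow> smooth (\<lambda>x. c * f x)"
  by (auto simp: smooth_def intro: Ck_cmult)

lemma smooth_continuous: "smooth f \<Longrightarrow> continuous_on UNIV f"
  by (metis Ck.simps(1) smooth_def)

lemma smooth_has_derivative: "smooth f \<Longrightarrow> (f has_derivative frechet_derivative f (at x)) (at x)"
  using Ck_SucD smooth_def by blast

lemma inner_grad: "b \<in> Basis \<Longrightarrow> grad \<phi> x \<bullet> b = frechet_derivative \<phi> (at x) b"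
  by (simp add: grad_def)

lemma grad_add:
  assumes "smooth f" "smooth g"
  shows "grad (\<lambda>x. f x + g x) x = grad f x + grad g x"
proof -
  have "frechet_derivative (\<lambda>x. f x + g x) (at x) =
      (\<lambda>h. frechet_derivative f (at x) h + frechet_derivative g (at x) h)"
    using has_derivative_add[OF assms[THEN smooth_has_derivative]]
    by (simp add: frechet_derivative_at[symmetric])
  then show ?thesis
    by (simp add: grad_def sum.distrib scaleR_add_left)
qed

lemma grad_cmult:
  assumes "smooth f"
  shows "grad (\<lambda>x. c * f x) x = c *\<^sub>R grad f x"
proof -
  have "frechet_derivative (\<lambda>x. c * f x) (at x) = (\<lambda>h. c * frechet_derivative f (at x) h)"
    using has_derivative_mult_right[OF smooth_has_derivative[OF assms]]
    by (simp add: frechet_derivative_at[symmetric])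
  then show ?thesis
    by (simp add: grad_def scaleR_sum_right)
qed

lemma continuous_on_inner_grad:
  assumes "smooth \<phi>" "b \<in> Basis"
  shows "continuous_on UNIV (\<lambda>x. grad \<phi> x \<bullet> b)"
proof -
  have "Ck (Suc 0) \<phi>" using assms by (simp add: smooth_def)
  then show ?thesis using assms by (simp add: inner_grad)
qed

lemma bounded_compact_support:
  fixes g :: "'a::euclidean_space \<Rightarrow> real"
  assumes "continuous_on UNIV g" "compact C" "\<And>x. x \<notin> C \<Longrightarrow> g x = 0"
  obtains B where "\<And>x. \<bar>g x\<bar> \<le> B"
proof -
  have "compact (g ` C)"
    using assms continuous_on_subset by (blast intro: compact_continuous_image)
  then obtain B where B: "\<And>x. x \<in> C \<Longrightarrow> \<bar>g x\<bar> \<le> B"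
    using compact_imp_bounded bounded_iff by (metis image_eqI real_norm_def)
  have "\<bar>g x\<bar> \<le> max B 0" for x
    using B[of x] assms(3)[of x] by (cases "x \<in> C") auto
  then show ?thesis using that by blast
qed

lemma test_functions_bounded:
  assumes "\<phi> \<in> test_functions \<Omega>"
  obtains B where "\<And>x. \<bar>\<phi> x\<bar> \<le> B"
  using assms bounded_compact_support smooth_continuous unfolding test_functions_def by blast

lemma test_functions_grad_bounded:
  assumes "\<phi> \<in> test_functions \<Omega>" "b \<in> Basis"
  obtains B where "\<And>x. \<bar>grad \<phi> x \<bullet> b\<bar> \<le> B"
proof -
  obtain C where C: "compact C" "\<And>x. x \<notin> C \<Longrightarrow> \<phi> x = 0" "smooth \<phi>"
    using assms unfolding test_functions_def by auto
  have "grad \<phi> x \<bullet> b = 0" if "x \<notin> C" for x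
  proof -
    have "open (- C)" using C compact_imp_closed by blast
    then have "(\<phi> has_derivative (\<lambda>h. 0)) (at x)"
      using has_derivative_transform_within_open[of "\<lambda>x. 0" "\<lambda>h. 0" x UNIV "- C" \<phi>] C that by auto
    then show ?thesis
      using frechet_derivative_at assms by (metis inner_grad)
  qed
  then show ?thesis
    using bounded_compact_support[OF continuous_on_inner_grad[OF C(3) assms(2)] C(1)] that by blast
qed

subsection \<open>Square-integrable functions\<close>

lemma L2_measurable [measurable_dest]: "f \<in> L2 M \<Longrightarrow> f \<in> borel_measurable M"
  by (simp add: L2_def)

lemma L2_integrable_norm_sq: "f \<in> L2 M \<Longrightarrow> integrable M (\<lambda>x. (norm (f x))\<^sup>2)"
  by (simp add: L2_def)

lemma L2I:
  "f \<in> borel_measurable M \<Longrightarrow> integrable M g \<Longrightarrow> (\<And>x. (norm (f x))\<^sup>2 \<le> g x) \<Longrightarrow> f \<in> L2 M"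
  unfolding L2_def
  by (auto intro!: Bochner_Integration.integrable_bound[of M g] AE_I2)
    (meson abs_ge_self order_trans)

lemma L2_add:
  assumes "f \<in> L2 M" "g \<in> L2 M"
  shows "f + g \<in> L2 M"
proof (rule L2I[where g = "\<lambda>x. 2 * (norm (f x))\<^sup>2 + 2 * (norm (g x))\<^sup>2"])
  show "f + g \<in> borel_measurable M"
    using assms[THEN L2_measurable] by (simp add: plus_fun_def)
  show "integrable M (\<lambda>x. 2 * (norm (f x))\<^sup>2 + 2 * (norm (g x))\<^sup>2)"
    using assms[THEN L2_integrable_norm_sq] by simp
  fix x
  have "(norm (f x + g x))\<^sup>2 \<le> (norm (f x) + norm (g x))\<^sup>2"
    by (intro power_mono norm_triangle_ineq) auto
  also have "\<dots> \<le> 2 * (norm (f x))\<^sup>2 + 2 * (norm (g x))\<^sup>2"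
    using sum_squares_bound[of "norm (f x)" "norm (g x)"] by (simp add: power2_sum)
  finally show "(norm ((f + g) x))\<^sup>2 \<le> 2 * (norm (f x))\<^sup>2 + 2 * (norm (g x))\<^sup>2"
    by simp
qed

lemma L2_scaleR:
  assumes "f \<in> L2 M"
  shows "(\<lambda>x. c *\<^sub>R f x) \<in> L2 M"
  using assms by (auto simp: L2_def power_mult_distrib)

lemma L2_uminus: "f \<in> L2 M \<Longrightarrow> - f \<in> L2 M"
  using L2_scaleR[of f M "-1"] by (simp add: fun_Compl_def)

lemma L2_diff: "f \<in> L2 M \<Longrightarrow> g \<in> L2 M \<Longrightarrow> f - g \<in> L2 M"
  using L2_add[of f M "- g"] L2_uminus[of g M] by simp

lemma L2_zero [simp]: "0 \<in> L2 M"
  by (simp add: L2_def zero_fun_def)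

lemma L2_norm_nonneg [simp]: "0 \<le> L2_norm M f"
  by (simp add: L2_norm_def)

lemma L2_norm_zero [simp]: "L2_norm M 0 = 0"
  by (simp add: L2_norm_def)

lemma L2_norm_power2: "(L2_norm M f)\<^sup>2 = (\<integral>x. (norm (f x))\<^sup>2 \<partial>M)"
  by (simp add: L2_norm_def)

lemma L2_norm_cong_AE:
  assumes "f \<in> borel_measurable M" "g \<in> borel_measurable M" "AE x in M. f x = g x"
  shows "L2_norm M f = L2_norm M g"
proof -
  have "(\<integral>x. (norm (f x))\<^sup>2 \<partial>M) = (\<integral>x. (norm (g x))\<^sup>2 \<partial>M)"
    using assms by (intro integral_cong_AE) auto
  then show ?thesis by (simp add: L2_norm_def)
qed

lemma L2_norm_scaleR: "L2_norm M (\<lambda>x. c *\<^sub>R f x) = \<bar>c\<bar> * L2_norm M f"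
  by (simp add: L2_norm_def power_mult_distrib real_sqrt_mult)

lemma L2_norm_uminus: "L2_norm M (- f) = L2_norm M f"
  by (simp add: L2_norm_def)

lemma L2_norm_minus_commute: "L2_norm M (f - g) = L2_norm M (g - f)"
  by (simp add: L2_norm_def norm_minus_commute)

lemma L2_inner_integrable:
  assumes "f \<in> L2 M" "g \<in> L2 M"
  shows "integrable M (\<lambda>x. f x \<bullet> g x)"
proof (rule Bochner_Integration.integrable_bound)
  show "integrable M (\<lambda>x. (norm (f x))\<^sup>2 + (norm (g x))\<^sup>2)"
    using assms[THEN L2_integrable_norm_sq] by simp
  show "(\<lambda>x. f x \<bullet> g x) \<in> borel_measurable M"
    using assms[THEN L2_measurable] by simp
  show "AE x in M. norm (f x \<bullet> g x) \<le> norm ((norm (f x))\<^sup>2 + (norm (g x))\<^sup>2)"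
  proof (intro AE_I2)
    fix x
    have "norm (f x \<bullet> g x) \<le> norm (f x) * norm (g x)"
      using Cauchy_Schwarz_ineq2 by simp
    also have "\<dots> \<le> (norm (f x))\<^sup>2 + (norm (g x))\<^sup>2"
      using sum_squares_bound[of "norm (f x)" "norm (g x)"]
        mult_nonneg_nonneg[OF norm_ge_zero norm_ge_zero, of "f x" "g x"] by linarith
    finally show "norm (f x \<bullet> g x) \<le> norm ((norm (f x))\<^sup>2 + (norm (g x))\<^sup>2)"
      by simp
  qed
qed

lemma L2_norm_add_power2:
  assumes "f \<in> L2 M" "g \<in> L2 M"
  shows "(L2_norm M (f + g))\<^sup>2 = (L2_norm M f)\<^sup>2 + 2 * (\<integral>x. f x \<bullet> g x \<partial>M) + (L2_norm M g)\<^sup>2"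
proof -
  have "(norm ((f + g) x))\<^sup>2 = (norm (f x))\<^sup>2 + 2 * (f x \<bullet> g x) + (norm (g x))\<^sup>2" for x
    by (simp add: power2_norm_eq_inner inner_add_left inner_add_right inner_commute)
  then show ?thesis
    using assms[THEN L2_integrable_norm_sq] L2_inner_integrable[OF assms]
    by (simp add: L2_norm_power2)
qed

lemma L2_norm_diff_power2:
  assumes "f \<in> L2 M" "g \<in> L2 M"
  shows "(L2_norm M (f - g))\<^sup>2 = (L2_norm M f)\<^sup>2 - 2 * (\<integral>x. f x \<bullet> g x \<partial>M) + (L2_norm M g)\<^sup>2"
  using L2_norm_add_power2[OF assms(1) L2_uminus[OF assms(2)]] by (simp add: L2_norm_uminus)

text \<open>The discriminant criterion. Besides the Cauchy-Schwarz inequality it yields an Euler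
  equation later on: for \<open>a = 0\<close> it forces \<open>c = 0\<close>.\<close>

lemma quadratic_nonneg_imp_le:
  fixes a b c :: real
  assumes "0 \<le> a" "0 \<le> b" "\<And>s. 0 \<le> a + 2 * s * c + s\<^sup>2 * b"
  shows "\<bar>c\<bar> \<le> sqrt a * sqrt b"
proof -
  have "c\<^sup>2 \<le> a * b"
  proof (cases "b = 0")
    case True
    have "c = 0"
    proof (rule ccontr)
      assume "c \<noteq> 0"
      \<comment> \<open>With \<open>b = 0\<close> the expression is affine in \<open>s\<close>, and
        this \<open>s\<close> gives it the value \<open>-1\<close>.\<close>
      with assms(3)[of "- (a + 1) / (2 * c)"] True show False by (simp add: field_simps)
    qed
    then show ?thesis by (simp add: True)
  next
    case False
    then have "0 < b" using assms by simp
    \<comment> \<open>The minimiser of the quadratic.\<close>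
    with assms(3)[of "- c / b"] show ?thesis by (simp add: field_simps power2_eq_square)
  qed
  then have "\<bar>c\<bar> \<le> sqrt (a * b)"
    by (metis real_sqrt_abs real_sqrt_le_mono)
  then show ?thesis by (simp add: real_sqrt_mult)
qed

lemma L2_Cauchy_Schwarz:
  assumes "f \<in> L2 M" "g \<in> L2 M"
  shows "\<bar>\<integral>x. f x \<bullet> g x \<partial>M\<bar> \<le> L2_norm M f * L2_norm M g"
proof -
  have "0 \<le> (L2_norm M f)\<^sup>2 + 2 * s * (\<integral>x. f x \<bullet> g x \<partial>M) + s\<^sup>2 * (L2_norm M g)\<^sup>2" for s
  proof -
    have "(L2_norm M (f + (\<lambda>x. s *\<^sub>R g x)))\<^sup>2 =
        (L2_norm M f)\<^sup>2 + 2 * s * (\<integral>x. f x \<bullet> g x \<partial>M) + s\<^sup>2 * (L2_norm M g)\<^sup>2"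
      using L2_norm_add_power2[OF assms(1) L2_scaleR[OF assms(2)], of s]
      by (simp add: L2_norm_scaleR power_mult_distrib)
    then show ?thesis by (metis zero_le_power2)
  qed
  from quadratic_nonneg_imp_le[OF _ _ this] show ?thesis by simp
qed

lemma L2_norm_triangle:
  assumes "f \<in> L2 M" "g \<in> L2 M"
  shows "L2_norm M (f + g) \<le> L2_norm M f + L2_norm M g"
proof (rule power2_le_imp_le)
  show "(L2_norm M (f + g))\<^sup>2 \<le> (L2_norm M f + L2_norm M g)\<^sup>2"
    using L2_norm_add_power2[OF assms] L2_Cauchy_Schwarz[OF assms] by (simp add: power2_sum)
qed simp

lemma L2_norm_triangle_diff:
  assumes "f \<in> L2 M" "g \<in> L2 M"
  shows "L2_norm M (f - g) \<le> L2_norm M f + L2_norm M g"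
  using L2_norm_triangle[OF assms(1) L2_uminus[OF assms(2)]] by (simp add: L2_norm_uminus)

lemma L2_imp_integrable:
  assumes "f \<in> L2 M" "finite_measure M"
  shows "integrable M f"
proof (rule Bochner_Integration.integrable_bound)
  interpret finite_measure M by fact
  show "integrable M (\<lambda>x. 1 + (norm (f x))\<^sup>2)"
    using L2_integrable_norm_sq[OF assms(1)] by simp
  have "y \<le> 1 + y\<^sup>2" for y :: real
    using sum_squares_bound[of y 1] zero_le_power2[of y] by (simp; linarith)
  then show "AE x in M. norm (f x) \<le> norm (1 + (norm (f x))\<^sup>2)"
    by (intro AE_I2) (simp add: order_trans[OF _ abs_ge_self])
qed (use assms in \<open>simp add: L2_measurable\<close>)

lemma L2_bounded:
  assumes "f \<in> borel_measurable M" "\<And>x. norm (f x) \<le> B" "finite_measure M"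
  shows "f \<in> L2 M"
proof (rule L2I)
  interpret finite_measure M by fact
  show "integrable M (\<lambda>x. B\<^sup>2)" by simp
qed (use assms in \<open>auto intro: power_mono\<close>)

lemma integral_norm_le_L2_norm:
  assumes "f \<in> L2 M" "finite_measure M"
  shows "(\<integral>x. norm (f x) \<partial>M) \<le> L2_norm M f * sqrt (measure M (space M))"
proof -
  interpret finite_measure M by fact
  have "(\<lambda>x. norm (f x)) \<in> L2 M" using assms by (auto simp: L2_def)
  moreover have "(\<lambda>x. 1::real) \<in> L2 M" by (simp add: L2_def)
  ultimately show ?thesis
    using L2_Cauchy_Schwarz[of "\<lambda>x. norm (f x)" M "\<lambda>x. 1::real"] by (simp add: L2_norm_def)
qed

text \<open>Riesz-Fischer. Finiteness of the measure makes the sequence Cauchy in \<open>L1\<close>,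
  which supplies a subsequence converging almost everywhere; Fatou's lemma along that subsequence
  then controls the \<open>L2\<close> distance of the full sequence to the limit.\<close>

lemma L2_complete:
  fixes F :: "nat \<Rightarrow> 'c \<Rightarrow> 'b::euclidean_space"
  assumes fin: "finite_measure M" and F: "\<And>n. F n \<in> L2 M"
    and Cauchy: "\<And>e. 0 < e \<Longrightarrow> \<exists>N. \<forall>m\<ge>N. \<forall>n\<ge>N. L2_norm M (F m - F n) < e"
  obtains g where "g \<in> L2 M" "(\<lambda>n. L2_norm M (F n - g)) \<longlonglongrightarrow> 0"
proof -
  interpret finite_measure M by fact
  note meas [measurable] = F[THEN L2_measurable]
  define c where "c = sqrt (measure M (space M))"
  have "\<exists>N. \<forall>i\<ge>N. \<forall>j\<ge>N. (\<integral>x. norm (F i x - F j x) \<partial>M) < e" if "0 < e" for e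
  proof -
    have "0 \<le> c" by (simp add: c_def)
    \<comment> \<open>The summand 1 covers a measure of total mass zero.\<close>
    then have "0 < e / (c + 1)" using that by simp
    then obtain N where N: "\<And>m n. m \<ge> N \<Longrightarrow> n \<ge> N \<Longrightarrow> L2_norm M (F m - F n) < e / (c + 1)"
      using Cauchy by blast
    have "(\<integral>x. norm (F i x - F j x) \<partial>M) < e" if "i \<ge> N" "j \<ge> N" for i j
    proof -
      have "(\<integral>x. norm (F i x - F j x) \<partial>M) \<le> L2_norm M (F i - F j) * c"
        using integral_norm_le_L2_norm[OF L2_diff[OF F F] fin, of i j] by (simp add: c_def)
      also have "\<dots> \<le> e / (c + 1) * c"
        using N[OF that] \<open>0 \<le> c\<close> by (intro mult_right_mono) auto
      also have "\<dots> < e"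
        using \<open>0 \<le> c\<close> \<open>0 < e\<close> by (simp add: field_simps)
      finally show ?thesis .
    qed
    then show ?thesis by blast
  qed
  then obtain r where r: "strict_mono r" "AE x in M. Cauchy (\<lambda>i. F (r i) x)"
    using cauchy_L1_AE_cauchy_subseq[of M F] L2_imp_integrable[OF F fin] by blast
  define g where "g x = lim (\<lambda>i. F (r i) x)" for x
  have g [measurable]: "g \<in> borel_measurable M"
    unfolding g_def by measurable
  have lim: "AE x in M. (\<lambda>i. F (r i) x) \<longlonglongrightarrow> g x"
    using r(2) unfolding g_def by eventually_elim (simp add: Cauchy_convergent convergent_LIMSEQ_iff[symmetric])
  \<comment> \<open>Fatou gives membership of the difference and the estimate at once; that
    \<open>g\<close> itself is square integrable follows afterwards by subtraction from one
    \<open>F N\<close>.\<close>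
  have bound: "F n - g \<in> L2 M \<and> L2_norm M (F n - g) \<le> e"
    if "0 < e" and N: "\<And>m n. m \<ge> N \<Longrightarrow> n \<ge> N \<Longrightarrow> L2_norm M (F m - F n) < e" and "n \<ge> N" for e n N
  proof -
    have "(\<integral>\<^sup>+x. ennreal ((norm (F n x - g x))\<^sup>2) \<partial>M)
        = (\<integral>\<^sup>+x. liminf (\<lambda>i. ennreal ((norm (F n x - F (r i) x))\<^sup>2)) \<partial>M)"
    proof (rule nn_integral_cong_AE, use lim in eventually_elim)
      fix x assume "(\<lambda>i. F (r i) x) \<longlonglongrightarrow> g x"
      then have "(\<lambda>i. ennreal ((norm (F n x - F (r i) x))\<^sup>2)) \<longlonglongrightarrow> ennreal ((norm (F n x - g x))\<^sup>2)"
        by (intro tendsto_intros)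
      then show "ennreal ((norm (F n x - g x))\<^sup>2) = liminf (\<lambda>i. ennreal ((norm (F n x - F (r i) x))\<^sup>2))"
        by (intro lim_imp_Liminf[symmetric]) simp
    qed
    also have "\<dots> \<le> liminf (\<lambda>i. \<integral>\<^sup>+x. ennreal ((norm (F n x - F (r i) x))\<^sup>2) \<partial>M)"
      by (rule nn_integral_liminf) measurable
    also have "\<dots> \<le> ennreal (e\<^sup>2)"
    proof (rule Liminf_le)
      show "\<forall>\<^sub>F i in sequentially. (\<integral>\<^sup>+x. ennreal ((norm (F n x - F (r i) x))\<^sup>2) \<partial>M) \<le> ennreal (e\<^sup>2)"
      proof (rule eventually_sequentiallyI)
        fix i assume "N \<le> i"
        then have "r i \<ge> N" using seq_suble[OF r(1), of i] by simp
        then have "(L2_norm M (F n - F (r i)))\<^sup>2 \<le> e\<^sup>2"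
          using N[OF \<open>n \<ge> N\<close>] by (intro power_mono) (auto intro: less_imp_le)
        then show "(\<integral>\<^sup>+x. ennreal ((norm (F n x - F (r i) x))\<^sup>2) \<partial>M) \<le> ennreal (e\<^sup>2)"
          using L2_integrable_norm_sq[OF L2_diff[OF F F], of n "r i"]
          by (subst nn_integral_eq_integral) (auto simp: L2_norm_power2)
      qed
    qed simp
    finally have le: "(\<integral>\<^sup>+x. ennreal ((norm ((F n - g) x))\<^sup>2) \<partial>M) \<le> ennreal (e\<^sup>2)"
      by simp
    have int: "integrable M (\<lambda>x. (norm ((F n - g) x))\<^sup>2)"
      using le by (intro integrableI_bounded) (auto intro: le_less_trans)
    then have "(L2_norm M (F n - g))\<^sup>2 \<le> e\<^sup>2"
      using le by (simp add: nn_integral_eq_integral L2_norm_power2)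
    then show ?thesis
      using int \<open>0 < e\<close> by (auto simp: L2_def fun_diff_def intro: power2_le_imp_le)
  qed
  have "g \<in> L2 M"
  proof -
    obtain N where "\<And>m n. m \<ge> N \<Longrightarrow> n \<ge> N \<Longrightarrow> L2_norm M (F m - F n) < 1"
      using Cauchy[of 1] by auto
    then have "F N - g \<in> L2 M" using bound[of 1 N N] by auto
    from L2_diff[OF F this, of N] show ?thesis by simp
  qed
  moreover have "(\<lambda>n. L2_norm M (F n - g)) \<longlonglongrightarrow> 0"
  proof (rule LIMSEQ_I)
    fix e :: real assume "0 < e"
    then obtain N where "\<And>m n. m \<ge> N \<Longrightarrow> n \<ge> N \<Longrightarrow> L2_norm M (F m - F n) < e / 2"
      using Cauchy[of "e / 2"] by auto
    then have "L2_norm M (F n - g) \<le> e / 2" if "n \<ge> N" for n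
      using bound[of "e / 2" N n] that \<open>0 < e\<close> by auto
    then show "\<exists>no. \<forall>n\<ge>no. norm (L2_norm M (F n - g) - 0) < e"
      using \<open>0 < e\<close> by (intro exI[of _ N]) fastforce
  qed
  ultimately show ?thesis using that by blast
qed

subsection \<open>Uniqueness of weak gradients\<close>

text \<open>Open boxes are stable under intersection and generate the Borel sets, so the vanishing
  of the integral spreads from boxes to all Borel sets by Dynkin's argument. A function whose
  integral over every measurable set is zero vanishes almost everywhere.\<close>

lemma AE_zero_if_box_integrals_zero:
  fixes f :: "'a::euclidean_space \<Rightarrow> real"
  assumes f: "integrable lborel f" and box: "\<And>a b. (LINT x:box a b|lborel. f x) = 0"
  shows "AE x in lborel. f x = 0"
proof -
  have si: "set_integrable lborel A f" if "A \<in> sets borel" for A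
    using f that unfolding set_integrable_def by (intro integrable_mult_indicator) auto
  \<comment> \<open>Complements in the Dynkin argument need the integral over the whole space, which
    is an increasing union of boxes.\<close>
  have UNIV0: "(LINT x:UNIV|lborel. f x) = 0"
  proof -
    let ?A = "\<lambda>n::nat. box (- (real n *\<^sub>R One)) (real n *\<^sub>R One) :: 'a set"
    have "incseq ?A"
      unfolding incseq_def
    proof (intro allI impI subset_box_imp(4) ballI)
      fix m n :: nat and i :: 'a assume "m \<le> n" "i \<in> Basis"
      then show "- (real n *\<^sub>R One) \<bullet> i \<le> - (real m *\<^sub>R One) \<bullet> i \<and> real m *\<^sub>R One \<bullet> i \<le> real n *\<^sub>R One \<bullet> i"
        by simp
    qed
    then have "(\<lambda>i. LINT x:?A i|lborel. f x) \<longlonglongrightarrow> (LINT x:(\<Union>i. ?A i)|lborel. f x)"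
      by (intro set_integral_cont_up si) auto
    then have "(\<lambda>i. 0) \<longlonglongrightarrow> (LINT x:UNIV|lborel. f x)"
      by (simp add: box UN_box_eq_UNIV)
    then show ?thesis by (simp add: LIMSEQ_const_iff)
  qed
  have "(LINT x:A|lborel. f x) = 0" if "A \<in> sets borel" for A
  proof -
    have "Int_stable (range (\<lambda>(a, b). box a b :: 'a set))"
      by (auto simp: Int_stable_def box_Int_box)
    moreover have "range (\<lambda>(a, b). box a b :: 'a set) \<subseteq> Pow UNIV"
      by simp
    moreover have "A \<in> sigma_sets UNIV (range (\<lambda>(a, b). box a b :: 'a set))"
      using that by (simp add: borel_eq_box)
    ultimately show ?thesis
    proof (induction rule: sigma_sets_induct_disjoint)
      case (basic A)
      then show ?case by (auto simp: box)
    next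
      case empty
      show ?case by (simp add: set_lebesgue_integral_def)
    next
      case (compl A)
      then have A: "A \<in> sets borel" by (simp add: borel_eq_box)
      have "(LINT x:UNIV|lborel. f x) = (LINT x:A \<union> (UNIV - A)|lborel. f x)" by simp
      also have "\<dots> = (LINT x:A|lborel. f x) + (LINT x:UNIV - A|lborel. f x)"
        using A by (intro set_integral_Un si) auto
      finally show ?case using UNIV0 compl by simp
    next
      case (union A)
      then have A: "\<And>i. A i \<in> sets borel" by (auto simp: borel_eq_box)
      have "(LINT x:(\<Union>i. A i)|lborel. f x) = (\<Sum>i. LINT x:A i|lborel. f x)"
        using A union(1) by (intro lebesgue_integral_countable_add si) (auto simp: disjoint_family_on_def)
      then show ?case using union by simp
    qed
  qed
  then show ?thesis
    by (intro sigma_finite_measure.density_zero[OF sigma_finite_lborel f]) auto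
qed

text \<open>The fundamental lemma of the calculus of variations. Box bumps converge to indicators,
  so the integral of \<open>k\<close> over each box inside \<Omega> vanishes; the preceding
  criterion applies on each such box, and countably many of them fill \<Omega>.\<close>

lemma AE_zero_if_orthogonal_to_test_functions:
  fixes k :: "'a::euclidean_space \<Rightarrow> real"
  assumes "open \<Omega>" and k: "integrable (lebesgue_on \<Omega>) k"
    and zero: "\<And>\<phi>. \<phi> \<in> test_functions \<Omega> \<Longrightarrow> (\<integral>x. k x * \<phi> x \<partial>lebesgue_on \<Omega>) = 0"
  shows "AE x in lebesgue_on \<Omega>. k x = 0"
proof -
  have \<Omega>: "\<Omega> \<in> sets lebesgue" using \<open>open \<Omega>\<close> by auto
  define K where "K x = indicator \<Omega> x * k x" for x
  have K: "integrable lebesgue K"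
    using k \<Omega> by (simp add: integrable_restrict_space K_def[abs_def])
  have box0: "(\<integral>x. indicator (box a b) x * K x \<partial>lebesgue) = 0" if "box a b \<subseteq> \<Omega>" for a b
  proof -
    have "(\<lambda>n. \<integral>x. K x * box_bump a b (Suc n) x \<partial>lebesgue)
        \<longlonglongrightarrow> (\<integral>x. K x * indicator (box a b) x \<partial>lebesgue)"
    proof (rule integral_dominated_convergence[where w = "\<lambda>x. \<bar>K x\<bar>"])
      show "(\<lambda>x. K x * indicator (box a b) x) \<in> borel_measurable lebesgue"
        using K by (intro borel_measurable_times borel_measurable_indicator) auto
      show "(\<lambda>x. K x * box_bump a b (Suc n) x) \<in> borel_measurable lebesgue" for n
      proof -
        have "box_bump a b (Suc n) \<in> borel_measurable borel"
          using box_bump_test_function[OF that, of "Suc n"] smooth_continuous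
          by (intro borel_measurable_continuous_onI) (auto simp: test_functions_def)
        then have "box_bump a b (Suc n) \<in> borel_measurable lebesgue"
          by (intro measurable_completion) simp
        then show ?thesis using K by (intro borel_measurable_times) auto
      qed
      show "integrable lebesgue (\<lambda>x. \<bar>K x\<bar>)" using K by simp
      show "AE x in lebesgue. (\<lambda>n. K x * box_bump a b (Suc n) x) \<longlonglongrightarrow> K x * indicator (box a b) x"
        using LIMSEQ_Suc[OF box_bump_tendsto] by (intro AE_I2 tendsto_mult) auto
      show "AE x in lebesgue. norm (K x * box_bump a b (Suc n) x) \<le> \<bar>K x\<bar>" for n
        using mult_left_mono[OF box_bump_bounds(2) abs_ge_zero]
        by (intro AE_I2) (simp add: abs_mult abs_of_nonneg[OF box_bump_bounds(1)])
    qed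
    moreover have "(\<integral>x. K x * box_bump a b (Suc n) x \<partial>lebesgue) = 0" for n
      using zero[OF box_bump_test_function[OF that, of "Suc n"]] \<Omega>
      by (simp add: integral_restrict_space K_def mult.assoc)
    ultimately show ?thesis
      by (simp add: LIMSEQ_const_iff mult.commute)
  qed
  have AE_box: "AE x in lebesgue. x \<in> box c d \<longrightarrow> K x = 0" if "box c d \<subseteq> \<Omega>" for c d
  proof -
    let ?f = "\<lambda>x. indicator (box c d) x * K x"
    have f: "integrable lebesgue ?f"
      using K integrable_mult_indicator[of "box c d" lebesgue K] by simp
    \<comment> \<open>The box criterion works with Borel measurability, so \<open>f'\<close> is a
      Borel function that agrees almost everywhere with the Lebesgue measurable one.\<close>
    obtain f' where f': "f' \<in> borel_measurable lborel" "AE x in lborel. ?f x = f' x"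
      using completion_ex_borel_measurable_real[of ?f lborel] f by auto
    have eq: "AE x in lebesgue. ?f x = f' x" using f'(2) by (rule AE_completion)
    have f'm: "f' \<in> borel_measurable lebesgue" using f'(1) by (rule measurable_completion)
    have "integrable lebesgue f'"
      using integrable_cong_AE_imp[OF f f'm] eq by auto
    then have int': "integrable lborel f'"
      using f'(1) by (simp add: integrable_completion)
    have "(LINT x:box a b|lborel. f' x) = 0" for a b
    proof -
      have "(LINT x:box a b|lborel. f' x) = (LINT x|lebesgue. indicator (box a b) x * f' x)"
        using f'(1) by (simp add: set_lebesgue_integral_def integral_completion)
      also have "\<dots> = (LINT x|lebesgue. indicator (box a b) x * ?f x)"
        using eq f f'm K
        by (intro integral_cong_AE borel_measurable_times borel_measurable_indicator) auto
      also have "\<dots> = (LINT x|lebesgue. indicator (box a b \<inter> box c d) x * K x)"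
        by (simp add: indicator_inter_arith mult.assoc)
      also have "\<dots> = 0"
      proof -
        \<comment> \<open>Cutting an arbitrary box with the fixed one gives a box inside \<Omega>,
          where the integral is already known to vanish.\<close>
        obtain a' b' where "box a b \<inter> box c d = box a' b'" by (simp add: box_Int_box)
        with box0[of a' b'] that show ?thesis by (metis Int_lower2 order_trans)
      qed
      finally show ?thesis .
    qed
    from AE_zero_if_box_integrals_zero[OF int' this] have "AE x in lebesgue. f' x = 0"
      by (rule AE_completion)
    with eq show ?thesis
      by eventually_elim (auto simp: indicator_def)
  qed
  obtain \<D> where \<D>: "countable \<D>" "\<D> \<subseteq> Pow \<Omega>" "\<And>X. X \<in> \<D> \<Longrightarrow> \<exists>a b. X = box a b" "\<Union>\<D> = \<Omega>"
    using open_countable_Union_open_box[OF \<open>open \<Omega>\<close>] by metis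
  have "AE x in lebesgue. x \<in> X \<longrightarrow> K x = 0" if "X \<in> \<D>" for X
    using \<D>(2,3) that AE_box by blast
  then have "AE x in lebesgue. \<forall>X\<in>\<D>. x \<in> X \<longrightarrow> K x = 0"
    by (subst AE_ball_countable[OF \<D>(1)]) simp
  then have "AE x in lebesgue. x \<in> \<Omega> \<longrightarrow> k x = 0"
    by eventually_elim (use \<D>(4) in \<open>auto simp: K_def indicator_def\<close>)
  then show ?thesis
    using \<Omega> by (simp add: AE_restrict_space_iff)
qed

locale bounded_open_set =
  fixes \<Omega> :: "'a::euclidean_space set"
  assumes open_set: "open \<Omega>" and bounded_set: "bounded \<Omega>"
begin

abbreviation "M\<Omega> \<equiv> lebesgue_on \<Omega>"

lemma finite_M: "finite_measure M\<Omega>"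
proof -
  have "\<Omega> \<in> lmeasurable" using open_set bounded_set by (simp add: lmeasurable_open)
  then show ?thesis by (rule finite_measure_lebesgue_on)
qed

lemma continuous_measurable_M:
  fixes g :: "'a \<Rightarrow> real"
  shows "continuous_on UNIV g \<Longrightarrow> g \<in> borel_measurable M\<Omega>"
  by (intro measurable_restrict_space1 measurable_completion) (simp add: borel_measurable_continuous_onI)

lemma test_function_L2: "\<phi> \<in> test_functions \<Omega> \<Longrightarrow> \<phi> \<in> L2 M\<Omega>"
  using test_functions_bounded[of \<phi> \<Omega>] smooth_continuous continuous_measurable_M finite_M
  by (metis (mono_tags, lifting) L2_bounded mem_Collect_eq real_norm_def test_functions_def)

lemma grad_test_function_L2:
  assumes "\<phi> \<in> test_functions \<Omega>" "b \<in> Basis"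
  shows "(\<lambda>x. grad \<phi> x \<bullet> b) \<in> L2 M\<Omega>"
proof -
  obtain B where "\<And>x. \<bar>grad \<phi> x \<bullet> b\<bar> \<le> B" using test_functions_grad_bounded[OF assms] by blast
  moreover have "smooth \<phi>" using assms by (simp add: test_functions_def)
  ultimately show ?thesis
    using continuous_measurable_M[OF continuous_on_inner_grad[OF _ assms(2)]] finite_M
    by (intro L2_bounded[of _ _ B]) auto
qed

lemma L2_component: "g \<in> L2 M\<Omega> \<Longrightarrow> b \<in> Basis \<Longrightarrow> (\<lambda>x. g x \<bullet> b) \<in> L2 M\<Omega>"
  by (rule L2I[where g = "\<lambda>x. (norm (g x))\<^sup>2"])
    (auto simp: L2_def intro!: power_mono Basis_le_norm simp: abs_le_square_iff[symmetric])

lemma weak_grad_integrable: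
  assumes "v \<in> L2 M\<Omega>" "g \<in> L2 M\<Omega>" "\<phi> \<in> test_functions \<Omega>" "b \<in> Basis"
  shows "integrable M\<Omega> (\<lambda>x. v x * (grad \<phi> x \<bullet> b))" "integrable M\<Omega> (\<lambda>x. (g x \<bullet> b) * \<phi> x)"
  using L2_inner_integrable[OF assms(1) grad_test_function_L2[OF assms(3,4)]]
    L2_inner_integrable[OF L2_component[OF assms(2,4)] test_function_L2[OF assms(3)]]
  by auto

lemma is_weak_grad_add:
  assumes "v \<in> L2 M\<Omega>" "g \<in> L2 M\<Omega>" "w \<in> L2 M\<Omega>" "h \<in> L2 M\<Omega>"
    and "is_weak_grad \<Omega> v g" "is_weak_grad \<Omega> w h"
  shows "is_weak_grad \<Omega> (v + w) (g + h)"
  using assms(5,6) weak_grad_integrable[OF assms(1,2)] weak_grad_integrable[OF assms(3,4)]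
  unfolding is_weak_grad_def by (auto simp: distrib_right inner_add_left)

lemma is_weak_grad_cmult:
  assumes "is_weak_grad \<Omega> v g"
  shows "is_weak_grad \<Omega> (\<lambda>x. c * v x) (\<lambda>x. c *\<^sub>R g x)"
  using assms unfolding is_weak_grad_def by (auto simp: mult.assoc)

text \<open>Apply the fundamental lemma to each component of \<open>g - h\<close>. Since
  \<open>wgrad\<close> is picked by choice, uniqueness is the only access to its additivity and
  homogeneity, both up to null sets.\<close>

lemma is_weak_grad_unique:
  assumes "g \<in> L2 M\<Omega>" "h \<in> L2 M\<Omega>" "is_weak_grad \<Omega> v g" "is_weak_grad \<Omega> v h"
  shows "AE x in M\<Omega>. g x = h x"
proof -
  have "AE x in M\<Omega>. (g x - h x) \<bullet> b = 0" if b: "b \<in> Basis" for b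
  proof (rule AE_zero_if_orthogonal_to_test_functions[OF open_set])
    show "integrable M\<Omega> (\<lambda>x. (g x - h x) \<bullet> b)"
      using L2_imp_integrable[OF L2_component[OF L2_diff[OF assms(1,2)] b] finite_M] by simp
    fix \<phi> assume \<phi>: "\<phi> \<in> test_functions \<Omega>"
    show "(\<integral>x. (g x - h x) \<bullet> b * \<phi> x \<partial>M\<Omega>) = 0"
      using assms(3,4) \<phi> b L2_inner_integrable[OF L2_component[OF assms(1) b] test_function_L2[OF \<phi>]]
        L2_inner_integrable[OF L2_component[OF assms(2) b] test_function_L2[OF \<phi>]]
      by (simp add: is_weak_grad_def inner_diff_left left_diff_distrib)
  qed
  then have "AE x in M\<Omega>. \<forall>b\<in>Basis. (g x - h x) \<bullet> b = 0"
    by (simp add: AE_ball_countable countable_finite)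
  then show ?thesis
    by eventually_elim (simp add: euclidean_eq_iff[where 'a = 'a] inner_diff_left)
qed

lemma W12_L2: "v \<in> W12 \<Omega> \<Longrightarrow> v \<in> L2 M\<Omega>"
  by (simp add: W12_def)

lemma wgrad:
  assumes "v \<in> W12 \<Omega>"
  shows "wgrad \<Omega> v \<in> L2 M\<Omega>" "is_weak_grad \<Omega> v (wgrad \<Omega> v)"
proof -
  have "\<exists>g. g \<in> L2 M\<Omega> \<and> is_weak_grad \<Omega> v g" using assms by (auto simp: W12_def)
  from someI_ex[OF this] show "wgrad \<Omega> v \<in> L2 M\<Omega>" "is_weak_grad \<Omega> v (wgrad \<Omega> v)"
    unfolding wgrad_def by auto
qed

lemma W12_add: "v \<in> W12 \<Omega> \<Longrightarrow> w \<in> W12 \<Omega> \<Longrightarrow> v + w \<in> W12 \<Omega>"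
  using is_weak_grad_add[of v "wgrad \<Omega> v" w "wgrad \<Omega> w"] wgrad[of v] wgrad[of w]
    L2_add[of v M\<Omega> w] L2_add[of "wgrad \<Omega> v" M\<Omega> "wgrad \<Omega> w"] W12_L2[of v] W12_L2[of w]
  unfolding W12_def by blast

lemma W12_cmult: "v \<in> W12 \<Omega> \<Longrightarrow> (\<lambda>x. c * v x) \<in> W12 \<Omega>"
  using is_weak_grad_cmult[OF wgrad(2), of v c] L2_scaleR[OF wgrad(1), of v c] L2_scaleR[OF W12_L2, of v c]
  unfolding W12_def by auto

lemma wgrad_add:
  assumes "v \<in> W12 \<Omega>" "w \<in> W12 \<Omega>"
  shows "AE x in M\<Omega>. wgrad \<Omega> (v + w) x = (wgrad \<Omega> v + wgrad \<Omega> w) x"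
  using assms
  by (intro is_weak_grad_unique[of _ _ "v + w"] wgrad W12_add L2_add is_weak_grad_add W12_L2)

lemma wgrad_cmult:
  assumes "v \<in> W12 \<Omega>"
  shows "AE x in M\<Omega>. wgrad \<Omega> (\<lambda>x. c * v x) x = c *\<^sub>R wgrad \<Omega> v x"
  using assms
  by (intro is_weak_grad_unique[of _ _ "\<lambda>x. c * v x"] wgrad W12_cmult L2_scaleR is_weak_grad_cmult)

end

subsection \<open>The space \<open>V\<close> and its dual\<close>

lemma L2_tendsto_add:
  assumes "L2_tendsto M F f" "L2_tendsto M G g"
  shows "L2_tendsto M (\<lambda>n. F n + G n) (f + g)"
proof -
  have L2: "\<And>n. F n \<in> L2 M" "f \<in> L2 M" "\<And>n. G n \<in> L2 M" "g \<in> L2 M"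
    using assms by (auto simp: L2_tendsto_def)
  have lim: "(\<lambda>n. L2_norm M (F n - f) + L2_norm M (G n - g)) \<longlonglongrightarrow> 0 + 0"
    using assms by (intro tendsto_add) (auto simp: L2_tendsto_def)
  have "(\<lambda>n. L2_norm M (F n + G n - (f + g))) \<longlonglongrightarrow> 0"
  proof (rule tendsto_sandwich[where f = "\<lambda>n. 0"])
    show "\<forall>\<^sub>F n in sequentially. L2_norm M (F n + G n - (f + g)) \<le> L2_norm M (F n - f) + L2_norm M (G n - g)"
      using L2_norm_triangle[OF L2_diff[OF L2(1,2)] L2_diff[OF L2(3,4)]]
      by (simp add: add_diff_add)
  qed (use lim in auto)
  then show ?thesis using L2 by (auto simp: L2_tendsto_def intro: L2_add)
qed

lemma L2_tendsto_scaleR: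
  assumes "L2_tendsto M F f"
  shows "L2_tendsto M (\<lambda>n x. c *\<^sub>R F n x) (\<lambda>x. c *\<^sub>R f x)"
proof -
  have "(\<lambda>n. \<bar>c\<bar> * L2_norm M (F n - f)) \<longlonglongrightarrow> \<bar>c\<bar> * 0"
    using assms by (intro tendsto_mult) (auto simp: L2_tendsto_def)
  moreover have "L2_norm M ((\<lambda>x. c *\<^sub>R F n x) - (\<lambda>x. c *\<^sub>R f x)) = \<bar>c\<bar> * L2_norm M (F n - f)" for n
    using L2_norm_scaleR[of M c "F n - f"] by (simp add: fun_diff_def scaleR_diff_right)
  ultimately show ?thesis
    using assms by (auto simp: L2_tendsto_def intro: L2_scaleR)
qed

lemma L2_tendsto_cong_AE:
  assumes "L2_tendsto M F f" "g \<in> L2 M" "AE x in M. g x = f x"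
  shows "L2_tendsto M F g"
proof -
  have "L2_norm M (F n - g) = L2_norm M (F n - f)" for n
    using assms by (intro L2_norm_cong_AE) (auto simp: L2_tendsto_def intro!: L2_measurable L2_diff)
  then show ?thesis using assms by (simp add: L2_tendsto_def)
qed

context bounded_open_set
begin

text \<open>A trace comes with one smooth sequence that serves the function, its gradient and the
  boundary values together; adding two such sequences settles all three limits. Only the limit of
  the gradients has to be moved to the chosen \<open>wgrad\<close> of the sum.\<close>

lemma is_trace_add:
  assumes "is_trace \<Omega> v g" "is_trace \<Omega> w h" "v \<in> W12 \<Omega>" "w \<in> W12 \<Omega>"
  shows "is_trace \<Omega> (v + w) (g + h)"
proof -
  obtain \<phi> where \<phi>: "\<And>n. smooth (\<phi> n)" "L2_tendsto M\<Omega> \<phi> v"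
      "L2_tendsto M\<Omega> (\<lambda>n. grad (\<phi> n)) (wgrad \<Omega> v)" "L2_tendsto (surface \<Omega>) \<phi> g"
    using assms(1) by (auto simp: is_trace_def)
  obtain \<psi> where \<psi>: "\<And>n. smooth (\<psi> n)" "L2_tendsto M\<Omega> \<psi> w"
      "L2_tendsto M\<Omega> (\<lambda>n. grad (\<psi> n)) (wgrad \<Omega> w)" "L2_tendsto (surface \<Omega>) \<psi> h"
    using assms(2) by (auto simp: is_trace_def)
  have "grad (\<phi> n + \<psi> n) = grad (\<phi> n) + grad (\<psi> n)" for n
    using grad_add[OF \<phi>(1) \<psi>(1)] by (auto simp: plus_fun_def)
  then have "L2_tendsto M\<Omega> (\<lambda>n. grad (\<phi> n + \<psi> n)) (wgrad \<Omega> v + wgrad \<Omega> w)"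
    using L2_tendsto_add[OF \<phi>(3) \<psi>(3)] by simp
  then have "L2_tendsto M\<Omega> (\<lambda>n. grad (\<phi> n + \<psi> n)) (wgrad \<Omega> (v + w))"
    using wgrad(1)[OF W12_add[OF assms(3,4)]] wgrad_add[OF assms(3,4)]
    by (rule L2_tendsto_cong_AE)
  moreover have "smooth (\<phi> n + \<psi> n)" for n
    using smooth_add[OF \<phi>(1) \<psi>(1)] by (simp add: plus_fun_def)
  ultimately show ?thesis
    unfolding is_trace_def using L2_tendsto_add[OF \<phi>(2) \<psi>(2)] L2_tendsto_add[OF \<phi>(4) \<psi>(4)]
    by (intro exI[of _ "\<lambda>n. \<phi> n + \<psi> n"]) auto
qed

lemma is_trace_cmult:
  assumes "is_trace \<Omega> v g" "v \<in> W12 \<Omega>"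
  shows "is_trace \<Omega> (\<lambda>x. c * v x) (\<lambda>x. c * g x)"
proof -
  obtain \<phi> where \<phi>: "\<And>n. smooth (\<phi> n)" "L2_tendsto M\<Omega> \<phi> v"
      "L2_tendsto M\<Omega> (\<lambda>n. grad (\<phi> n)) (wgrad \<Omega> v)" "L2_tendsto (surface \<Omega>) \<phi> g"
    using assms(1) by (auto simp: is_trace_def)
  have "grad (\<lambda>x. c * \<phi> n x) = (\<lambda>x. c *\<^sub>R grad (\<phi> n) x)" for n
    using grad_cmult[OF \<phi>(1)] by auto
  then have "L2_tendsto M\<Omega> (\<lambda>n. grad (\<lambda>x. c * \<phi> n x)) (\<lambda>x. c *\<^sub>R wgrad \<Omega> v x)"
    using L2_tendsto_scaleR[OF \<phi>(3), of c] by simp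
  then have "L2_tendsto M\<Omega> (\<lambda>n. grad (\<lambda>x. c * \<phi> n x)) (wgrad \<Omega> (\<lambda>x. c * v x))"
    using wgrad(1)[OF W12_cmult[OF assms(2)], of c] wgrad_cmult[OF assms(2), of c]
    by (rule L2_tendsto_cong_AE)
  then show ?thesis
    unfolding is_trace_def using smooth_cmult[OF \<phi>(1)]
      L2_tendsto_scaleR[OF \<phi>(2), of c] L2_tendsto_scaleR[OF \<phi>(4), of c]
    by (intro exI[of _ "\<lambda>n x. c * \<phi> n x"]) auto
qed

end

locale sobolev_space = bounded_open_set \<Omega> for \<Omega> :: "'a::euclidean_space set" +
  fixes \<Gamma>D :: "'a set"
begin

abbreviation "VD \<equiv> V \<Omega> \<Gamma>D"
abbreviation "VD' \<equiv> V_dual \<Omega> \<Gamma>D"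
abbreviation "dual_norm \<equiv> V_dual_norm \<Omega> \<Gamma>D"

lemma V_W12: "v \<in> VD \<Longrightarrow> v \<in> W12 \<Omega>"
  by (simp add: V_def)

lemma V_L2: "v \<in> VD \<Longrightarrow> v \<in> L2 M\<Omega>"
  by (intro W12_L2 V_W12)

lemma wgrad_V: "v \<in> VD \<Longrightarrow> wgrad \<Omega> v \<in> L2 M\<Omega>"
  by (intro wgrad V_W12)

lemma V_add:
  assumes "v \<in> VD" "w \<in> VD"
  shows "v + w \<in> VD"
proof -
  obtain g where g: "is_trace \<Omega> v g" "AE x in surface \<Omega>. x \<in> \<Gamma>D \<longrightarrow> g x = 0"
    using assms(1) by (auto simp: V_def)
  obtain h where h: "is_trace \<Omega> w h" "AE x in surface \<Omega>. x \<in> \<Gamma>D \<longrightarrow> h x = 0"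
    using assms(2) by (auto simp: V_def)
  have "AE x in surface \<Omega>. x \<in> \<Gamma>D \<longrightarrow> (g + h) x = 0"
    using g(2) h(2) by eventually_elim auto
  then show ?thesis
    using is_trace_add[OF g(1) h(1) assms[THEN V_W12]] W12_add[OF assms[THEN V_W12]]
    unfolding V_def by blast
qed

lemma V_cmult:
  assumes "v \<in> VD"
  shows "(\<lambda>x. c * v x) \<in> VD"
proof -
  obtain g where g: "is_trace \<Omega> v g" "AE x in surface \<Omega>. x \<in> \<Gamma>D \<longrightarrow> g x = 0"
    using assms by (auto simp: V_def)
  have "AE x in surface \<Omega>. x \<in> \<Gamma>D \<longrightarrow> c * g x = 0"
    using g(2) by eventually_elim auto
  then show ?thesis
    using is_trace_cmult[OF g(1) assms[THEN V_W12]] W12_cmult[OF assms[THEN V_W12]]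
    unfolding V_def by blast
qed

lemma V_uminus: "v \<in> VD \<Longrightarrow> - v \<in> VD"
  using V_cmult[of v "-1"] by (simp add: fun_Compl_def)

lemma V_diff: "v \<in> VD \<Longrightarrow> w \<in> VD \<Longrightarrow> v - w \<in> VD"
  using V_add[of v "- w"] V_uminus[of w] by simp

lemma wgrad_diff:
  assumes "v \<in> W12 \<Omega>" "w \<in> W12 \<Omega>"
  shows "AE x in M\<Omega>. wgrad \<Omega> (v - w) x = wgrad \<Omega> v x - wgrad \<Omega> w x"
proof -
  have eq: "v - w = v + (\<lambda>x. -1 * w x)" by auto
  show ?thesis
    unfolding eq using wgrad_add[OF assms(1) W12_cmult[OF assms(2)], of "-1"] wgrad_cmult[OF assms(2), of "-1"]
    by eventually_elim simp
qed

lemma wgrad_0: "AE x in M\<Omega>. wgrad \<Omega> 0 x = 0"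
proof -
  have "is_weak_grad \<Omega> 0 0" by (simp add: is_weak_grad_def)
  then have "0 \<in> W12 \<Omega>" by (auto simp: W12_def intro!: bexI[of _ 0])
  then show ?thesis
    using \<open>is_weak_grad \<Omega> 0 0\<close> is_weak_grad_unique[OF wgrad(1) L2_zero wgrad(2), of 0] by simp
qed

lemma V_0: "0 \<in> VD"
proof -
  have "is_weak_grad \<Omega> 0 0" by (simp add: is_weak_grad_def)
  then have W: "0 \<in> W12 \<Omega>" by (auto simp: W12_def intro!: bexI[of _ 0])
  have smooth0: "smooth (0 :: 'a \<Rightarrow> real)"
    by (simp add: smooth_def zero_fun_def)
  have const: "L2_tendsto M (\<lambda>n. 0) 0" for M :: "'a measure"
    unfolding L2_tendsto_def by simp
  have "grad (0 :: 'a \<Rightarrow> real) = 0"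
    using grad_cmult[OF smooth0, of 0] by (auto simp: zero_fun_def)
  then have "L2_tendsto M\<Omega> (\<lambda>n. grad 0) 0"
    unfolding L2_tendsto_def by simp
  then have "L2_tendsto M\<Omega> (\<lambda>n. grad 0) (wgrad \<Omega> 0)"
    by (rule L2_tendsto_cong_AE[OF _ wgrad(1)[OF W]]) (use wgrad_0 in simp)
  then have "is_trace \<Omega> 0 0"
    unfolding is_trace_def using smooth0 const by (intro exI[of _ "\<lambda>n. 0"]) auto
  then show ?thesis using W unfolding V_def by auto
qed

text \<open>Moves the seminorm of a difference into \<open>L2\<close>, where squares can be
  expanded; the chosen gradient of a difference agrees with the difference of the gradients only
  almost everywhere.\<close>

lemma L2_norm_wgrad_diff:
  assumes "v \<in> VD" "w \<in> VD"
  shows "V_norm \<Omega> (v - w) = L2_norm M\<Omega> (wgrad \<Omega> v - wgrad \<Omega> w)"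
  unfolding V_norm_def using assms wgrad_diff[OF assms[THEN V_W12]]
  by (intro L2_norm_cong_AE) (auto intro!: L2_measurable wgrad_V V_diff L2_diff)

lemma L2_norm_wgrad_add:
  assumes "v \<in> VD" "w \<in> VD"
  shows "V_norm \<Omega> (v + w) = L2_norm M\<Omega> (wgrad \<Omega> v + wgrad \<Omega> w)"
  unfolding V_norm_def using assms wgrad_add[OF assms[THEN V_W12]]
  by (intro L2_norm_cong_AE) (auto intro!: L2_measurable wgrad_V V_add L2_add)

lemma V_norm_cmult:
  assumes "v \<in> VD"
  shows "V_norm \<Omega> (\<lambda>x. c * v x) = \<bar>c\<bar> * V_norm \<Omega> v"
proof -
  have "V_norm \<Omega> (\<lambda>x. c * v x) = L2_norm M\<Omega> (\<lambda>x. c *\<^sub>R wgrad \<Omega> v x)"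
    unfolding V_norm_def using assms wgrad_cmult[OF V_W12[OF assms]]
    by (intro L2_norm_cong_AE) (auto intro!: L2_measurable wgrad_V V_cmult L2_scaleR)
  then show ?thesis by (simp add: L2_norm_scaleR V_norm_def)
qed

lemma V_norm_nonneg [simp]: "0 \<le> V_norm \<Omega> v"
  by (simp add: V_norm_def)

lemma V_norm_0 [simp]: "V_norm \<Omega> 0 = 0"
  using L2_norm_wgrad_diff[OF V_0 V_0] by simp

lemma V_norm_diff_le:
  "v \<in> VD \<Longrightarrow> w \<in> VD \<Longrightarrow> V_norm \<Omega> (v - w) \<le> V_norm \<Omega> v + V_norm \<Omega> w"
  using L2_norm_triangle_diff[OF wgrad_V wgrad_V, of v w] L2_norm_wgrad_diff[of v w]
  by (simp add: V_norm_def[symmetric])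

section \<open>Functionals on \<open>V\<close>, their norm and the adjoint of the gradient\<close>

lemma V_dual_add_arg:
  "F \<in> VD' \<Longrightarrow> v \<in> VD \<Longrightarrow> w \<in> VD \<Longrightarrow> F (v + w) = F v + F w"
  by (simp add: V_dual_def)

lemma V_dual_cmult_arg: "F \<in> VD' \<Longrightarrow> v \<in> VD \<Longrightarrow> F (\<lambda>x. c * v x) = c * F v"
  by (simp add: V_dual_def)

lemma V_dual_diff_arg:
  assumes "F \<in> VD'" "v \<in> VD" "w \<in> VD"
  shows "F (v - w) = F v - F w"
  using V_dual_add_arg[OF assms(1) V_diff[OF assms(2,3)] assms(3)] by simp

lemma V_dual_bounded:
  assumes "F \<in> VD'"
  obtains C where "0 \<le> C" "\<And>v. v \<in> VD \<Longrightarrow> \<bar>F v\<bar> \<le> C * V_norm \<Omega> v"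
proof -
  obtain C where C: "\<And>v. v \<in> VD \<Longrightarrow> \<bar>F v\<bar> \<le> C * V_norm \<Omega> v"
    using assms unfolding V_dual_def by blast
  have "\<bar>F v\<bar> \<le> \<bar>C\<bar> * V_norm \<Omega> v" if "v \<in> VD" for v
    using C[OF that] by (rule order_trans) (intro mult_right_mono, auto)
  then show ?thesis using that[of "\<bar>C\<bar>"] by simp
qed

lemma V_dual_add: 
  assumes "F \<in> VD'" "G \<in> VD'"
  shows "F + G \<in> VD'"
proof -
  obtain C where C: "\<And>v. v \<in> VD \<Longrightarrow> \<bar>F v\<bar> \<le> C * V_norm \<Omega> v" using V_dual_bounded[OF assms(1)] by blast
  obtain D where D: "\<And>v. v \<in> VD \<Longrightarrow> \<bar>G v\<bar> \<le> D * V_norm \<Omega> v" using V_dual_bounded[OF assms(2)] by blast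
  have "\<bar>F v + G v\<bar> \<le> (C + D) * V_norm \<Omega> v" if "v \<in> VD" for v
    using C[OF that] D[OF that] by (simp add: distrib_right)
  then have "\<exists>C. \<forall>v\<in>VD. \<bar>(F + G) v\<bar> \<le> C * V_norm \<Omega> v" by auto
  then show ?thesis using assms unfolding V_dual_def by (simp add: distrib_left)
qed

lemma V_dual_uminus: "F \<in> VD' \<Longrightarrow> - F \<in> VD'"
  by (auto simp: V_dual_def)

lemma V_dual_diff: "F \<in> VD' \<Longrightarrow> G \<in> VD' \<Longrightarrow> F - G \<in> VD'"
  using V_dual_add[of F "- G"] V_dual_uminus[of G] by simp

lemma V_dual_0: "0 \<in> VD'"
  by (auto simp: V_dual_def intro: exI[of _ 0])

lemma V_dual_norm_least:
  assumes "\<And>v. v \<in> VD \<Longrightarrow> V_norm \<Omega> v \<le> 1 \<Longrightarrow> \<bar>F v\<bar> \<le> C"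
  shows "dual_norm F \<le> C"
  unfolding V_dual_norm_def using assms V_0 by (intro cSUP_least) (auto intro!: exI[of _ 0])

lemma V_dual_norm_upper:
  assumes "F \<in> VD'" "v \<in> VD" "V_norm \<Omega> v \<le> 1"
  shows "\<bar>F v\<bar> \<le> dual_norm F"
proof -
  obtain C where C: "0 \<le> C" "\<And>v. v \<in> VD \<Longrightarrow> \<bar>F v\<bar> \<le> C * V_norm \<Omega> v" using V_dual_bounded[OF assms(1)] by blast
  have "\<bar>F v\<bar> \<le> C" if "v \<in> VD" "V_norm \<Omega> v \<le> 1" for v
    using C(2)[OF that(1)] mult_left_mono[OF that(2) C(1)] by simp
  then show ?thesis
    unfolding V_dual_norm_def using assms by (intro cSUP_upper bdd_aboveI2) auto
qed

lemma V_dual_norm_nonneg: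
  assumes "F \<in> VD'"
  shows "0 \<le> dual_norm F"
  using V_dual_norm_upper[OF assms V_0] by simp

lemma V_dual_apply_le:
  assumes F: "F \<in> VD'" and v: "v \<in> VD"
  shows "\<bar>F v\<bar> \<le> dual_norm F * V_norm \<Omega> v"
proof (cases "V_norm \<Omega> v = 0")
  \<comment> \<open>On the kernel of the seminorm \<open>v\<close> cannot be normalised; there the
    boundedness of \<open>F\<close> forces \<open>F v = 0\<close>.\<close>
  case True
  obtain C where "\<bar>F v\<bar> \<le> C * V_norm \<Omega> v" using V_dual_bounded[OF F] v by blast
  with True show ?thesis by simp
next
  case False
  then have pos: "0 < V_norm \<Omega> v" using V_norm_nonneg[of v] by linarith
  let ?w = "\<lambda>x. inverse (V_norm \<Omega> v) * v x"
  have "V_norm \<Omega> ?w \<le> 1" using pos by (simp add: V_norm_cmult[OF v])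
  from V_dual_norm_upper[OF F V_cmult[OF v] this]
  have "inverse (V_norm \<Omega> v) * \<bar>F v\<bar> \<le> dual_norm F"
    using pos by (simp only: V_dual_cmult_arg[OF F v] abs_mult) simp
  then show ?thesis using pos by (simp add: field_simps)
qed

lemma V_dual_norm_0: "dual_norm 0 = 0"
  using V_dual_norm_least[of 0 0] V_dual_norm_nonneg[OF V_dual_0] by simp

lemma V_dual_norm_diff_le:
  assumes "F \<in> VD'" "G \<in> VD'"
  shows "dual_norm (F - G) \<le> dual_norm F + dual_norm G"
proof (rule V_dual_norm_least)
  fix v assume v: "v \<in> VD" "V_norm \<Omega> v \<le> 1"
  show "\<bar>(F - G) v\<bar> \<le> dual_norm F + dual_norm G"
    using V_dual_norm_upper[OF assms(1) v] V_dual_norm_upper[OF assms(2) v] by simp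
qed

lemma V_dual_norm_cong:
  assumes "\<And>v. v \<in> VD \<Longrightarrow> F v = G v"
  shows "dual_norm F = dual_norm G"
  unfolding V_dual_norm_def using assms by (intro SUP_cong) auto

lemma Lstar_V_dual:
  assumes y: "y \<in> L2 M\<Omega>"
  shows "Lstar \<Omega> y \<in> VD'"
proof -
  have "Lstar \<Omega> y (v + w) = Lstar \<Omega> y v + Lstar \<Omega> y w" if "v \<in> VD" "w \<in> VD" for v w
  proof -
    have "Lstar \<Omega> y (v + w) = (\<integral>x. y x \<bullet> wgrad \<Omega> v x + y x \<bullet> wgrad \<Omega> w x \<partial>M\<Omega>)"
      unfolding Lstar_def using wgrad_add[OF that[THEN V_W12]]
        L2_measurable[OF y] that[THEN wgrad_V, THEN L2_measurable] V_add[OF that, THEN wgrad_V, THEN L2_measurable]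
      by (intro integral_cong_AE) (auto simp: inner_add_right elim!: eventually_mono)
    then show ?thesis
      using L2_inner_integrable[OF y wgrad_V] that by (simp add: Lstar_def)
  qed
  moreover have "Lstar \<Omega> y (\<lambda>x. c * v x) = c * Lstar \<Omega> y v" if "v \<in> VD" for c v
  proof -
    have "Lstar \<Omega> y (\<lambda>x. c * v x) = (\<integral>x. c * (y x \<bullet> wgrad \<Omega> v x) \<partial>M\<Omega>)"
      unfolding Lstar_def using wgrad_cmult[OF V_W12[OF that], of c] L2_measurable[OF y]
        that[THEN wgrad_V, THEN L2_measurable] V_cmult[OF that, THEN wgrad_V, THEN L2_measurable]
      by (intro integral_cong_AE) (auto elim!: eventually_mono)
    then show ?thesis by (simp add: Lstar_def)
  qed
  moreover have "\<bar>Lstar \<Omega> y v\<bar> \<le> L2_norm M\<Omega> y * V_norm \<Omega> v" if "v \<in> VD" for v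
    unfolding Lstar_def V_norm_def by (rule L2_Cauchy_Schwarz[OF y wgrad_V[OF that]])
  ultimately show ?thesis
    by (auto simp: V_dual_def intro!: exI[of _ "L2_norm M\<Omega> y"])
qed

lemma V_dual_norm_Lstar_le:
  assumes y: "y \<in> L2 M\<Omega>"
  shows "dual_norm (Lstar \<Omega> y) \<le> L2_norm M\<Omega> y"
proof (rule V_dual_norm_least)
  fix v assume v: "v \<in> VD" "V_norm \<Omega> v \<le> 1"
  have "\<bar>Lstar \<Omega> y v\<bar> \<le> L2_norm M\<Omega> y * V_norm \<Omega> v"
    unfolding Lstar_def V_norm_def by (rule L2_Cauchy_Schwarz[OF y wgrad_V[OF v(1)]])
  also have "\<dots> \<le> L2_norm M\<Omega> y"
    using mult_left_mono[OF v(2) L2_norm_nonneg] by simp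
  finally show "\<bar>Lstar \<Omega> y v\<bar> \<le> L2_norm M\<Omega> y" .
qed

lemma Lstar_diff:
  assumes "y \<in> L2 M\<Omega>" "z \<in> L2 M\<Omega>" "v \<in> VD"
  shows "Lstar \<Omega> (y - z) v = Lstar \<Omega> y v - Lstar \<Omega> z v"
  using L2_inner_integrable[OF assms(1) wgrad_V[OF assms(3)]] L2_inner_integrable[OF assms(2) wgrad_V[OF assms(3)]]
  by (simp add: Lstar_def inner_diff_left)

end

subsection \<open>Bochner spaces with values in seminormed groups\<close>

text \<open>Completeness of Lebesgue measure lets measurability pass to \<open>g\<close> across a
  null set; pointwise limits that hold only almost everywhere depend on this.\<close>

lemma borel_measurable_lebesgue_on_AE:
  fixes f :: "'a::euclidean_space \<Rightarrow> 'b::euclidean_space"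
  assumes "f \<in> borel_measurable (lebesgue_on S)" "S \<in> sets lebesgue"
    and "AE x in lebesgue_on S. f x = g x"
  shows "g \<in> borel_measurable (lebesgue_on S)"
proof -
  have "AE x in lebesgue. (if x \<in> S then f x else 0) = (if x \<in> S then g x else 0)"
    using assms(2,3) by (simp add: AE_restrict_space_iff) 
  then show ?thesis
    using borel_measurable_AE assms(1,2) by (simp add: borel_measurable_if[symmetric])
qed

lemma borel_measurable_lebesgue_on_LIMSEQ_AE:
  fixes h :: "nat \<Rightarrow> 'a::euclidean_space \<Rightarrow> real"
  assumes [measurable]: "\<And>n. h n \<in> borel_measurable (lebesgue_on S)" and "S \<in> sets lebesgue"
    and lim: "AE x in lebesgue_on S. (\<lambda>n. h n x) \<longlonglongrightarrow> g x"
  shows "g \<in> borel_measurable (lebesgue_on S)"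
proof (rule borel_measurable_lebesgue_on_AE[OF _ assms(2)])
  show "(\<lambda>x. lim (\<lambda>n. h n x)) \<in> borel_measurable (lebesgue_on S)" by measurable
  show "AE x in lebesgue_on S. lim (\<lambda>n. h n x) = g x"
    using lim by eventually_elim (rule limI)
qed

abbreviation time_measure :: "real \<Rightarrow> real measure" (\<open>\<I>\<close>) where
  "\<I> T \<equiv> lebesgue_on {0<..<T}"

text \<open>The value spaces carry no measurable structure. Simple functions have finitely many
  values, so \<open>K\<close> of two of them is a real simple function, and sequential continuity of
  \<open>K\<close> for the two seminorms passes this to the limit.\<close>

lemma strongly_measurable_compose2:
  fixes K :: "'b::minus \<Rightarrow> 'c::minus \<Rightarrow> real"
  assumes f: "strongly_measurable T X N f" "AE t in \<I> T. f t \<in> X"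
    and g: "strongly_measurable T Y P g" "AE t in \<I> T. g t \<in> Y"
    and K: "\<And>x y xs ys. \<lbrakk>x \<in> X; y \<in> Y; \<And>n. xs n \<in> X; \<And>n. ys n \<in> Y;
        (\<lambda>n. N (x - xs n)) \<longlonglongrightarrow> 0; (\<lambda>n. P (y - ys n)) \<longlonglongrightarrow> 0\<rbrakk> \<Longrightarrow> (\<lambda>n. K (xs n) (ys n)) \<longlonglongrightarrow> K x y"
  shows "(\<lambda>t. K (f t) (g t)) \<in> borel_measurable (\<I> T)"
proof -
  obtain s where s: "\<And>n. simple_function (\<I> T) (s n)" "\<And>n t. t \<in> {0<..<T} \<Longrightarrow> s n t \<in> X"
    "AE t in \<I> T. (\<lambda>n. N (f t - s n t)) \<longlonglongrightarrow> 0"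
    using f(1) unfolding strongly_measurable_def by blast
  obtain r where r: "\<And>n. simple_function (\<I> T) (r n)" "\<And>n t. t \<in> {0<..<T} \<Longrightarrow> r n t \<in> Y"
    "AE t in \<I> T. (\<lambda>n. P (g t - r n t)) \<longlonglongrightarrow> 0"
    using g(1) unfolding strongly_measurable_def by blast
  have lim: "AE t in \<I> T. (\<lambda>n. K (s n t) (r n t)) \<longlonglongrightarrow> K (f t) (g t)"
    using s(3) r(3) f(2) g(2) AE_space
    by eventually_elim (rule K, use s(2) r(2) in auto)
  have "(\<lambda>t. K (s n t) (r n t)) \<in> borel_measurable (\<I> T)" for n
    by (intro borel_measurable_simple_function simple_function_compose2[where h = K] s r)
  from borel_measurable_lebesgue_on_LIMSEQ_AE[OF this _ lim] show ?thesis by simp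
qed

text \<open>Subtraction and a seminorm are all that the Bochner theory below touches;
  \<open>V\<close>, its dual and \<open>L2\<close> are its instances. The seminorm may vanish on
  nonzero elements, because functions stand for their equivalence classes.\<close>

locale seminormed_group =
  fixes X :: "'b::ab_group_add set" and N :: "'b \<Rightarrow> real"
  assumes zero_mem: "0 \<in> X" and diff_mem: "x \<in> X \<Longrightarrow> y \<in> X \<Longrightarrow> x - y \<in> X"
    and N_zero: "N 0 = 0" and N_diff_le: "x \<in> X \<Longrightarrow> y \<in> X \<Longrightarrow> N (x - y) \<le> N x + N y"
begin

lemma uminus_mem: "x \<in> X \<Longrightarrow> - x \<in> X"
  using diff_mem[OF zero_mem] by simp

lemma N_nonneg: "x \<in> X \<Longrightarrow> 0 \<le> N x"
  using N_diff_le[of x x] N_zero by simp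

lemma N_uminus: "x \<in> X \<Longrightarrow> N (- x) = N x"
  using N_diff_le[OF zero_mem, of x] N_diff_le[OF zero_mem uminus_mem, of x] N_zero by simp

lemma N_minus_commute: "x \<in> X \<Longrightarrow> y \<in> X \<Longrightarrow> N (x - y) = N (y - x)"
  using N_uminus[OF diff_mem, of x y] by simp

lemma N_add_le: "x \<in> X \<Longrightarrow> y \<in> X \<Longrightarrow> N (x + y) \<le> N x + N y"
  using N_diff_le[OF _ uminus_mem, of x y] N_uminus[of y] by simp

lemma N_triangle: "x \<in> X \<Longrightarrow> y \<in> X \<Longrightarrow> z \<in> X \<Longrightarrow> N (x - z) \<le> N (x - y) + N (y - z)"
  using N_add_le[of "x - y" "y - z"] diff_mem by simp

lemma N_diff_ge: "x \<in> X \<Longrightarrow> y \<in> X \<Longrightarrow> \<bar>N x - N y\<bar> \<le> N (x - y)"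
  using N_add_le[of "x - y" y] N_add_le[of "y - x" x] N_minus_commute[of x y] diff_mem[of x y]
    diff_mem[of y x] by (simp add: abs_le_iff)

lemma N_tendsto:
  assumes "x \<in> X" "\<And>n. xs n \<in> X" "(\<lambda>n. N (x - xs n)) \<longlonglongrightarrow> 0"
  shows "(\<lambda>n. N (xs n)) \<longlonglongrightarrow> N x"
  by (rule Lim_transform_bound[OF _ assms(3), THEN LIM_zero_cancel])
    (use N_diff_ge[OF assms(1,2)] in \<open>auto simp: abs_minus_commute intro!: eventuallyI order_trans[OF _ abs_ge_self]\<close>)

lemma N_diff_power2_le:
  assumes "x \<in> X" "y \<in> X"
  shows "(N (x - y))\<^sup>2 \<le> 2 * (N x)\<^sup>2 + 2 * (N y)\<^sup>2"
proof -
  have "(N (x - y))\<^sup>2 \<le> (N x + N y)\<^sup>2"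
    using assms by (intro power_mono N_diff_le N_nonneg diff_mem)
  also have "\<dots> \<le> 2 * (N x)\<^sup>2 + 2 * (N y)\<^sup>2"
    using sum_squares_bound[of "N x" "N y"] by (simp add: power2_sum)
  finally show ?thesis .
qed

lemma bochner_L2D:
  assumes "f \<in> bochner_L2 T X N"
  shows "AE t in \<I> T. f t \<in> X" "strongly_measurable T X N f"
    "integrable (\<I> T) (\<lambda>t. (N (f t))\<^sup>2)"
  using assms by (auto simp: bochner_L2_def)

lemma strongly_measurable_N:
  assumes "strongly_measurable T X N f" "AE t in \<I> T. f t \<in> X"
  shows "(\<lambda>t. N (f t)) \<in> borel_measurable (\<I> T)"
  by (rule strongly_measurable_compose2[OF assms assms, where K = "\<lambda>x y. N x"]) (rule N_tendsto)

lemma bochner_L2_N_measurable: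
  "f \<in> bochner_L2 T X N \<Longrightarrow> (\<lambda>t. N (f t)) \<in> borel_measurable (\<I> T)"
  by (intro strongly_measurable_N bochner_L2D)

lemma bochner_L2I:
  assumes "AE t in \<I> T. f t \<in> X" "strongly_measurable T X N f"
    and "integrable (\<I> T) g" "AE t in \<I> T. (N (f t))\<^sup>2 \<le> g t"
  shows "f \<in> bochner_L2 T X N"
proof -
  have "integrable (\<I> T) (\<lambda>t. (N (f t))\<^sup>2)"
  proof (rule Bochner_Integration.integrable_bound[OF assms(3)])
    show "(\<lambda>t. (N (f t))\<^sup>2) \<in> borel_measurable (\<I> T)"
      using strongly_measurable_N[OF assms(2,1)] by simp
    show "AE t in \<I> T. norm ((N (f t))\<^sup>2) \<le> norm (g t)"
      using assms(4) by eventually_elim simp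
  qed
  then show ?thesis using assms(1,2) by (simp add: bochner_L2_def)
qed

lemma bochner_L2_zero: "0 \<in> bochner_L2 T X N"
  using zero_mem by (auto simp: bochner_L2_def strongly_measurable_def N_zero intro!: exI[of _ "\<lambda>n t. 0"])

lemma strongly_measurable_diff:
  assumes f: "strongly_measurable T X N f" "AE t in \<I> T. f t \<in> X"
    and g: "strongly_measurable T X N g" "AE t in \<I> T. g t \<in> X"
  shows "strongly_measurable T X N (f - g)"
proof -
  obtain s where s: "\<And>n. simple_function (\<I> T) (s n)" "\<And>n t. t \<in> {0<..<T} \<Longrightarrow> s n t \<in> X"
    "AE t in \<I> T. (\<lambda>n. N (f t - s n t)) \<longlonglongrightarrow> 0"
    using f(1) unfolding strongly_measurable_def by blast
  obtain r where r: "\<And>n. simple_function (\<I> T) (r n)" "\<And>n t. t \<in> {0<..<T} \<Longrightarrow> r n t \<in> X"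
    "AE t in \<I> T. (\<lambda>n. N (g t - r n t)) \<longlonglongrightarrow> 0"
    using g(1) unfolding strongly_measurable_def by blast
  have "AE t in \<I> T. (\<lambda>n. N ((f - g) t - (s n t - r n t))) \<longlonglongrightarrow> 0"
    using s(3) r(3) f(2) g(2) AE_space
  proof eventually_elim
    case (elim t)
    then have t: "t \<in> {0<..<T}" by simp
    note mem = elim(3,4) s(2)[OF t] r(2)[OF t]
    have eq: "(f - g) t - (s n t - r n t) = (f t - s n t) - (g t - r n t)" for n by simp
    show ?case
    proof (rule tendsto_sandwich[where f = "\<lambda>n. 0"])
      show "(\<lambda>n. N (f t - s n t) + N (g t - r n t)) \<longlonglongrightarrow> 0"
        using tendsto_add[OF elim(1,2)] by simp
      show "\<forall>\<^sub>F n in sequentially. N ((f - g) t - (s n t - r n t)) \<le> N (f t - s n t) + N (g t - r n t)"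
        unfolding eq using mem by (intro always_eventually allI N_diff_le diff_mem)
      show "\<forall>\<^sub>F n in sequentially. 0 \<le> N ((f - g) t - (s n t - r n t))"
        unfolding eq using mem by (intro always_eventually allI N_nonneg diff_mem)
    qed simp
  qed
  then show ?thesis
    unfolding strongly_measurable_def using s r
    by (intro exI[of _ "\<lambda>n t. s n t - r n t"]) (auto intro: diff_mem simple_function_compose2[where h = "(-)"])
qed

lemma bochner_L2_diff:
  assumes f: "f \<in> bochner_L2 T X N" and g: "g \<in> bochner_L2 T X N"
  shows "f - g \<in> bochner_L2 T X N"
proof (rule bochner_L2I)
  note F = bochner_L2D[OF f] and G = bochner_L2D[OF g]
  show "AE t in \<I> T. (f - g) t \<in> X"
    using F(1) G(1) by eventually_elim (simp add: diff_mem)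
  show "strongly_measurable T X N (f - g)"
    by (intro strongly_measurable_diff F G)
  show "integrable (\<I> T) (\<lambda>t. 2 * (N (f t))\<^sup>2 + 2 * (N (g t))\<^sup>2)"
    using F(3) G(3) by simp
  show "AE t in \<I> T. (N ((f - g) t))\<^sup>2 \<le> 2 * (N (f t))\<^sup>2 + 2 * (N (g t))\<^sup>2"
    using F(1) G(1) by eventually_elim (simp add: N_diff_power2_le)
qed

lemma bochner_L2_uminus: "f \<in> bochner_L2 T X N \<Longrightarrow> - f \<in> bochner_L2 T X N"
  using bochner_L2_diff[OF bochner_L2_zero] by force

lemma bochner_L2_add: "f \<in> bochner_L2 T X N \<Longrightarrow> g \<in> bochner_L2 T X N \<Longrightarrow> f + g \<in> bochner_L2 T X N"
  using bochner_L2_diff[OF _ bochner_L2_uminus] by force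

text \<open>The simple functions of strong measurability converge almost everywhere but need no
  common bound. Setting them to zero where they exceed twice the size of \<open>f\<close> gives
  domination by a multiple of \<open>f\<close>, and dominated convergence applies.\<close>

lemma bochner_L2_simple_dense:
  assumes f: "f \<in> bochner_L2 T X N" and "0 < e"
  obtains p where "simple_function (\<I> T) p" "\<And>t. t \<in> {0<..<T} \<Longrightarrow> p t \<in> X"
    "integrable (\<I> T) (\<lambda>t. (N (f t - p t))\<^sup>2)"
    "(\<integral>t. (N (f t - p t))\<^sup>2 \<partial>\<I> T) < e"
proof -
  let ?M = "\<I> T"
  note F = bochner_L2D[OF f]
  obtain s where s: "\<And>n. simple_function ?M (s n)" "\<And>n t. t \<in> {0<..<T} \<Longrightarrow> s n t \<in> X"
    "AE t in ?M. (\<lambda>n. N (f t - s n t)) \<longlonglongrightarrow> 0"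
    using F(2) unfolding strongly_measurable_def by blast
  note fm [measurable] = bochner_L2_N_measurable[OF f]
  have sm [measurable]: "(\<lambda>t. N (s n t)) \<in> borel_measurable ?M" for n
    by (intro borel_measurable_simple_function simple_function_compose1[where g = N] s)
  \<comment> \<open>The factor 2 leaves room: where \<open>N (f t) > 0\<close> the truncation is
    eventually inactive, since \<open>N (s n t)\<close> tends to \<open>N (f t)\<close>; where
    \<open>N (f t) = 0\<close> the domination alone makes the error vanish.\<close>
  define p where "p n t = (if N (s n t) \<le> 2 * N (f t) then s n t else 0)" for n t
  have p_simple: "simple_function ?M (p n)" for n
  proof -
    have "{t \<in> space ?M. N (s n t) \<le> 2 * N (f t)} \<in> sets ?M" by measurable
    then show ?thesis
      unfolding p_def[abs_def] by (intro simple_function_If s simple_function_const)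
  qed
  have pX: "p n t \<in> X" if "t \<in> {0<..<T}" for n t
    using s(2)[OF that] zero_mem by (simp add: p_def)
  have p_le: "N (p n t) \<le> 2 * N (f t)" if "f t \<in> X" for n t
    using N_nonneg[OF that] N_zero by (simp add: p_def)
  have bound: "(N (f t - p n t))\<^sup>2 \<le> 9 * (N (f t))\<^sup>2" if "f t \<in> X" "t \<in> {0<..<T}" for n t
  proof -
    have "N (f t - p n t) \<le> 3 * N (f t)"
      using N_diff_le[OF that(1) pX[OF that(2)]] p_le[OF that(1)] by (smt (verit))
    then have "(N (f t - p n t))\<^sup>2 \<le> (3 * N (f t))\<^sup>2"
      using that pX N_nonneg diff_mem by (intro power_mono) auto
    then show ?thesis by (simp add: power_mult_distrib)
  qed
  have lim: "AE t in ?M. (\<lambda>n. (N (f t - p n t))\<^sup>2) \<longlonglongrightarrow> 0"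
    using s(3) F(1) AE_space
  proof eventually_elim
    case (elim t)
    then have t: "t \<in> {0<..<T}" by simp
    show ?case
    proof (cases "N (f t) = 0")
      case True
      then have "(N (f t - p n t))\<^sup>2 = 0" for n
        using bound[OF elim(2) t, of n] zero_le_power2[of "N (f t - p n t)"] by simp
      then show ?thesis by simp
    next
      case False
      then have "N (f t) < 2 * N (f t)" using N_nonneg[OF elim(2)] by simp
      with N_tendsto[OF elim(2) s(2)[OF t] elim(1)]
      have "eventually (\<lambda>n. N (s n t) < 2 * N (f t)) sequentially"
        by (rule order_tendstoD)
      then have "eventually (\<lambda>n. N (f t - s n t) = N (f t - p n t)) sequentially"
        by eventually_elim (simp add: p_def)
      from Lim_transform_eventually[OF elim(1) this] show ?thesis
        using tendsto_power[of _ 0 _ 2] by force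
    qed
  qed
  have pm: "(\<lambda>t. (N (f t - p n t))\<^sup>2) \<in> borel_measurable ?M" for n
  proof -
    have "strongly_measurable T X N (p n)"
      unfolding strongly_measurable_def using p_simple pX N_zero by (intro exI[of _ "\<lambda>m. p n"]) auto
    then have "strongly_measurable T X N (f - p n)"
      using F pX by (intro strongly_measurable_diff) auto
    moreover have "AE t in ?M. (f - p n) t \<in> X"
      using F(1) AE_space by eventually_elim (simp add: diff_mem pX)
    ultimately have "(\<lambda>t. N ((f - p n) t)) \<in> borel_measurable ?M"
      by (rule strongly_measurable_N)
    then show ?thesis by simp
  qed
  have "(\<lambda>n. \<integral>t. (N (f t - p n t))\<^sup>2 \<partial>?M) \<longlonglongrightarrow> (\<integral>t. 0 \<partial>?M)"
  proof (rule integral_dominated_convergence[where w = "\<lambda>t. 9 * (N (f t))\<^sup>2"])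
    show "AE t in ?M. norm ((N (f t - p n t))\<^sup>2) \<le> 9 * (N (f t))\<^sup>2" for n
      using F(1) AE_space by eventually_elim (use bound in auto)
  qed (use pm lim F(3) in auto)
  then have "eventually (\<lambda>n. (\<integral>t. (N (f t - p n t))\<^sup>2 \<partial>?M) < e) sequentially"
    using \<open>0 < e\<close> by (auto dest: order_tendstoD(2))
  then obtain n where n: "(\<integral>t. (N (f t - p n t))\<^sup>2 \<partial>?M) < e"
    by (meson eventually_sequentially order_refl)
  have "integrable ?M (\<lambda>t. (N (f t - p n t))\<^sup>2)"
  proof (rule Bochner_Integration.integrable_bound[OF _ pm])
    show "integrable ?M (\<lambda>t. 9 * (N (f t))\<^sup>2)" using F(3) by simp
    show "AE t in ?M. norm ((N (f t - p n t))\<^sup>2) \<le> norm (9 * (N (f t))\<^sup>2)"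
      using F(1) AE_space by eventually_elim (use bound in auto)
  qed
  with that p_simple pX n show ?thesis by blast
qed

end

text \<open>Phrased for nonexpansive maps instead of linear ones because it is applied to
  \<open>wgrad\<close> and \<open>riesz\<close>, whose values are arbitrary choices of
  representatives, as well as to \<open>Lstar\<close>.\<close>

lemma bochner_L2_map:
  assumes "seminormed_group X N" "seminormed_group Y P" and f: "f \<in> bochner_L2 T X N"
    and \<Phi>: "\<And>x. x \<in> X \<Longrightarrow> \<Phi> x \<in> Y" "\<And>x. x \<in> X \<Longrightarrow> P (\<Phi> x) \<le> N x"
      "\<And>x y. x \<in> X \<Longrightarrow> y \<in> X \<Longrightarrow> P (\<Phi> x - \<Phi> y) \<le> N (x - y)"
  shows "(\<lambda>t. \<Phi> (f t)) \<in> bochner_L2 T Y P"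
proof -
  interpret X: seminormed_group X N by fact
  interpret Y: seminormed_group Y P by fact
  note F = X.bochner_L2D[OF f]
  obtain s where s: "\<And>n. simple_function (\<I> T) (s n)" "\<And>n t. t \<in> {0<..<T} \<Longrightarrow> s n t \<in> X"
    "AE t in \<I> T. (\<lambda>n. N (f t - s n t)) \<longlonglongrightarrow> 0"
    using F(2) unfolding strongly_measurable_def by blast
  have "AE t in \<I> T. (\<lambda>n. P (\<Phi> (f t) - \<Phi> (s n t))) \<longlonglongrightarrow> 0"
    using s(3) F(1) AE_space
  proof eventually_elim
    case (elim t)
    then have "t \<in> {0<..<T}" by simp
    note mem = elim(2) s(2)[OF this]
    show ?case
    proof (rule tendsto_sandwich[where f = "\<lambda>n. 0"])
      show "\<forall>\<^sub>F n in sequentially. 0 \<le> P (\<Phi> (f t) - \<Phi> (s n t))"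
        using mem by (intro always_eventually allI Y.N_nonneg Y.diff_mem \<Phi>)
      show "\<forall>\<^sub>F n in sequentially. P (\<Phi> (f t) - \<Phi> (s n t)) \<le> N (f t - s n t)"
        using mem by (intro always_eventually allI \<Phi>)
    qed (use elim in auto)
  qed
  then have "strongly_measurable T Y P (\<lambda>t. \<Phi> (f t))"
    unfolding strongly_measurable_def using s \<Phi>(1)
    by (intro exI[of _ "\<lambda>n t. \<Phi> (s n t)"]) (auto intro: simple_function_compose1[where g = \<Phi>])
  moreover have "AE t in \<I> T. \<Phi> (f t) \<in> Y"
    using F(1) by eventually_elim (rule \<Phi>)
  moreover have "AE t in \<I> T. (P (\<Phi> (f t)))\<^sup>2 \<le> (N (f t))\<^sup>2"
    using F(1) by eventually_elim (intro power_mono \<Phi> Y.N_nonneg)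
  ultimately show ?thesis
    using F(3) by (intro Y.bochner_L2I)
qed

text \<open>Common frame for the inner product of \<open>L2\<close> and for the duality between
  \<open>V\<close> and its dual.\<close>

locale bounded_pairing = X: seminormed_group X N + Y: seminormed_group Y P
  for X :: "'b::ab_group_add set" and N and Y :: "'c::ab_group_add set" and P +
  fixes B :: "'b \<Rightarrow> 'c \<Rightarrow> real"
  assumes B_le: "x \<in> X \<Longrightarrow> y \<in> Y \<Longrightarrow> \<bar>B x y\<bar> \<le> N x * P y"
    and B_diff_left: "x \<in> X \<Longrightarrow> x' \<in> X \<Longrightarrow> y \<in> Y \<Longrightarrow> B (x - x') y = B x y - B x' y"
    and B_diff_right: "x \<in> X \<Longrightarrow> y \<in> Y \<Longrightarrow> y' \<in> Y \<Longrightarrow> B x (y - y') = B x y - B x y'"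
begin

lemma B_tendsto:
  assumes "x \<in> X" "y \<in> Y" "\<And>n. xs n \<in> X" "\<And>n. ys n \<in> Y"
    and lim: "(\<lambda>n. N (x - xs n)) \<longlonglongrightarrow> 0" "(\<lambda>n. P (y - ys n)) \<longlonglongrightarrow> 0"
  shows "(\<lambda>n. B (xs n) (ys n)) \<longlonglongrightarrow> B x y"
proof (rule Lim_transform_bound[THEN LIM_zero_cancel])
  have "(\<lambda>n. N (x - xs n) * P y + N (xs n) * P (y - ys n)) \<longlonglongrightarrow> 0 * P y + N x * 0"
    by (intro tendsto_intros lim X.N_tendsto assms)
  then show "(\<lambda>n. N (x - xs n) * P y + N (xs n) * P (y - ys n)) \<longlonglongrightarrow> 0" by simp
  show "\<forall>\<^sub>F n in sequentially. norm (B (xs n) (ys n) - B x y) \<le> norm (N (x - xs n) * P y + N (xs n) * P (y - ys n))"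
  proof (intro always_eventually allI)
    fix n
    have "norm (B (xs n) (ys n) - B x y) = \<bar>B (x - xs n) y + B (xs n) (y - ys n)\<bar>"
      using assms by (simp add: B_diff_left B_diff_right abs_minus_commute)
    also have "\<dots> \<le> N (x - xs n) * P y + N (xs n) * P (y - ys n)"
      using B_le[of "x - xs n" y] B_le[of "xs n" "y - ys n"] assms X.diff_mem Y.diff_mem by force
    finally show "norm (B (xs n) (ys n) - B x y) \<le> norm (N (x - xs n) * P y + N (xs n) * P (y - ys n))"
      by simp
  qed
qed

lemma pairing_measurable:
  assumes "f \<in> bochner_L2 T X N" "g \<in> bochner_L2 T Y P"
  shows "(\<lambda>t. B (f t) (g t)) \<in> borel_measurable (\<I> T)"
  using X.bochner_L2D[OF assms(1)] Y.bochner_L2D[OF assms(2)]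
  by (intro strongly_measurable_compose2[where K = B and X = X and Y = Y and N = N and P = P] B_tendsto)

lemma pairing_integrable:
  assumes f: "f \<in> bochner_L2 T X N" and g: "g \<in> bochner_L2 T Y P"
  shows "integrable (\<I> T) (\<lambda>t. B (f t) (g t))"
proof (rule Bochner_Integration.integrable_bound[OF _ pairing_measurable[OF f g]])
  note F = X.bochner_L2D[OF f] and G = Y.bochner_L2D[OF g]
  show "integrable (\<I> T) (\<lambda>t. (N (f t))\<^sup>2 + (P (g t))\<^sup>2)"
    using F(3) G(3) by simp
  show "AE t in \<I> T. norm (B (f t) (g t)) \<le> norm ((N (f t))\<^sup>2 + (P (g t))\<^sup>2)"
    using F(1) G(1)
  proof eventually_elim
    case (elim t)
    have "2 * (N (f t) * P (g t)) \<le> (N (f t))\<^sup>2 + (P (g t))\<^sup>2"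
      using sum_squares_bound[of "N (f t)" "P (g t)"] by simp
    moreover have "0 \<le> N (f t) * P (g t)"
      using elim by (intro mult_nonneg_nonneg X.N_nonneg Y.N_nonneg)
    ultimately show ?case using B_le[OF elim] by simp
  qed
qed

end

subsection \<open>Averaged translations\<close>

lemma finite_measure_interval: "finite_measure (lebesgue_on {0<..<T::real})"
  by (intro finite_measure_lebesgue_on) auto

lemma sigma_finite_interval: "sigma_finite_measure (lebesgue_on {0<..<T::real})"
  using finite_measure_interval finite_measure.axioms(1) by blast

lemma emeasure_interval_le: "emeasure (lebesgue_on {0<..<T::real}) {t \<in> space (\<I> T). \<bar>t - s\<bar> < h} \<le> ennreal (2 * h)"
proof (cases "0 < h")
  case True
  have "{t \<in> space (\<I> T). \<bar>t - s\<bar> < h} = {0<..<T} \<inter> {s - h<..<s + h}"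
    by auto
  then have "emeasure (\<I> T) {t \<in> space (\<I> T). \<bar>t - s\<bar> < h}
      = emeasure lebesgue ({0<..<T} \<inter> {s - h<..<s + h})"
    by (simp only:, intro emeasure_restrict_space[OF _ Int_lower1]) simp
  also have "\<dots> \<le> emeasure lebesgue {s - h<..<s + h}"
    by (intro emeasure_mono) auto
  also have "\<dots> = ennreal (2 * h)" using True by simp
  finally show ?thesis .
next
  case False
  then have "{t \<in> space (\<I> T). \<bar>t - s\<bar> < h} = {}" by auto
  then show ?thesis by (simp only: emeasure_empty zero_le)
qed

text \<open>An average that is not normalised, over the times within distance \<open>h\<close> of
  \<open>t\<close>. Values in \<open>ennreal\<close> keep it meaningful without integrability;
  negative values of \<open>g\<close> count as zero.\<close>

definition window_integral :: "real \<Rightarrow> real \<Rightarrow> (real \<Rightarrow> real) \<Rightarrow> real \<Rightarrow> ennreal" where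
  "window_integral T h g t = (\<integral>\<^sup>+s. ennreal (if \<bar>s - t\<bar> < h then g s else 0) \<partial>\<I> T)"

lemma ident_measurable_interval [measurable]: "(\<lambda>x. x) \<in> borel_measurable (lebesgue_on {0<..<T::real})"
  using id_borel_measurable_lebesgue_on by (simp add: id_def)

lemma window_measurable:
  assumes "g \<in> borel_measurable (\<I> T)"
  shows "(\<lambda>s. ennreal (if \<bar>s - t\<bar> < h then g s else 0)) \<in> borel_measurable (lebesgue_on {0<..<T::real})"
  using assms by measurable

text \<open>Tonelli: a time \<open>s\<close> is seen only by the \<open>t\<close> within distance
  \<open>h\<close> of it, a set of measure at most \<open>2 * h\<close>.\<close>

lemma
  assumes g [measurable]: "g \<in> borel_measurable (\<I> T)"
  shows window_integral_measurable: "window_integral T h g \<in> borel_measurable (\<I> T)"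
    and window_integral_integral_le: "(\<integral>\<^sup>+t. window_integral T h g t \<partial>\<I> T)
      \<le> ennreal (2 * h) * (\<integral>\<^sup>+s. ennreal (g s) \<partial>\<I> T)"
proof -
  let ?M = "\<I> T"
  interpret M: sigma_finite_measure ?M by (rule sigma_finite_interval)
  interpret P: pair_sigma_finite ?M ?M ..
  have [measurable]: "(\<lambda>p. fst p) \<in> borel_measurable (?M \<Otimes>\<^sub>M ?M)" "(\<lambda>p. snd p) \<in> borel_measurable (?M \<Otimes>\<^sub>M ?M)"
    using measurable_compose[OF measurable_fst ident_measurable_interval]
      measurable_compose[OF measurable_snd ident_measurable_interval] by auto
  have [measurable]: "(\<lambda>p. g (fst p)) \<in> borel_measurable (?M \<Otimes>\<^sub>M ?M)"
    "(\<lambda>p. g (snd p)) \<in> borel_measurable (?M \<Otimes>\<^sub>M ?M)"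
    using measurable_compose[OF measurable_fst g] measurable_compose[OF measurable_snd g] by auto
  have "(\<lambda>p. ennreal (if \<bar>snd p - fst p\<bar> < h then g (snd p) else 0)) \<in> borel_measurable (?M \<Otimes>\<^sub>M ?M)"
    by measurable
  then have "(\<lambda>(t, s). ennreal (if \<bar>s - t\<bar> < h then g s else 0)) \<in> borel_measurable (?M \<Otimes>\<^sub>M ?M)"
    by (simp add: case_prod_beta')
  from M.borel_measurable_nn_integral[OF this]
  show "window_integral T h g \<in> borel_measurable ?M"
    by (simp add: window_integral_def[abs_def])
  have m: "(\<lambda>(s, t). ennreal (if \<bar>s - t\<bar> < h then g s else 0)) \<in> borel_measurable (?M \<Otimes>\<^sub>M ?M)"
    unfolding case_prod_beta' by measurable
  have "(\<integral>\<^sup>+t. window_integral T h g t \<partial>?M) = (\<integral>\<^sup>+s. \<integral>\<^sup>+t. ennreal (if \<bar>s - t\<bar> < h then g s else 0) \<partial>?M \<partial>?M)"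
    unfolding window_integral_def by (rule P.Fubini'[OF m])
  also have "\<dots> \<le> (\<integral>\<^sup>+s. ennreal (2 * h) * ennreal (g s) \<partial>?M)"
  proof (rule nn_integral_mono)
    fix s
    have "(\<integral>\<^sup>+t. ennreal (if \<bar>s - t\<bar> < h then g s else 0) \<partial>?M)
        = (\<integral>\<^sup>+t. ennreal (g s) * indicator {t \<in> space ?M. \<bar>t - s\<bar> < h} t \<partial>?M)"
      by (intro nn_integral_cong) (auto simp: abs_minus_commute)
    also have "\<dots> = ennreal (g s) * emeasure ?M {t \<in> space ?M. \<bar>t - s\<bar> < h}"
      by (intro nn_integral_cmult_indicator) measurable
    also have "\<dots> \<le> ennreal (g s) * ennreal (2 * h)"
      by (intro mult_left_mono emeasure_interval_le) simp
    finally show "(\<integral>\<^sup>+t. ennreal (if \<bar>s - t\<bar> < h then g s else 0) \<partial>?M) \<le> ennreal (2 * h) * ennreal (g s)"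
      by (simp add: mult.commute)
  qed
  also have "\<dots> = ennreal (2 * h) * (\<integral>\<^sup>+s. ennreal (g s) \<partial>?M)"
    by (intro nn_integral_cmult) measurable
  finally show "(\<integral>\<^sup>+t. window_integral T h g t \<partial>?M) \<le> ennreal (2 * h) * (\<integral>\<^sup>+s. ennreal (g s) \<partial>?M)" .
qed

lemma window_integral_const_le: "window_integral T h (\<lambda>s. c) t \<le> ennreal (2 * h) * ennreal c"
proof -
  let ?M = "\<I> T"
  have "window_integral T h (\<lambda>s. c) t = (\<integral>\<^sup>+s. ennreal c * indicator {s \<in> space ?M. \<bar>s - t\<bar> < h} s \<partial>?M)"
    unfolding window_integral_def by (intro nn_integral_cong) auto
  also have "\<dots> = ennreal c * emeasure ?M {s \<in> space ?M. \<bar>s - t\<bar> < h}"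
    by (intro nn_integral_cmult_indicator) measurable
  also have "\<dots> \<le> ennreal c * ennreal (2 * h)"
    by (intro mult_left_mono emeasure_interval_le) simp
  finally show ?thesis by (simp add: mult.commute)
qed

lemma window_integral_mono_AE:
  assumes "AE s in \<I> T. g s \<le> g' s"
  shows "window_integral T h g t \<le> window_integral T h g' t"
  unfolding window_integral_def using assms
  by (intro nn_integral_mono_AE) (auto elim!: eventually_mono intro!: ennreal_leI)

lemma window_integral_add:
  assumes "g \<in> borel_measurable (\<I> T)" "g' \<in> borel_measurable (\<I> T)"
    and "\<And>s. 0 \<le> g s" "\<And>s. 0 \<le> g' s"
  shows "window_integral T h (\<lambda>s. g s + g' s) t = window_integral T h g t + window_integral T h g' t"
proof -
  have "window_integral T h (\<lambda>s. g s + g' s) t = (\<integral>\<^sup>+s. ennreal (if \<bar>s - t\<bar> < h then g s else 0) +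
      ennreal (if \<bar>s - t\<bar> < h then g' s else 0) \<partial>\<I> T)"
    unfolding window_integral_def using assms(3,4) by (intro nn_integral_cong) (auto simp: ennreal_plus)
  then show ?thesis
    unfolding window_integral_def using assms(1,2)[THEN window_measurable] by (simp add: nn_integral_add)
qed

lemma window_integral_cmult:
  assumes "g \<in> borel_measurable (\<I> T)" "0 \<le> c"
  shows "window_integral T h (\<lambda>s. c * g s) t = ennreal c * window_integral T h g t"
proof -
  have "window_integral T h (\<lambda>s. c * g s) t
      = (\<integral>\<^sup>+s. ennreal c * ennreal (if \<bar>s - t\<bar> < h then g s else 0) \<partial>\<I> T)"
    unfolding window_integral_def using assms(2) by (intro nn_integral_cong) (auto simp: ennreal_mult')
  then show ?thesis
    unfolding window_integral_def using window_measurable[OF assms(1)] by (simp add: nn_integral_cmult)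
qed

text \<open>
  Only a measurable majorant of the inner integral is required, so that \<open>F\<close> need not be jointly
  measurable.
\<close>

definition window_bound :: "real \<Rightarrow> real \<Rightarrow> (real \<Rightarrow> real \<Rightarrow> real) \<Rightarrow> real \<Rightarrow> bool" where
  "window_bound T h F c \<longleftrightarrow> (\<exists>K\<in>borel_measurable (\<I> T).
     (AE t in \<I> T. window_integral T h (\<lambda>s. F s t) t \<le> K t) \<and>
     (\<integral>\<^sup>+t. K t \<partial>\<I> T) \<le> ennreal c)"

text \<open>The mass of \<open>F\<close> on the strip of width of order \<open>h\<close> around the
  diagonal is \<open>o(h)\<close>: on average \<open>F\<close> tends to zero at the diagonal. With
  \<open>F s t\<close> a distance between \<open>g s\<close> and \<open>g t\<close> this is an
  averaged form of continuity of translations.\<close>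

definition vanishing_average :: "real \<Rightarrow> (real \<Rightarrow> real \<Rightarrow> real) \<Rightarrow> bool" where
  "vanishing_average T F \<longleftrightarrow> (\<forall>e>0. \<forall>\<^sub>F h in at_right 0. window_bound T h F (e * h))"

lemma window_boundI:
  assumes "K \<in> borel_measurable (\<I> T)"
    and "AE t in \<I> T. window_integral T h (\<lambda>s. F s t) t \<le> K t"
    and "(\<integral>\<^sup>+t. K t \<partial>\<I> T) \<le> ennreal c"
  shows "window_bound T h F c"
  unfolding window_bound_def using assms by blast

lemma window_boundE:
  assumes "window_bound T h F c"
  obtains K where "K \<in> borel_measurable (\<I> T)"
    and "AE t in \<I> T. window_integral T h (\<lambda>s. F s t) t \<le> K t"
    and "(\<integral>\<^sup>+t. K t \<partial>\<I> T) \<le> ennreal c"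
  using assms unfolding window_bound_def by blast

lemma vanishing_averageI:
  assumes "\<And>e. 0 < e \<Longrightarrow> \<forall>\<^sub>F h in at_right 0. 0 < h \<longrightarrow> window_bound T h F (e * h)"
  shows "vanishing_average T F"
  unfolding vanishing_average_def
proof (intro allI impI)
  fix e :: real assume "0 < e"
  from assms[OF this] eventually_at_right_less[of "0::real"]
  show "\<forall>\<^sub>F h in at_right 0. window_bound T h F (e * h)"
    by eventually_elim simp
qed

lemma vanishing_averageD:
  "vanishing_average T F \<Longrightarrow> 0 < e \<Longrightarrow> \<forall>\<^sub>F h in at_right 0. window_bound T h F (e * h)"
  by (simp add: vanishing_average_def)

text \<open>The error \<open>d s\<close> costs at most \<open>2 * h * \<delta>\<close> by Tonelli.
  The error \<open>d t\<close> is constant on its window, of measure at most \<open>2 * h\<close>,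
  and costs the same again; hence the constant 4.\<close>

lemma window_bound_approx:
  assumes G: "window_bound T h G c" "0 \<le> c" "0 < h"
    and Gm: "AE t in \<I> T. (\<lambda>s. G s t) \<in> borel_measurable (\<I> T)"
    and G0: "\<And>s t. 0 \<le> G s t"
    and d: "integrable (\<I> T) d" "\<And>s. 0 \<le> d s" "(\<integral>s. d s \<partial>\<I> T) \<le> \<delta>"
    and F: "AE t in \<I> T. AE s in \<I> T. F s t \<le> d s + G s t + d t"
  shows "window_bound T h F (c + 4 * h * \<delta>)"
proof -
  let ?M = "\<I> T"
  have "0 \<le> \<delta>" by (rule order_trans[OF _ d(3)]) (simp add: d(2))
  have dm [measurable]: "d \<in> borel_measurable ?M" using d(1) by simp
  have dI: "(\<integral>\<^sup>+s. ennreal (d s) \<partial>?M) \<le> ennreal \<delta>"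
    using d by (simp add: nn_integral_eq_integral ennreal_leI)
  obtain K where K [measurable]: "K \<in> borel_measurable ?M"
    and K_le: "AE t in ?M. window_integral T h (\<lambda>s. G s t) t \<le> K t"
    and KI: "(\<integral>\<^sup>+t. K t \<partial>?M) \<le> ennreal c"
    using window_boundE[OF G(1)] .
  have wm [measurable]: "window_integral T h d \<in> borel_measurable ?M"
    by (rule window_integral_measurable[OF dm])
  show ?thesis
  proof (rule window_boundI)
    let ?K = "\<lambda>t. window_integral T h d t + K t + ennreal (2 * h) * ennreal (d t)"
    show "?K \<in> borel_measurable ?M" by measurable
    show "AE t in ?M. window_integral T h (\<lambda>s. F s t) t \<le> ?K t"
      using F K_le Gm
    proof eventually_elim
      case (elim t)
      have "window_integral T h (\<lambda>s. F s t) t \<le> window_integral T h (\<lambda>s. (d s + G s t) + d t) t"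
        by (rule window_integral_mono_AE[OF elim(1)])
      also have "\<dots> = window_integral T h d t + window_integral T h (\<lambda>s. G s t) t + window_integral T h (\<lambda>s. d t) t"
        using elim(3) d(2) G0 by (simp add: window_integral_add)
      also have "\<dots> \<le> ?K t"
        using elim(2) by (intro add_mono window_integral_const_le) auto
      finally show ?case .
    qed
    have "(\<integral>\<^sup>+t. ?K t \<partial>?M) = (\<integral>\<^sup>+t. window_integral T h d t \<partial>?M) + (\<integral>\<^sup>+t. K t \<partial>?M)
        + ennreal (2 * h) * (\<integral>\<^sup>+t. ennreal (d t) \<partial>?M)"
      by (simp add: nn_integral_add nn_integral_cmult)
    also have "\<dots> \<le> ennreal (2 * h) * ennreal \<delta> + ennreal c + ennreal (2 * h) * ennreal \<delta>"
      by (intro add_mono KI mult_left_mono dI order_trans[OF window_integral_integral_le[OF dm]]) auto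
    also have "\<dots> = ennreal (c + 4 * h * \<delta>)"
      using G(2,3) \<open>0 \<le> \<delta>\<close> by (simp add: ennreal_mult'[symmetric] ennreal_plus[symmetric] del: ennreal_plus)
    finally show "(\<integral>\<^sup>+t. ?K t \<partial>?M) \<le> ennreal (c + 4 * h * \<delta>)" .
  qed
qed

text \<open>The density principle behind all the cases below: it leads from continuous functions to
  indicators, from those to simple functions, then to Bochner functions, and finally to products
  with a square integrable factor.\<close>

lemma vanishing_average_approx:
  assumes "\<And>\<delta>. 0 < \<delta> \<Longrightarrow> \<exists>G d. vanishing_average T G \<and>
      (AE t in \<I> T. (\<lambda>s. G s t) \<in> borel_measurable (\<I> T)) \<and>
      (\<forall>s t. 0 \<le> G s t) \<and> integrable (\<I> T) d \<and> (\<forall>s. 0 \<le> d s) \<and>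
      (\<integral>s. d s \<partial>\<I> T) \<le> \<delta> \<and>
      (AE t in \<I> T. AE s in \<I> T. F s t \<le> d s + G s t + d t)"
  shows "vanishing_average T F"
proof (rule vanishing_averageI)
  fix e :: real assume "0 < e"
  \<comment> \<open>Four times this error is one half of \<open>e\<close>; the other half goes to
    \<open>G\<close>.\<close>
  then have "0 < e / 8" by simp
  from assms[OF this] obtain G d where VA: "vanishing_average T G"
    and Gd: "AE t in \<I> T. (\<lambda>s. G s t) \<in> borel_measurable (\<I> T)"
      "\<And>s t. 0 \<le> G s t" "integrable (\<I> T) d" "\<And>s. 0 \<le> d s"
      "(\<integral>s. d s \<partial>\<I> T) \<le> e / 8"
      "AE t in \<I> T. AE s in \<I> T. F s t \<le> d s + G s t + d t"
    by (elim exE conjE) blast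
  show "\<forall>\<^sub>F h in at_right 0. 0 < h \<longrightarrow> window_bound T h F (e * h)"
    using vanishing_averageD[OF VA half_gt_zero[OF \<open>0 < e\<close>]]
  proof (eventually_elim, intro impI)
    fix h :: real assume h: "window_bound T h G (e / 2 * h)" "0 < h"
    have "window_bound T h F (e / 2 * h + 4 * h * (e / 8))"
      using h \<open>0 < e\<close> by (intro window_bound_approx[OF h(1) _ h(2) Gd]) simp
    then show "window_bound T h F (e * h)" by (simp add: field_simps)
  qed
qed

section \<open>Closure properties and examples of vanishing averages\<close>

lemma vanishing_average_zero: "vanishing_average T (\<lambda>s t. 0)"
  by (intro vanishing_averageI always_eventually allI impI window_boundI[of "\<lambda>_. 0"])
    (simp_all add: window_integral_def)

lemma vanishing_average_add:
  assumes F: "vanishing_average T F" and G: "vanishing_average T G"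
    and Fm: "AE t in \<I> T. (\<lambda>s. F s t) \<in> borel_measurable (\<I> T)"
    and Gm: "AE t in \<I> T. (\<lambda>s. G s t) \<in> borel_measurable (\<I> T)"
    and nonneg: "\<And>s t. 0 \<le> F s t" "\<And>s t. 0 \<le> G s t"
  shows "vanishing_average T (\<lambda>s t. F s t + G s t)"
proof (rule vanishing_averageI)
  let ?M = "\<I> T"
  fix e :: real assume "0 < e"
  note half = half_gt_zero[OF this]
  show "\<forall>\<^sub>F h in at_right 0. 0 < h \<longrightarrow> window_bound T h (\<lambda>s t. F s t + G s t) (e * h)"
    using vanishing_averageD[OF F half] vanishing_averageD[OF G half]
  proof (eventually_elim, intro impI)
    fix h :: real
    assume FG: "window_bound T h F (e / 2 * h)" "window_bound T h G (e / 2 * h)" and h: "0 < h"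
    obtain K where K [measurable]: "K \<in> borel_measurable ?M"
      and K_le: "AE t in ?M. window_integral T h (\<lambda>s. F s t) t \<le> K t"
      and KI: "(\<integral>\<^sup>+t. K t \<partial>?M) \<le> ennreal (e / 2 * h)"
      using window_boundE[OF FG(1)] .
    obtain L where L [measurable]: "L \<in> borel_measurable ?M"
      and L_le: "AE t in ?M. window_integral T h (\<lambda>s. G s t) t \<le> L t"
      and LI: "(\<integral>\<^sup>+t. L t \<partial>?M) \<le> ennreal (e / 2 * h)"
      using window_boundE[OF FG(2)] .
    show "window_bound T h (\<lambda>s t. F s t + G s t) (e * h)"
    proof (rule window_boundI)
      show "(\<lambda>t. K t + L t) \<in> borel_measurable ?M" by measurable
      show "AE t in ?M. window_integral T h (\<lambda>s. F s t + G s t) t \<le> K t + L t"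
        using K_le L_le Fm Gm by eventually_elim (simp add: window_integral_add nonneg add_mono)
      have "(\<integral>\<^sup>+t. K t + L t \<partial>?M) \<le> ennreal (e / 2 * h) + ennreal (e / 2 * h)"
        using add_mono[OF KI LI] by (simp add: nn_integral_add)
      also have "\<dots> = ennreal (e * h)"
        using h \<open>0 < e\<close> by (simp add: ennreal_plus[symmetric] del: ennreal_plus)
      finally show "(\<integral>\<^sup>+t. K t + L t \<partial>?M) \<le> ennreal (e * h)" .
    qed
  qed
qed

lemma vanishing_average_sum:
  assumes "finite Z" "\<And>z. z \<in> Z \<Longrightarrow> vanishing_average T (F z)"
    and "\<And>z t. z \<in> Z \<Longrightarrow> (\<lambda>s. F z s t) \<in> borel_measurable (\<I> T)"
    and "\<And>z s t. z \<in> Z \<Longrightarrow> 0 \<le> F z s t"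
  shows "vanishing_average T (\<lambda>s t. \<Sum>z\<in>Z. F z s t)"
  using assms
proof (induction Z)
  case empty
  then show ?case using vanishing_average_zero by simp
next
  case (insert z Z)
  then show ?case
    by (simp, intro vanishing_average_add) (auto intro!: borel_measurable_sum sum_nonneg)
qed

lemma vanishing_average_cmult:
  assumes F: "vanishing_average T F" and "0 < c"
    and Fm: "AE t in \<I> T. (\<lambda>s. F s t) \<in> borel_measurable (\<I> T)"
  shows "vanishing_average T (\<lambda>s t. c * F s t)"
proof (rule vanishing_averageI)
  let ?M = "\<I> T"
  fix e :: real assume "0 < e"
  with \<open>0 < c\<close> have ec: "0 < e / c" by simp
  show "\<forall>\<^sub>F h in at_right 0. 0 < h \<longrightarrow> window_bound T h (\<lambda>s t. c * F s t) (e * h)"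
    using vanishing_averageD[OF F ec]
  proof (eventually_elim, intro impI)
    fix h :: real assume h: "window_bound T h F (e / c * h)" "0 < h"
    obtain K where K [measurable]: "K \<in> borel_measurable ?M"
      and K_le: "AE t in ?M. window_integral T h (\<lambda>s. F s t) t \<le> K t"
      and KI: "(\<integral>\<^sup>+t. K t \<partial>?M) \<le> ennreal (e / c * h)"
      using window_boundE[OF h(1)] .
    show "window_bound T h (\<lambda>s t. c * F s t) (e * h)"
    proof (rule window_boundI)
      show "(\<lambda>t. ennreal c * K t) \<in> borel_measurable ?M" by measurable
      show "AE t in ?M. window_integral T h (\<lambda>s. c * F s t) t \<le> ennreal c * K t"
        using K_le Fm
        by eventually_elim (simp add: window_integral_cmult mult_left_mono less_imp_le[OF \<open>0 < c\<close>])
      have "(\<integral>\<^sup>+t. ennreal c * K t \<partial>?M) \<le> ennreal c * ennreal (e / c * h)"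
        using KI by (simp add: nn_integral_cmult mult_left_mono)
      also have "\<dots> = ennreal (e * h)"
        using \<open>0 < c\<close> by (simp add: ennreal_mult'[symmetric])
      finally show "(\<integral>\<^sup>+t. ennreal c * K t \<partial>?M) \<le> ennreal (e * h)" .
    qed
  qed
qed

text \<open>Uniform continuity on the compact interval bounds the whole window by a constant once
  \<open>h\<close> is small; this is the base of the density argument.\<close>

lemma vanishing_average_continuous:
  assumes g: "continuous_on UNIV g"
  shows "vanishing_average T (\<lambda>s t. \<bar>g s - g t :: real\<bar>)"
proof (rule vanishing_averageI)
  fix e :: real assume "0 < e"
  let ?M = "\<I> T"
  \<comment> \<open>A window contributes at most \<open>2 * h * \<omega>\<close>, and integration
    over the interval multiplies this by at most \<open>\<bar>T\<bar>\<close>; the summand 1 avoids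
    division by zero.\<close>
  define \<omega> where "\<omega> = e / (2 * (\<bar>T\<bar> + 1))"
  have "0 < \<omega>" using \<open>0 < e\<close> by (simp add: \<omega>_def add_nonneg_pos)
  have "uniformly_continuous_on {0..T} g"
    using g by (intro compact_uniformly_continuous continuous_on_subset[OF g]) auto
  then obtain h0 where "0 < h0" and h0: "\<And>s t. s \<in> {0..T} \<Longrightarrow> t \<in> {0..T} \<Longrightarrow> \<bar>s - t\<bar> < h0 \<Longrightarrow> \<bar>g s - g t\<bar> < \<omega>"
    using \<open>0 < \<omega>\<close> unfolding uniformly_continuous_on_def dist_real_def by (metis abs_minus_commute)
  have "window_bound T h (\<lambda>s t. \<bar>g s - g t\<bar>) (e * h)" if h: "0 < h" "h < h0" for h
  proof (rule window_boundI)
    show "(\<lambda>t. ennreal (2 * h) * ennreal \<omega>) \<in> borel_measurable ?M" by simp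
    show "AE t in ?M. window_integral T h (\<lambda>s. \<bar>g s - g t\<bar>) t \<le> ennreal (2 * h) * ennreal \<omega>"
    proof (rule AE_I2)
      fix t assume t: "t \<in> space ?M"
      have "window_integral T h (\<lambda>s. \<bar>g s - g t\<bar>) t \<le> window_integral T h (\<lambda>s. \<omega>) t"
        unfolding window_integral_def using h0[of _ t] t h
        by (intro nn_integral_mono) (auto intro!: ennreal_leI simp: less_imp_le)
      also have "\<dots> \<le> ennreal (2 * h) * ennreal \<omega>"
        by (rule window_integral_const_le)
      finally show "window_integral T h (\<lambda>s. \<bar>g s - g t\<bar>) t \<le> ennreal (2 * h) * ennreal \<omega>" .
    qed
    have "emeasure ?M (space ?M) \<le> ennreal \<bar>T\<bar>"
      by (cases "0 \<le> T") (simp_all add: emeasure_restrict_space)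
    then have "(\<integral>\<^sup>+t. ennreal (2 * h) * ennreal \<omega> \<partial>?M) \<le> ennreal (2 * h) * ennreal \<omega> * ennreal \<bar>T\<bar>"
      by (simp add: mult_left_mono)
    also have "\<dots> = ennreal (2 * h * \<omega> * \<bar>T\<bar>)"
      using h \<open>0 < \<omega>\<close> by (simp add: ennreal_mult')
    also have "\<dots> \<le> ennreal (e * h)"
    proof (rule ennreal_leI)
      have "2 * \<omega> * \<bar>T\<bar> \<le> e" using \<open>0 < e\<close> by (simp add: \<omega>_def field_simps)
      then have "h * (2 * \<omega> * \<bar>T\<bar>) \<le> h * e" using h by (intro mult_left_mono) auto
      then show "2 * h * \<omega> * \<bar>T\<bar> \<le> e * h" by (simp add: mult_ac)
    qed
    finally show "(\<integral>\<^sup>+t. ennreal (2 * h) * ennreal \<omega> \<partial>?M) \<le> ennreal (e * h)" .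
  qed
  then show "\<forall>\<^sub>F h in at_right 0. 0 < h \<longrightarrow> window_bound T h (\<lambda>s t. \<bar>g s - g t\<bar>) (e * h)"
    using \<open>0 < h0\<close> by (auto simp: eventually_at_right_field)
qed

text \<open>Regularity of Lebesgue measure puts a closed set \<open>C\<close> inside and an open set
  \<open>U\<close> around \<open>E\<close> with small gap. A Urysohn function that is 1 on
  \<open>C\<close> and 0 off \<open>U\<close> can differ from the indicator only on
  \<open>U - C\<close>.\<close>

lemma continuous_L1_approx_indicator:
  assumes E: "E \<in> sets (lebesgue_on {0<..<T::real})" and "0 < \<delta>"
  obtains g :: "real \<Rightarrow> real" where "continuous_on UNIV g" "\<And>x. 0 \<le> g x" "\<And>x. g x \<le> 1"
    "(\<integral>s. \<bar>indicator E s - g s\<bar> \<partial>\<I> T) \<le> \<delta>"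
proof -
  let ?M = "\<I> T"
  have EL: "E \<in> sets lebesgue" "E \<subseteq> {0<..<T}"
    using E by (auto simp: sets_restrict_space)
  obtain C where C: "closed C" "C \<subseteq> E" "E - C \<in> lmeasurable" "emeasure lebesgue (E - C) < ennreal (\<delta> / 2)"
    using sets_lebesgue_inner_closed[OF EL(1), of "\<delta> / 2"] \<open>0 < \<delta>\<close> by auto
  obtain U where U: "open U" "E \<subseteq> U" "U - E \<in> lmeasurable" "emeasure lebesgue (U - E) < ennreal (\<delta> / 2)"
    using sets_lebesgue_outer_open[OF EL(1), of "\<delta> / 2"] \<open>0 < \<delta>\<close> by auto
  obtain g :: "real \<Rightarrow> real" where g: "continuous_on UNIV g" "\<And>x. g x \<in> closed_segment 0 1"
      "\<And>x. x \<in> - U \<Longrightarrow> g x = 0" "\<And>x. x \<in> C \<Longrightarrow> g x = 1"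
    using Urysohn[of "- U" C 0 1] C U by auto
  then have g01: "0 \<le> g x" "g x \<le> 1" for x
    using g(2)[of x] by (auto simp: closed_segment_eq_real_ivl)
  have UC: "U - C \<in> lmeasurable"
  proof -
    have "U - C = (U - E) \<union> (E - C)" using C U by auto
    then show ?thesis using C U by auto
  qed
  have "measure lebesgue (U - C) \<le> \<delta>"
  proof -
    have eq: "U - C = (U - E) \<union> (E - C)" using C U by auto
    have "measure lebesgue (U - C) \<le> measure lebesgue (U - E) + measure lebesgue (E - C)"
      unfolding eq using C U by (intro measure_Un_le) auto
    moreover have "measure lebesgue (U - E) \<le> \<delta> / 2" "measure lebesgue (E - C) \<le> \<delta> / 2"
      using C(3,4) U(3,4) \<open>0 < \<delta>\<close> by (auto simp: emeasure_eq_measure2 ennreal_less_iff)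
    ultimately show ?thesis by simp
  qed
  have gm: "g \<in> borel_measurable ?M"
    using g(1) by (intro measurable_restrict_space1 measurable_completion) (simp add: borel_measurable_continuous_onI)
  have "(\<integral>s. \<bar>indicator E s - g s\<bar> \<partial>?M) \<le> (\<integral>s. indicator (U - C) s \<partial>?M)"
  proof (rule integral_mono_AE)
    interpret finite_measure ?M by (rule finite_measure_interval)
    have "\<bar>indicator E s - g s\<bar> \<le> 1" for s
      using g01[of s] by (cases "s \<in> E") (auto simp: abs_le_iff)
    then show "integrable ?M (\<lambda>s. \<bar>indicator E s - g s\<bar>)"
      using E gm by (intro integrable_const_bound[of _ 1] AE_I2) auto
    show "integrable ?M (indicator (U - C) :: real \<Rightarrow> real)"
    proof (rule integrable_const_bound[of _ 1])
      have "indicator (U - C) \<in> borel_measurable (lebesgue :: real measure)"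
        using UC by (intro borel_measurable_indicator) auto
      then show "(indicator (U - C) :: real \<Rightarrow> real) \<in> borel_measurable ?M"
        by (intro measurable_restrict_space1)
    qed simp
    show "AE s in ?M. \<bar>indicator E s - g s\<bar> \<le> indicator (U - C) s"
    proof (rule AE_I2)
      fix s
      show "\<bar>indicator E s - g s\<bar> \<le> indicator (U - C) s"
      using g(3)[of s] g(4)[of s] g01[of s] C(2) U(2) by (auto simp: indicator_def)
    qed
  qed
  also have "\<dots> \<le> (\<integral>s. indicator (U - C) s \<partial>lebesgue)"
  proof -
    have "(\<integral>s. indicator (U - C) s \<partial>?M) = (\<integral>s. indicator {0<..<T} s * (indicator (U - C) s :: real) \<partial>lebesgue)"
      by (subst integral_restrict_space) auto
    also have "\<dots> \<le> (\<integral>s. indicator (U - C) s \<partial>lebesgue)"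
    proof (rule integral_mono)
      show I: "integrable lebesgue (indicator (U - C) :: real \<Rightarrow> real)"
        using UC by (auto simp: fmeasurable_def intro!: integrable_real_indicator)
      show "integrable lebesgue (\<lambda>s. indicator {0<..<T} s * indicator (U - C) s :: real)"
        using integrable_mult_indicator[OF _ I, of "{0<..<T}"] by simp
    qed (auto simp: indicator_def)
    finally show ?thesis .
  qed
  also have "\<dots> \<le> \<delta>"
    using UC \<open>measure lebesgue (U - C) \<le> \<delta>\<close> by (auto simp: fmeasurable_def)
  finally show ?thesis using that g(1) g01 by blast
qed

lemma vanishing_average_indicator:
  assumes E: "E \<in> sets (lebesgue_on {0<..<T::real})"
  shows "vanishing_average T (\<lambda>s t. \<bar>indicator E s - indicator E t\<bar>)"
proof (rule vanishing_average_approx)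
  fix \<delta> :: real assume "0 < \<delta>"
  let ?M = "\<I> T"
  interpret finite_measure ?M by (rule finite_measure_interval)
  obtain g :: "real \<Rightarrow> real" where g: "continuous_on UNIV g" "\<And>x. 0 \<le> g x" "\<And>x. g x \<le> 1"
    "(\<integral>s. \<bar>indicator E s - g s\<bar> \<partial>?M) \<le> \<delta>"
    using continuous_L1_approx_indicator[OF E \<open>0 < \<delta>\<close>] by blast
  have gm: "g \<in> borel_measurable ?M"
    using g(1) by (intro measurable_restrict_space1 measurable_completion) (simp add: borel_measurable_continuous_onI)
  have "\<bar>indicator E s - g s\<bar> \<le> 1" for s
    using g(2,3)[of s] by (cases "s \<in> E") (auto simp: abs_le_iff)
  then have "integrable ?M (\<lambda>s. \<bar>indicator E s - g s\<bar>)"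
    using E gm by (intro integrable_const_bound[of _ 1] AE_I2) auto
  moreover have "\<bar>indicator E s - indicator E t\<bar> \<le> \<bar>indicator E s - g s\<bar> + \<bar>g s - g t\<bar> + \<bar>indicator E t - g t\<bar>" for s t
    by linarith
  ultimately show "\<exists>G d. vanishing_average T G \<and>
      (AE t in ?M. (\<lambda>s. G s t) \<in> borel_measurable ?M) \<and>
      (\<forall>s t. 0 \<le> G s t) \<and> integrable ?M d \<and> (\<forall>s. 0 \<le> d s) \<and> (\<integral>s. d s \<partial>?M) \<le> \<delta> \<and>
      (AE t in ?M. AE s in ?M. \<bar>indicator E s - indicator E t\<bar> \<le> d s + G s t + d t)"
    using vanishing_average_continuous[OF g(1)] gm g(4)
    by (intro exI[of _ "\<lambda>s t. \<bar>g s - g t\<bar>"] exI[of _ "\<lambda>s. \<bar>indicator E s - g s\<bar>"] conjI) auto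
qed

context seminormed_group
begin

text \<open>A simple function changes between \<open>s\<close> and \<open>t\<close> only if
  \<open>t\<close> has left the level set of \<open>s\<close>, and then by a bounded amount;
  finitely many indicators therefore dominate the increment.\<close>

lemma vanishing_average_simple:
  assumes p: "simple_function (\<I> T) p" and pX: "\<And>t. t \<in> {0<..<T} \<Longrightarrow> p t \<in> X"
  shows "vanishing_average T (\<lambda>s t. (N (p s - p t))\<^sup>2)"
proof (rule vanishing_average_approx)
  fix \<delta> :: real assume "0 < \<delta>"
  let ?M = "\<I> T"
  define Z where "Z = p ` {0<..<T}"
  define E where "E z = p -` {z} \<inter> {0<..<T}" for z
  \<comment> \<open>Exceeds every squared distance between two values; the summand 1 makes it
    positive, as rescaling a vanishing average requires.\<close>
  define C where "C = 1 + (\<Sum>x\<in>Z. \<Sum>y\<in>Z. (N (x - y))\<^sup>2)"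
  have Z: "finite Z" using simple_functionD(1)[OF p] by (simp add: Z_def)
  have E: "E z \<in> sets ?M" for z using simple_functionD(2)[OF p, of "{z}"] by (simp add: E_def)
  have C0: "0 < C" unfolding C_def by (intro add_pos_nonneg sum_nonneg) auto
  let ?S = "\<lambda>s t. \<Sum>z\<in>Z. \<bar>indicator (E z) s - indicator (E z) t :: real\<bar>"
  have Sm: "(\<lambda>s. ?S s t) \<in> borel_measurable ?M" for t
    using E by (intro borel_measurable_sum borel_measurable_abs borel_measurable_diff) auto
  have VS: "vanishing_average T ?S"
    using Z E by (intro vanishing_average_sum vanishing_average_indicator) auto
  have VA: "vanishing_average T (\<lambda>s t. C * ?S s t)"
    by (rule vanishing_average_cmult[OF VS C0]) (use Sm in simp)
  have le: "(N (p s - p t))\<^sup>2 \<le> C * ?S s t" if "s \<in> {0<..<T}" "t \<in> {0<..<T}" for s t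
  proof (cases "p s = p t")
    case True
    then show ?thesis using C0 by (simp add: N_zero sum_nonneg)
  next
    case False
    have "p s \<in> Z" "p t \<in> Z" using that by (auto simp: Z_def)
    then have "(N (p s - p t))\<^sup>2 \<le> C"
      unfolding C_def
      by (intro add_increasing order_trans[OF member_le_sum[OF \<open>p t \<in> Z\<close>, of "\<lambda>y. (N (p s - y))\<^sup>2"]
            member_le_sum[OF \<open>p s \<in> Z\<close>, of "\<lambda>x. \<Sum>y\<in>Z. (N (x - y))\<^sup>2"]] sum_nonneg Z) auto
    also have "C * 1 \<le> C * ?S s t"
    proof (intro mult_left_mono less_imp_le[OF C0])
      have "1 = \<bar>indicator (E (p s)) s - indicator (E (p s)) t :: real\<bar>"
        using that False by (auto simp: E_def)
      also have "\<dots> \<le> ?S s t"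
        using \<open>p s \<in> Z\<close> Z by (intro member_le_sum[of "p s" Z "\<lambda>z. \<bar>indicator (E z) s - indicator (E z) t :: real\<bar>"]) auto
      finally show "1 \<le> ?S s t" .
    qed
    finally show ?thesis by simp
  qed
  show "\<exists>G d. vanishing_average T G \<and> (AE t in ?M. (\<lambda>s. G s t) \<in> borel_measurable ?M) \<and>
      (\<forall>s t. 0 \<le> G s t) \<and> integrable ?M d \<and> (\<forall>s. 0 \<le> d s) \<and> (\<integral>s. d s \<partial>?M) \<le> \<delta> \<and>
      (AE t in ?M. AE s in ?M. (N (p s - p t))\<^sup>2 \<le> d s + G s t + d t)"
  proof (intro exI[of _ "\<lambda>s t. C * ?S s t"] exI[of _ "\<lambda>s. 0"] conjI VA)
    show "AE t in ?M. (\<lambda>s. C * ?S s t) \<in> borel_measurable ?M"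
      using Sm by (intro AE_I2 borel_measurable_times) auto
    show "AE t in ?M. AE s in ?M. (N (p s - p t))\<^sup>2 \<le> 0 + C * ?S s t + 0"
      using le by (intro AE_I2) simp
  qed (use C0 \<open>0 < \<delta>\<close> in \<open>auto intro!: mult_nonneg_nonneg sum_nonneg\<close>)
qed

lemma N_diff_const_measurable:
  assumes w: "w \<in> bochner_L2 T X N" and "x \<in> X"
  shows "(\<lambda>s. N (w s - x)) \<in> borel_measurable (\<I> T)"
proof -
  note F = bochner_L2D[OF w]
  have "strongly_measurable T X N (\<lambda>t. x)"
    unfolding strongly_measurable_def using \<open>x \<in> X\<close> N_zero by (intro exI[of _ "\<lambda>n t. x"]) auto
  then have "strongly_measurable T X N (w - (\<lambda>t. x))"
    using F \<open>x \<in> X\<close> by (intro strongly_measurable_diff) auto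
  moreover have "AE t in \<I> T. (w - (\<lambda>t. x)) t \<in> X"
    using F(1) by eventually_elim (simp add: diff_mem \<open>x \<in> X\<close>)
  ultimately have "(\<lambda>s. N ((w - (\<lambda>t. x)) s)) \<in> borel_measurable (\<I> T)"
    by (rule strongly_measurable_N)
  then show ?thesis by simp
qed

text \<open>Averaged continuity of translations in the Bochner space. The detour through
  \<open>p\<close> splits the increment into three parts; squaring their sum costs the factor 3,
  which is why \<open>p\<close> is taken within \<open>\<delta> / 3\<close>.\<close>

lemma vanishing_average_bochner:
  assumes w: "w \<in> bochner_L2 T X N"
  shows "vanishing_average T (\<lambda>s t. (N (w s - w t))\<^sup>2)"
proof (rule vanishing_average_approx)
  fix \<delta> :: real assume "0 < \<delta>"
  let ?M = "\<I> T"
  note wX = bochner_L2D(1)[OF w]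
  have "0 < \<delta> / 3" using \<open>0 < \<delta>\<close> by simp
  obtain p where p: "simple_function ?M p" "\<And>t. t \<in> {0<..<T} \<Longrightarrow> p t \<in> X"
    and int: "integrable ?M (\<lambda>t. (N (w t - p t))\<^sup>2)" and small: "(\<integral>t. (N (w t - p t))\<^sup>2 \<partial>?M) < \<delta> / 3"
    using bochner_L2_simple_dense[OF w \<open>0 < \<delta> / 3\<close>] by blast
  have pm: "(\<lambda>s. (N (p s - x))\<^sup>2) \<in> borel_measurable ?M" for x
    by (intro borel_measurable_simple_function simple_function_compose1[OF p(1), where g = "\<lambda>y. (N (y - x))\<^sup>2"])
  have VA: "vanishing_average T (\<lambda>s t. 3 * (N (p s - p t))\<^sup>2)"
    using pm by (intro vanishing_average_cmult vanishing_average_simple p) auto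
  have le: "(N (w s - w t))\<^sup>2 \<le> 3 * (N (w s - p s))\<^sup>2 + 3 * (N (p s - p t))\<^sup>2 + 3 * (N (w t - p t))\<^sup>2"
    if "w s \<in> X" "p s \<in> X" "w t \<in> X" "p t \<in> X" for s t
  proof -
    have "N (w s - w t) \<le> N (w s - p s) + N (p s - p t) + N (w t - p t)"
      using N_triangle[OF that(1,2,3)] N_triangle[OF that(2,4,3)] N_minus_commute[OF that(4,3)] by simp
    then have "(N (w s - w t))\<^sup>2 \<le> (N (w s - p s) + N (p s - p t) + N (w t - p t))\<^sup>2"
      using that by (intro power_mono N_nonneg diff_mem)
    also have "\<dots> \<le> 3 * (N (w s - p s))\<^sup>2 + 3 * (N (p s - p t))\<^sup>2 + 3 * (N (w t - p t))\<^sup>2"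
      using sum_squares_bound[of "N (w s - p s)" "N (p s - p t)"]
        sum_squares_bound[of "N (w s - p s)" "N (w t - p t)"] sum_squares_bound[of "N (p s - p t)" "N (w t - p t)"]
      by (simp add: power2_eq_square algebra_simps)
    finally show ?thesis .
  qed
  show "\<exists>G d. vanishing_average T G \<and> (AE t in ?M. (\<lambda>s. G s t) \<in> borel_measurable ?M) \<and>
      (\<forall>s t. 0 \<le> G s t) \<and> integrable ?M d \<and> (\<forall>s. 0 \<le> d s) \<and> (\<integral>s. d s \<partial>?M) \<le> \<delta> \<and>
      (AE t in ?M. AE s in ?M. (N (w s - w t))\<^sup>2 \<le> d s + G s t + d t)"
  proof (intro exI[of _ "\<lambda>s t. 3 * (N (p s - p t))\<^sup>2"] exI[of _ "\<lambda>s. 3 * (N (w s - p s))\<^sup>2"] conjI VA)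
    have X: "AE s in ?M. w s \<in> X \<and> p s \<in> X"
      using wX AE_space by eventually_elim (use p(2) in auto)
    show "AE t in ?M. AE s in ?M. (N (w s - w t))\<^sup>2
        \<le> 3 * (N (w s - p s))\<^sup>2 + 3 * (N (p s - p t))\<^sup>2 + 3 * (N (w t - p t))\<^sup>2"
      using X
    proof eventually_elim
      case (elim t)
      show ?case using X by eventually_elim (use elim le in auto)
    qed
    show "AE t in ?M. (\<lambda>s. 3 * (N (p s - p t))\<^sup>2) \<in> borel_measurable ?M"
      using pm by (intro AE_I2 borel_measurable_times) auto
  qed (use int small in auto)
qed

text \<open>Young's inequality with a small weight on \<open>(a s)^2\<close>, which becomes the
  error of the density principle, and a large weight on the squared increment, whose average
  vanishes anyway. The energy identity needs this with \<open>a\<close> the dual norm of the time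
  derivative.\<close>

lemma vanishing_average_product:
  assumes w: "w \<in> bochner_L2 T X N"
    and a: "integrable (\<I> T) (\<lambda>s. (a s)\<^sup>2)"
  shows "vanishing_average T (\<lambda>s t. a s * N (w s - w t))"
proof (rule vanishing_average_approx)
  fix \<delta> :: real assume "0 < \<delta>"
  let ?M = "\<I> T"
  define A where "A = (\<integral>s. (a s)\<^sup>2 \<partial>?M)"
  \<comment> \<open>Chosen so that \<open>\<eta> / 2 * A\<close> is
    \<open>\<delta> * A / (A + 1)\<close>, hence at most \<open>\<delta>\<close>, even for
    \<open>A = 0\<close>.\<close>
  define \<eta> where "\<eta> = 2 * \<delta> / (A + 1)"
  have "0 \<le> A" by (simp add: A_def)
  then have "0 < \<eta>" using \<open>0 < \<delta>\<close> by (simp add: \<eta>_def)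
  have m: "AE t in ?M. (\<lambda>s. (N (w s - w t))\<^sup>2) \<in> borel_measurable ?M"
    using bochner_L2D(1)[OF w] by eventually_elim (use N_diff_const_measurable[OF w] in simp)
  have VA: "vanishing_average T (\<lambda>s t. 1 / (2 * \<eta>) * (N (w s - w t))\<^sup>2)"
    using \<open>0 < \<eta>\<close> m by (intro vanishing_average_cmult vanishing_average_bochner w) auto
  have le: "x * y \<le> \<eta> / 2 * x\<^sup>2 + 1 / (2 * \<eta>) * y\<^sup>2" for x y :: real
  proof -
    have "0 \<le> (\<eta> * x - y)\<^sup>2 / (2 * \<eta>)" using \<open>0 < \<eta>\<close> by simp
    also have "\<dots> = \<eta> / 2 * x\<^sup>2 + 1 / (2 * \<eta>) * y\<^sup>2 - x * y"
      using \<open>0 < \<eta>\<close> by (simp add: power2_eq_square field_simps)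
    finally show ?thesis by simp
  qed
  show "\<exists>G d. vanishing_average T G \<and> (AE t in ?M. (\<lambda>s. G s t) \<in> borel_measurable ?M) \<and>
      (\<forall>s t. 0 \<le> G s t) \<and> integrable ?M d \<and> (\<forall>s. 0 \<le> d s) \<and> (\<integral>s. d s \<partial>?M) \<le> \<delta> \<and>
      (AE t in ?M. AE s in ?M. a s * N (w s - w t) \<le> d s + G s t + d t)"
  proof (intro exI[of _ "\<lambda>s t. 1 / (2 * \<eta>) * (N (w s - w t))\<^sup>2"] exI[of _ "\<lambda>s. \<eta> / 2 * (a s)\<^sup>2"] conjI VA)
    show "AE t in ?M. (\<lambda>s. 1 / (2 * \<eta>) * (N (w s - w t))\<^sup>2) \<in> borel_measurable ?M"
      using m by eventually_elim simp
    show "(\<integral>s. \<eta> / 2 * (a s)\<^sup>2 \<partial>?M) \<le> \<delta>"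
      using \<open>0 < \<delta>\<close> \<open>0 \<le> A\<close> by (simp add: A_def[symmetric]) (simp add: \<eta>_def field_simps)
    show "AE t in ?M. AE s in ?M. a s * N (w s - w t)
        \<le> \<eta> / 2 * (a s)\<^sup>2 + 1 / (2 * \<eta>) * (N (w s - w t))\<^sup>2 + \<eta> / 2 * (a t)\<^sup>2"
    proof (intro AE_I2)
      fix s t
      have "0 \<le> \<eta> / 2 * (a t)\<^sup>2" using \<open>0 < \<eta>\<close> by simp
      with le[of "a s" "N (w s - w t)"]
      show "a s * N (w s - w t) \<le> \<eta> / 2 * (a s)\<^sup>2 + 1 / (2 * \<eta>) * (N (w s - w t))\<^sup>2 + \<eta> / 2 * (a t)\<^sup>2"
        by linarith
    qed
  qed (use a \<open>0 < \<eta>\<close> in auto)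
qed

end

text \<open>Otherwise \<open>h * K\<close> exceeds the integral by \<open>x\<close> almost
  everywhere on \<open>J\<close>, and integrating this over \<open>J\<close> contradicts finiteness.
  The factor \<open>h\<close> on the left replaces a division in \<open>ennreal\<close>, and the
  predicate \<open>P\<close> lets the point also avoid a null set.\<close>

lemma exists_le_average:
  fixes K :: "'a \<Rightarrow> ennreal"
  assumes K: "K \<in> borel_measurable M" and J: "J \<in> sets M" "emeasure M J = ennreal h" and "0 < h"
    and P: "AE t in M. P t" and fin: "(\<integral>\<^sup>+t. K t * indicator J t \<partial>M) < \<infinity>" and "0 < x"
  shows "\<exists>t\<in>J. P t \<and> ennreal h * K t \<le> (\<integral>\<^sup>+t. K t * indicator J t \<partial>M) + ennreal x"
proof (rule ccontr)
  let ?I = "\<integral>\<^sup>+t. K t * indicator J t \<partial>M"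
  assume "\<not> ?thesis"
  then have gt: "?I + ennreal x \<le> ennreal h * K t" if "t \<in> J" "P t" for t
    using that by (meson linear)
  have "(?I + ennreal x) * ennreal h = (\<integral>\<^sup>+t. (?I + ennreal x) * indicator J t \<partial>M)"
    using J(1) by (simp only: nn_integral_cmult_indicator J(2))
  also have "\<dots> \<le> (\<integral>\<^sup>+t. ennreal h * (K t * indicator J t) \<partial>M)"
  proof (rule nn_integral_mono_AE, use P in eventually_elim)
    fix t assume "P t"
    then show "(?I + ennreal x) * indicator J t \<le> ennreal h * (K t * indicator J t)"
      using gt[of t] by (auto simp: indicator_def)
  qed
  also have "\<dots> = ?I * ennreal h"
    using K J by (subst nn_integral_cmult) (auto simp: mult.commute)
  finally have "?I + ennreal x \<le> ?I"
    using \<open>0 < h\<close> by (simp add: ennreal_mult_le_mult_iff mult.commute[of _ "ennreal h"])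
  then show False
    using fin \<open>0 < x\<close> by (metis ennreal_eq_0_iff ennreal_add_left_cancel_le add.right_neutral infinity_ennreal_def le_zero_eq not_le)
qed

text \<open>
  Telescoping over points of consecutive intervals of length \<open>T/n\<close>, each chosen such that the majorant
  there exceeds its mean over the interval by an arbitrarily small amount at most.
\<close>

lemma endpoints_eq_if_vanishing_average:
  fixes \<Phi> :: "real \<Rightarrow> real"
  assumes "0 < T" and cont: "continuous_on {0..T} \<Phi>" and VA: "vanishing_average T F"
    and G: "AE t in \<I> T. t \<in> G"
    and osc: "\<And>h t t'. \<lbrakk>t \<in> G; t' \<in> G; 0 < t; t < t'; t' < T; t' - t < h\<rbrakk> \<Longrightarrow>
      ennreal \<bar>\<Phi> t' - \<Phi> t\<bar> \<le> window_integral T h (\<lambda>s. F s t) t + window_integral T h (\<lambda>s. F s t') t'"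
  shows "\<Phi> T = \<Phi> 0"
proof -
  let ?M = "\<I> T"
  have "\<bar>\<Phi> T - \<Phi> 0\<bar> \<le> 8 * e" if "0 < e" for e
  proof -
    have "uniformly_continuous_on {0..T} \<Phi>"
      using cont by (intro compact_uniformly_continuous) auto
    then obtain \<delta> where "0 < \<delta>" and \<delta>: "\<And>s t. s \<in> {0..T} \<Longrightarrow> t \<in> {0..T} \<Longrightarrow> \<bar>s - t\<bar> < \<delta> \<Longrightarrow> \<bar>\<Phi> s - \<Phi> t\<bar> < e"
      using \<open>0 < e\<close> unfolding uniformly_continuous_on_def dist_real_def by (metis abs_minus_commute)
    obtain h0 where "0 < h0" and h0: "\<And>h. 0 < h \<Longrightarrow> h < h0 \<Longrightarrow> window_bound T h F (e * h)"
      using vanishing_averageD[OF VA \<open>0 < e\<close>] by (auto simp: eventually_at_right_field)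
    obtain n where n: "2 * T / min \<delta> h0 < real n"
      using reals_Archimedean2 by blast
    have "0 < 2 * T / min \<delta> h0" using \<open>0 < T\<close> \<open>0 < \<delta>\<close> \<open>0 < h0\<close> by simp
    with n have "0 < n" by (cases n) auto
    define h where "h = T / real n"
    have "0 < h" using \<open>0 < n\<close> \<open>0 < T\<close> by (simp add: h_def)
    have hn: "real n * h = T" using \<open>0 < n\<close> by (simp add: h_def)
    have "0 < min \<delta> h0" using \<open>0 < \<delta>\<close> \<open>0 < h0\<close> by simp
    then have "2 * T < real n * min \<delta> h0" using n by (simp only: pos_divide_less_eq)
    then have "2 * T / real n < min \<delta> h0"
      using \<open>0 < n\<close> by (simp only: pos_divide_less_eq of_nat_0_less_iff mult.commute)
    then have "2 * h < min \<delta> h0" by (simp only: h_def times_divide_eq_right)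
    then have "2 * h < \<delta>" "2 * h < h0" by auto
    \<comment> \<open>Points chosen from adjacent intervals of length \<open>h\<close> are less than
      \<open>2 * h\<close> apart, hence the doubled radius.\<close>
    then have "window_bound T (2 * h) F (e * (2 * h))" using \<open>0 < h\<close> by (intro h0) auto
    from window_boundE[OF this] obtain K where K: "K \<in> borel_measurable ?M"
      and K_le: "AE t in ?M. window_integral T (2 * h) (\<lambda>s. F s t) t \<le> K t"
      and KI: "(\<integral>\<^sup>+t. K t \<partial>?M) \<le> ennreal (e * (2 * h))"
      by blast
    define J where "J i = {real i * h<..<real (Suc i) * h}" for i
    have J_sub: "J i \<subseteq> {0<..<T}" if "i < n" for i
    proof -
      have "real (Suc i) * h \<le> real n * h" using that \<open>0 < h\<close> by (intro mult_right_mono) auto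
      moreover have "0 \<le> real i * h" using \<open>0 < h\<close> by simp
      ultimately show ?thesis unfolding J_def hn by auto
    qed
    have J: "J i \<in> sets ?M" "emeasure ?M (J i) = ennreal h" if "i < n" for i
    proof -
      have "J i \<in> sets lebesgue" by (simp add: J_def)
      then show "J i \<in> sets ?M" using J_sub[OF that] by (simp add: sets_restrict_space_iff)
      have "emeasure ?M (J i) = emeasure lebesgue (J i)"
        using J_sub[OF that] by (intro emeasure_restrict_space) auto
      then show "emeasure ?M (J i) = ennreal h"
        using \<open>0 < h\<close> by (simp add: J_def algebra_simps)
    qed
    have J_disj: "J i \<inter> J j = {}" if "i < j" for i j
    proof -
      have "real (Suc i) * h \<le> real j * h" using that \<open>0 < h\<close> by (intro mult_right_mono) auto
      then show ?thesis by (auto simp: J_def)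
    qed
    have disj: "disjoint_family_on J {..<n}"
      unfolding disjoint_family_on_def using J_disj by (metis Int_commute nat_neq_iff)
    have AE: "AE t in ?M. t \<in> G \<and> window_integral T (2 * h) (\<lambda>s. F s t) t \<le> K t"
      using G K_le by eventually_elim auto
    have fin: "(\<integral>\<^sup>+t. K t * indicator (J i) t \<partial>?M) < \<infinity>" for i
    proof -
      have "(\<integral>\<^sup>+t. K t * indicator (J i) t \<partial>?M) \<le> (\<integral>\<^sup>+t. K t \<partial>?M)"
        by (intro nn_integral_mono) (auto simp: indicator_def)
      also have "\<dots> \<le> ennreal (e * (2 * h))" by (rule KI)
      also have "\<dots> < \<infinity>" by simp
      finally show ?thesis .
    qed
    \<comment> \<open>The slack granted on each interval; over the \<open>n\<close> intervals it
      adds up to \<open>e * h\<close>.\<close>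
    have "0 < e * h / real n" using \<open>0 < e\<close> \<open>0 < h\<close> \<open>0 < n\<close> by simp
    have "\<exists>t\<in>J i. (t \<in> G \<and> window_integral T (2 * h) (\<lambda>s. F s t) t \<le> K t) \<and>
        ennreal h * K t \<le> (\<integral>\<^sup>+t. K t * indicator (J i) t \<partial>?M) + ennreal (e * h / real n)" if "i < n" for i
      by (rule exists_le_average[OF K J[OF that] \<open>0 < h\<close> AE fin \<open>0 < e * h / real n\<close>])
    then have "\<forall>i. \<exists>t. i < n \<longrightarrow> t \<in> J i \<and> t \<in> G \<and> window_integral T (2 * h) (\<lambda>s. F s t) t \<le> K t \<and>
        ennreal h * K t \<le> (\<integral>\<^sup>+t. K t * indicator (J i) t \<partial>?M) + ennreal (e * h / real n)"
      by blast
    from choice[OF this] obtain \<tau> where "\<forall>i. i < n \<longrightarrow> \<tau> i \<in> J i \<and> \<tau> i \<in> G \<and>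
        window_integral T (2 * h) (\<lambda>s. F s (\<tau> i)) (\<tau> i) \<le> K (\<tau> i) \<and>
        ennreal h * K (\<tau> i) \<le> (\<integral>\<^sup>+t. K t * indicator (J i) t \<partial>?M) + ennreal (e * h / real n)"
      by (elim exE)
    then have \<tau>: "\<And>i. i < n \<Longrightarrow> \<tau> i \<in> J i" "\<And>i. i < n \<Longrightarrow> \<tau> i \<in> G"
      "\<And>i. i < n \<Longrightarrow> window_integral T (2 * h) (\<lambda>s. F s (\<tau> i)) (\<tau> i) \<le> K (\<tau> i)"
      "\<And>i. i < n \<Longrightarrow> ennreal h * K (\<tau> i) \<le> (\<integral>\<^sup>+t. K t * indicator (J i) t \<partial>?M) + ennreal (e * h / real n)"
      by simp_all
    \<comment> \<open>After division by \<open>h\<close>, the bound on the integral of the majorant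
      contributes \<open>2 * e\<close> and the slacks contribute \<open>e\<close>; the intervals are
      disjoint, so the integral is used only once.\<close>
    have sum_K: "(\<Sum>i<n. K (\<tau> i)) \<le> ennreal (3 * e)"
    proof -
      have "ennreal h * (\<Sum>i<n. K (\<tau> i)) = (\<Sum>i<n. ennreal h * K (\<tau> i))"
        by (rule sum_distrib_left)
      also have "\<dots> \<le> (\<Sum>i<n. (\<integral>\<^sup>+t. K t * indicator (J i) t \<partial>?M) + ennreal (e * h / real n))"
        by (intro sum_mono \<tau>) auto
      also have "\<dots> = (\<Sum>i<n. \<integral>\<^sup>+t. K t * indicator (J i) t \<partial>?M) + ennreal (e * h)"
        using \<open>0 < n\<close> \<open>0 < e\<close> \<open>0 < h\<close>
        by (simp add: sum.distrib ennreal_of_nat_eq_real_of_nat ennreal_mult'[symmetric])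
      also have "(\<Sum>i<n. \<integral>\<^sup>+t. K t * indicator (J i) t \<partial>?M) = (\<integral>\<^sup>+t. (\<Sum>i<n. K t * indicator (J i) t) \<partial>?M)"
        using K J(1) by (intro nn_integral_sum[symmetric]) auto
      also have "\<dots> \<le> (\<integral>\<^sup>+t. K t \<partial>?M)"
      proof (rule nn_integral_mono)
        fix t
        have "(\<Sum>i<n. K t * indicator (J i) t) = K t * (\<Sum>i<n. indicator (J i) t)"
          by (rule sum_distrib_left[symmetric])
        also have "(\<Sum>i<n. indicator (J i) t) = indicator (\<Union>i<n. J i) t"
          by (rule indicator_UN_disjoint[OF finite_lessThan disj, symmetric])
        also have "K t * indicator (\<Union>i<n. J i) t \<le> K t"
          by (auto simp: indicator_def)
        finally show "(\<Sum>i<n. K t * indicator (J i) t) \<le> K t" .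
      qed
      also note KI
      also have "ennreal (e * (2 * h)) + ennreal (e * h) = ennreal h * ennreal (3 * e)"
        using \<open>0 < e\<close> \<open>0 < h\<close> by (simp add: ennreal_plus[symmetric] ennreal_mult'[symmetric] del: ennreal_plus)
      finally show ?thesis
        using \<open>0 < h\<close> by (simp add: ennreal_mult_le_mult_iff add_right_mono)
    qed
    have \<tau>_pos: "0 < \<tau> i" "\<tau> i < T" if "i < n" for i
      using \<tau>(1)[OF that] J_sub[OF that] by auto
    have step: "ennreal \<bar>\<Phi> (\<tau> (Suc i)) - \<Phi> (\<tau> i)\<bar> \<le> K (\<tau> i) + K (\<tau> (Suc i))" if "Suc i < n" for i
    proof -
      have i: "i < n" using that by simp
      have "real i * h < \<tau> i" "\<tau> i < real (Suc i) * h" "real (Suc i) * h < \<tau> (Suc i)" "\<tau> (Suc i) < real (Suc (Suc i)) * h"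
        using \<tau>(1)[OF i] \<tau>(1)[OF that] by (auto simp: J_def)
      then have "\<tau> i < \<tau> (Suc i)" "\<tau> (Suc i) - \<tau> i < 2 * h" by (auto simp: algebra_simps)
      from osc[OF \<tau>(2)[OF i] \<tau>(2)[OF that] \<tau>_pos(1)[OF i] this(1) \<tau>_pos(2)[OF that] this(2)]
      show ?thesis using \<tau>(3)[OF i] \<tau>(3)[OF that] by (meson add_mono order_trans)
    qed
    have tele: "ennreal \<bar>\<Phi> (\<tau> k) - \<Phi> (\<tau> 0)\<bar> \<le> (\<Sum>i<k. K (\<tau> i) + K (\<tau> (Suc i)))" if "k < n" for k
      using that
    proof (induction k)
      case 0
      then show ?case by simp
    next
      case (Suc k)
      have "ennreal \<bar>\<Phi> (\<tau> (Suc k)) - \<Phi> (\<tau> 0)\<bar> \<le> ennreal (\<bar>\<Phi> (\<tau> k) - \<Phi> (\<tau> 0)\<bar> + \<bar>\<Phi> (\<tau> (Suc k)) - \<Phi> (\<tau> k)\<bar>)"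
        by (rule ennreal_leI) linarith
      also have "\<dots> = ennreal \<bar>\<Phi> (\<tau> k) - \<Phi> (\<tau> 0)\<bar> + ennreal \<bar>\<Phi> (\<tau> (Suc k)) - \<Phi> (\<tau> k)\<bar>"
        by simp
      also have "\<dots> \<le> (\<Sum>i<k. K (\<tau> i) + K (\<tau> (Suc i))) + (K (\<tau> k) + K (\<tau> (Suc k)))"
        using Suc by (intro add_mono step) auto
      finally show ?case by simp
    qed
    obtain m where m: "n = Suc m" using \<open>0 < n\<close> by (cases n) auto
    \<comment> \<open>Each point takes part in at most two steps of the telescope, which doubles
      \<open>3 * e\<close>. The two end pieces, less than \<open>e\<close> each by uniform
      continuity, complete the bound \<open>8 * e\<close>.\<close>
    have "ennreal \<bar>\<Phi> (\<tau> m) - \<Phi> (\<tau> 0)\<bar> \<le> (\<Sum>i<m. K (\<tau> i)) + (\<Sum>i<m. K (\<tau> (Suc i)))"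
      using tele[of m] m by (simp add: sum.distrib)
    also have "\<dots> \<le> (\<Sum>i<n. K (\<tau> i)) + (\<Sum>i<n. K (\<tau> i))"
    proof (rule add_mono)
      show "(\<Sum>i<m. K (\<tau> i)) \<le> (\<Sum>i<n. K (\<tau> i))"
        unfolding m by (simp add: add_increasing2)
      show "(\<Sum>i<m. K (\<tau> (Suc i))) \<le> (\<Sum>i<n. K (\<tau> i))"
        unfolding m sum.lessThan_Suc_shift by (simp add: add_increasing)
    qed
    also have "\<dots> \<le> ennreal (3 * e) + ennreal (3 * e)"
      by (intro add_mono sum_K)
    also have "\<dots> = ennreal (6 * e)"
      using \<open>0 < e\<close> by (simp add: ennreal_plus[symmetric] del: ennreal_plus)
    finally have "\<bar>\<Phi> (\<tau> m) - \<Phi> (\<tau> 0)\<bar> \<le> 6 * e"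
      using \<open>0 < e\<close> by (simp add: ennreal_le_iff)
    moreover have "\<bar>\<Phi> (\<tau> 0) - \<Phi> 0\<bar> < e"
    proof (rule \<delta>)
      have "\<tau> 0 \<in> J 0" using \<tau>(1) \<open>0 < n\<close> by simp
      then show "\<bar>\<tau> 0 - 0\<bar> < \<delta>" using \<open>2 * h < \<delta>\<close> \<open>0 < h\<close> by (auto simp: J_def)
      show "\<tau> 0 \<in> {0..T}" using \<tau>_pos[of 0] \<open>0 < n\<close> by simp
      show "0 \<in> {0..T}" using \<open>0 < T\<close> by simp
    qed
    moreover have "\<bar>\<Phi> T - \<Phi> (\<tau> m)\<bar> < e"
    proof (rule \<delta>)
      have "\<tau> m \<in> J m" using \<tau>(1) m by simp
      moreover have "T = real (Suc m) * h" using hn m by simp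
      ultimately show "\<bar>T - \<tau> m\<bar> < \<delta>" using \<open>2 * h < \<delta>\<close> \<open>0 < h\<close> by (auto simp: J_def algebra_simps)
      show "\<tau> m \<in> {0..T}" using \<tau>_pos[of m] m by simp
      show "T \<in> {0..T}" using \<open>0 < T\<close> by simp
    qed
    ultimately show ?thesis by linarith
  qed
  \<comment> \<open>A nonzero difference would be at most 8/9 of itself.\<close>
  from this[of "\<bar>\<Phi> T - \<Phi> 0\<bar> / 9"] show ?thesis by force
qed

subsection \<open>From weak derivatives to increments\<close>

lemma exp_flat_0_mono: "x \<le> y \<Longrightarrow> exp_flat 0 x \<le> exp_flat 0 y"
  by (auto simp: exp_flat_def le_imp_inverse_le)

text \<open>After cross-multiplication the product of the two numerators cancels, leaving a
  comparison of increasing factors. Monotonicity is what makes the derivative a nonnegative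
  kernel.\<close>

lemma smooth_step_mono: "x \<le> y \<Longrightarrow> smooth_step x \<le> smooth_step y"
proof -
  assume "x \<le> y"
  let ?q = "exp_flat 0"
  have "?q x * ?q (1 - y) \<le> ?q y * ?q (1 - x)"
    using \<open>x \<le> y\<close> by (intro mult_mono exp_flat_0_mono exp_flat_nonneg) auto
  then have "?q x * (?q y + ?q (1 - y)) \<le> ?q y * (?q x + ?q (1 - x))"
    by (simp add: algebra_simps)
  then show ?thesis
    using smooth_step_denom_pos[of x] smooth_step_denom_pos[of y]
    by (simp add: smooth_step_def divide_inverse[symmetric] frac_le_eq divide_le_eq pos_divide_le_eq field_simps)
qed

lemma smooth_step_has_deriv: "(smooth_step has_real_derivative deriv smooth_step x) (at x)"
  by (rule Ck_real_derivD(1)[OF Ck_smooth_step])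

lemma deriv_smooth_step_nonneg: "0 \<le> deriv smooth_step x"
  by (rule mono_on_imp_deriv_nonneg[of UNIV, OF _ smooth_step_has_deriv])
    (auto intro: mono_onI smooth_step_mono)

lemma deriv_smooth_step_eq_0:
  assumes "x < 0 \<or> 1 < x"
  shows "deriv smooth_step x = 0"
  using assms
proof
  assume "x < 0"
  have "(smooth_step has_real_derivative 0) (at x)"
    by (rule has_field_derivative_transform_within_open[of "\<lambda>x. 0" 0 x "{..<0}"])
      (use \<open>x < 0\<close> in \<open>auto simp: smooth_step_eq_0\<close>)
  then show ?thesis by (rule DERIV_imp_deriv)
next
  assume "1 < x"
  have "(smooth_step has_real_derivative 0) (at x)"
    by (rule has_field_derivative_transform_within_open[of "\<lambda>x. 1" 0 x "{1<..}"])
      (use \<open>1 < x\<close> in \<open>auto simp: smooth_step_eq_1\<close>)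
  then show ?thesis by (rule DERIV_imp_deriv)
qed

definition step_at :: "real \<Rightarrow> nat \<Rightarrow> real \<Rightarrow> real" where
  "step_at a n t = smooth_step (real n * (t - a) - 1)"

text \<open>A kernel living between \<open>a + 1/n\<close> and \<open>a + 2/n\<close>, thus strictly
  to the right of \<open>a\<close>; this is what makes \<open>a = 0\<close> an admissible base
  point.\<close>

definition step_deriv :: "real \<Rightarrow> nat \<Rightarrow> real \<Rightarrow> real" where
  "step_deriv a n t = real n * deriv smooth_step (real n * (t - a) - 1)"

lemma step_at_has_deriv: "(step_at a n has_real_derivative step_deriv a n t) (at t)"
proof -
  have "((\<lambda>t. real n * (t - a) - 1) has_real_derivative real n) (at t)"
    by (auto intro!: derivative_eq_intros)
  from DERIV_chain2[OF smooth_step_has_deriv this] show ?thesis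
    by (simp add: step_at_def[abs_def] step_deriv_def mult.commute)
qed

lemma Ck_step_at: "Ck k (step_at a n)"
  using Ck_scaled_smooth_step[of k "real n" "1::real" a] by (simp add: step_at_def[abs_def])

lemma step_deriv_continuous: "continuous_on UNIV (step_deriv a n)"
proof -
  have "continuous_on UNIV (deriv smooth_step)"
    using Ck_real_derivD(2)[OF Ck_smooth_step, of 0] by simp
  then have "continuous_on UNIV (\<lambda>t. deriv smooth_step (real n * (t - a) - 1))"
    by (rule continuous_on_compose2) (auto intro!: continuous_intros)
  then show ?thesis
    unfolding step_deriv_def[abs_def] by (intro continuous_intros)
qed

lemma integrable_interval_continuous:
  fixes f :: "real \<Rightarrow> real"
  assumes "continuous_on {0..T} f"
  shows "integrable (\<I> T) f"
proof -
  interpret finite_measure "\<I> T" by (rule finite_measure_interval)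
  have "bounded (f ` {0..T})"
    using assms by (intro compact_imp_bounded compact_continuous_image) auto
  then have "\<exists>B. \<forall>t\<in>{0..T}. norm (f t) \<le> B"
    by (auto simp: bounded_iff)
  then obtain B where B: "\<And>t. t \<in> {0..T} \<Longrightarrow> norm (f t) \<le> B" by blast
  show ?thesis
  proof (rule integrable_const_bound[of _ B])
    show "AE t in \<I> T. norm (f t) \<le> B"
      using B by (intro AE_I2) auto
    show "f \<in> borel_measurable (\<I> T)"
      by (rule continuous_imp_measurable_on_sets_lebesgue)
        (auto intro: continuous_on_subset[OF assms])
  qed
qed

lemma step_deriv_integral:
  assumes "0 \<le> a" "0 < n" "a + 2 / real n \<le> T"
  shows "(\<integral>t. step_deriv a n t \<partial>\<I> T) = 1"
proof -
  have "0 \<le> T"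
    using assms by (smt (verit) divide_nonneg_nonneg of_nat_0_le_iff)
  have I: "integrable (\<I> T) (step_deriv a n)"
    by (intro integrable_interval_continuous continuous_on_subset[OF step_deriv_continuous]) auto
  have "(step_deriv a n has_integral step_at a n T - step_at a n 0) {0..T}"
    using step_at_has_deriv \<open>0 \<le> T\<close>
    by (intro fundamental_theorem_of_calculus)
      (auto simp: has_real_derivative_iff_has_vector_derivative[symmetric] intro: has_field_derivative_at_within)
  moreover have "step_at a n T = 1"
  proof -
    have "real n * (2 / real n) \<le> real n * (T - a)"
      using assms by (intro mult_left_mono) auto
    then have "1 \<le> real n * (T - a) - 1" using assms by simp
    then show ?thesis by (simp add: step_at_def smooth_step_eq_1)
  qed
  moreover have "step_at a n 0 = 0"
  proof -
    have "0 \<le> real n * a" using assms by simp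
    then show ?thesis unfolding step_at_def by (intro smooth_step_eq_0) simp
  qed
  ultimately have "integral {0..T} (step_deriv a n) = 1"
    by (simp add: integral_unique)
  then show ?thesis
    using lebesgue_integral_eq_integral[OF I] by (simp add: integral_open_interval_real)
qed

text \<open>A nonnegative kernel of mass one concentrated at distance at most \<open>2/n\<close>
  from \<open>a\<close>, on the right, tested against a continuous function. For large
  \<open>n\<close> its support lies inside the interval and within the modulus of continuity of
  \<open>g\<close> at \<open>a\<close>.\<close>

lemma step_deriv_integral_tendsto:
  assumes g: "continuous_on {0..T} g" and a: "0 \<le> a" "a < T"
  shows "(\<lambda>n. \<integral>t. step_deriv a n t * g t \<partial>\<I> T) \<longlonglongrightarrow> g a"
proof (rule LIMSEQ_I)
  let ?M = "\<I> T"
  fix e :: real assume "0 < e"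
  have "\<exists>\<delta>>0. \<forall>t\<in>{0..T}. \<bar>t - a\<bar> < \<delta> \<longrightarrow> \<bar>g t - g a\<bar> < e / 2"
    unfolding dist_real_def[symmetric]
    by (rule g[unfolded continuous_on_iff, rule_format]) (use a \<open>0 < e\<close> in auto)
  then obtain \<delta> where "0 < \<delta>" and \<delta>: "\<And>t. t \<in> {0..T} \<Longrightarrow> \<bar>t - a\<bar> < \<delta> \<Longrightarrow> \<bar>g t - g a\<bar> < e / 2"
    by blast
  obtain m where m: "2 / min \<delta> (T - a) < real m" using reals_Archimedean2 by blast
  have pos: "0 < min \<delta> (T - a)" using \<open>0 < \<delta>\<close> a by simp
  show "\<exists>no. \<forall>n\<ge>no. norm ((\<integral>t. step_deriv a n t * g t \<partial>?M) - g a) < e"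
  proof (intro exI[of _ m] allI impI)
    fix n assume "m \<le> n"
    with m have n: "2 / min \<delta> (T - a) < real n" by linarith
    then have "0 < real n" using pos by (smt (verit) divide_pos_pos)
    have "2 / real n < min \<delta> (T - a)"
      using n pos \<open>0 < real n\<close> by (simp only: pos_divide_less_eq mult.commute)
    then have small: "2 / real n < \<delta>" "a + 2 / real n \<le> T" by auto
    note cont = continuous_on_subset[OF step_deriv_continuous subset_UNIV, of "{0..T}" a n]
    have int1: "integrable ?M (\<lambda>t. step_deriv a n t * g t)" and int2: "integrable ?M (\<lambda>t. step_deriv a n t * g a)"
      and int3: "integrable ?M (\<lambda>t. step_deriv a n t * (e / 2))"
      by (intro integrable_interval_continuous continuous_intros cont g)+
    have one: "(\<integral>t. step_deriv a n t \<partial>?M) = 1"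
      using a small \<open>0 < real n\<close> by (intro step_deriv_integral) auto
    have "(\<integral>t. step_deriv a n t * g t \<partial>?M) - g a = (\<integral>t. step_deriv a n t * g t \<partial>?M) - (\<integral>t. step_deriv a n t * g a \<partial>?M)"
      using one by simp
    also have "\<dots> = (\<integral>t. step_deriv a n t * (g t - g a) \<partial>?M)"
      using int1 int2 by (simp add: right_diff_distrib)
    also have "norm \<dots> \<le> (\<integral>t. step_deriv a n t * (e / 2) \<partial>?M)"
    proof (rule Bochner_Integration.integral_norm_bound_integral)
      show "integrable ?M (\<lambda>t. step_deriv a n t * (g t - g a))"
        using int1 int2 by (simp add: right_diff_distrib)
      fix t assume "t \<in> space ?M"
      then have t: "t \<in> {0..T}" by simp
      have d0: "0 \<le> step_deriv a n t"
        by (simp add: step_deriv_def deriv_smooth_step_nonneg)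
      show "norm (step_deriv a n t * (g t - g a)) \<le> step_deriv a n t * (e / 2)"
      proof (cases "\<bar>t - a\<bar> < \<delta>")
        case True
        then have "step_deriv a n t * \<bar>g t - g a\<bar> \<le> step_deriv a n t * (e / 2)"
          by (intro mult_left_mono less_imp_le[OF \<delta>[OF t]] d0)
        then show ?thesis using d0 by (simp add: abs_mult)
      next
        case False
        \<comment> \<open>Here \<open>t\<close> lies either before \<open>a\<close> or beyond
          \<open>a + 2/n\<close>, in both cases off the support of the kernel.\<close>
        have "step_deriv a n t = 0"
        proof -
          have "real n * (t - a) - 1 < 0 \<or> 1 < real n * (t - a) - 1"
          proof (cases "t < a")
            case True
            then have "real n * (t - a) < 0" using \<open>0 < real n\<close> by (simp add: mult_pos_neg)
            then show ?thesis by simp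
          next
            case False
            with \<open>\<not> \<bar>t - a\<bar> < \<delta>\<close> small have "2 / real n < t - a" by linarith
            then have "2 < real n * (t - a)" using \<open>0 < real n\<close> by (simp add: pos_divide_less_eq mult.commute)
            then show ?thesis by simp
          qed
          then show ?thesis by (simp add: step_deriv_def deriv_smooth_step_eq_0)
        qed
        then show ?thesis by simp
      qed
    qed (rule int3)
    also have "\<dots> = e / 2" using one by simp
    also have "\<dots> < e" using \<open>0 < e\<close> by simp
    finally show "norm ((\<integral>t. step_deriv a n t * g t \<partial>?M) - g a) < e" .
  qed
qed

lemma integrable_indicator_interval:
  fixes T :: real
  assumes "integrable (\<I> T) k"
  shows "integrable (\<I> T) (\<lambda>t. indicator {a<..b} t * k t :: real)"
proof -
  have "{0<..<T} \<inter> {a<..b} \<in> sets (\<I> T)"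
    by (subst sets_restrict_space_iff) auto
  then have "integrable (\<I> T) (\<lambda>t. indicator ({0<..<T} \<inter> {a<..b}) t *\<^sub>R k t)"
    using assms by (intro integrable_mult_indicator)
  then show ?thesis
    by (rule Bochner_Integration.integrable_cong[THEN iffD1, OF refl, rotated]) (auto simp: indicator_def)
qed

text \<open>Dominated convergence: as the upper limit tends to \<open>b\<close>, the integrands
  become eventually constant at every time except possibly \<open>t = b\<close>, a null set.\<close>

lemma continuous_on_indefinite_integral:
  fixes T :: real
  assumes k: "integrable (\<I> T) k"
  shows "continuous_on S (\<lambda>b. \<integral>t. indicator {a<..b} t * k t \<partial>\<I> T :: real)"
  unfolding continuous_on_sequentially
proof (intro allI ballI impI)
  let ?M = "\<I> T"
  fix x b assume "b \<in> S" and x: "(\<forall>n. x n \<in> S) \<and> x \<longlonglongrightarrow> b"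
  have "(\<lambda>n. \<integral>t. indicator {a<..x n} t * k t \<partial>?M) \<longlonglongrightarrow> (\<integral>t. indicator {a<..b} t * k t \<partial>?M)"
  proof (rule integral_dominated_convergence[where w = "\<lambda>t. \<bar>k t\<bar>"])
    have "AE t in ?M. t \<noteq> b"
      using AE_completion[OF AE_lborel_singleton[of b]]
      by (subst AE_restrict_space_iff) (auto elim: eventually_mono)
    then show "AE t in ?M. (\<lambda>n. indicator {a<..x n} t * k t) \<longlonglongrightarrow> indicator {a<..b} t * k t"
    proof eventually_elim
      case (elim t)
      have "eventually (\<lambda>n. indicator {a<..x n} t * k t = indicator {a<..b} t * k t) sequentially"
      proof (cases "t < b")
        case True
        then have "eventually (\<lambda>n. t < x n) sequentially" using x by (auto dest: order_tendstoD)
        then show ?thesis by eventually_elim (use True in \<open>auto simp: indicator_def\<close>)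
      next
        case False
        with elim have "b < t" by simp
        then have "eventually (\<lambda>n. x n < t) sequentially" using x by (auto dest: order_tendstoD)
        then show ?thesis by eventually_elim (use \<open>b < t\<close> in \<open>auto simp: indicator_def\<close>)
      qed
      then show ?case by (rule tendsto_eventually)
    qed
    show "integrable ?M (\<lambda>t. \<bar>k t\<bar>)" using k by simp
  qed (use integrable_indicator_interval[OF k] in \<open>auto simp: indicator_def\<close>)
  then show "((\<lambda>b. \<integral>t. indicator {a<..b} t * k t \<partial>?M) \<circ> x) \<longlonglongrightarrow> (\<integral>t. indicator {a<..b} t * k t \<partial>?M)"
    by (simp add: o_def)
qed

text \<open>Test with the difference of a step at \<open>a\<close> and a step at \<open>b\<close>.
  Its derivative tends to evaluation at \<open>a\<close> minus evaluation at \<open>b\<close>, while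
  the function itself tends to the indicator of \<open>{a<..b}\<close>; the interval is half-open
  because a step vanishes at its own base point.\<close>

lemma weak_derivative_increment:
  fixes g k :: "real \<Rightarrow> real"
  assumes g: "continuous_on {0..T} g" and k: "integrable (\<I> T) k"
    and weak: "\<And>\<phi>. \<phi> \<in> test_functions {0<..<T} \<Longrightarrow>
      (\<integral>t. deriv \<phi> t * g t \<partial>\<I> T) = - (\<integral>t. \<phi> t * k t \<partial>\<I> T)"
    and ab: "0 \<le> a" "a \<le> b" "b \<le> T"
  shows "g b - g a = (\<integral>t. indicator {a<..b} t * k t \<partial>\<I> T)"
proof -
  let ?M = "\<I> T"
  have interior: "g b - g a = (\<integral>t. indicator {a<..b} t * k t \<partial>?M)" if "a \<le> b" "b < T" for b
  proof -
    have "0 \<le> b" "a < T" using ab that by auto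
    let ?\<phi> = "\<lambda>n t. step_at a n t - step_at b n t"
    have deriv: "deriv (?\<phi> n) t = step_deriv a n t - step_deriv b n t" for n t
      by (intro DERIV_imp_deriv derivative_intros step_at_has_deriv)
    have "(\<lambda>n. (\<integral>t. step_deriv a n t * g t \<partial>?M) - (\<integral>t. step_deriv b n t * g t \<partial>?M)) \<longlonglongrightarrow> g a - g b"
      using ab that \<open>0 \<le> b\<close> \<open>a < T\<close> by (intro tendsto_diff step_deriv_integral_tendsto g)
    moreover have "(\<integral>t. step_deriv a n t * g t \<partial>?M) - (\<integral>t. step_deriv b n t * g t \<partial>?M)
        = (\<integral>t. deriv (?\<phi> n) t * g t \<partial>?M)" for n
    proof -
      have "integrable ?M (\<lambda>t. step_deriv c n t * g t)" for c
        by (intro integrable_interval_continuous continuous_intros g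
            continuous_on_subset[OF step_deriv_continuous]) auto
      then show ?thesis by (simp add: deriv left_diff_distrib)
    qed
    ultimately have lhs: "(\<lambda>n. \<integral>t. deriv (?\<phi> n) t * g t \<partial>?M) \<longlonglongrightarrow> g a - g b"
      by simp
    have rhs: "(\<lambda>n. - (\<integral>t. ?\<phi> n t * k t \<partial>?M)) \<longlonglongrightarrow> - (\<integral>t. indicator {a<..b} t * k t \<partial>?M)"
    proof (rule tendsto_minus, rule integral_dominated_convergence[where w = "\<lambda>t. \<bar>k t\<bar>"])
      show "AE t in ?M. (\<lambda>n. ?\<phi> n t * k t) \<longlonglongrightarrow> indicator {a<..b} t * k t"
      proof (rule AE_I2)
        fix t
        have "(\<lambda>n. ?\<phi> n t * k t) \<longlonglongrightarrow> ((if 0 < t - a then 1 else 0) - (if 0 < t - b then 1 else 0)) * k t"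
          unfolding step_at_def by (intro tendsto_mult tendsto_diff smooth_step_scaled_tendsto tendsto_const)
        also have "((if 0 < t - a then 1 else 0) - (if 0 < t - b then 1 else 0)) * k t = indicator {a<..b} t * k t"
          using \<open>a \<le> b\<close> by (auto simp: indicator_def)
        finally show "(\<lambda>n. ?\<phi> n t * k t) \<longlonglongrightarrow> indicator {a<..b} t * k t" .
      qed
      show "AE t in ?M. norm (?\<phi> n t * k t) \<le> \<bar>k t\<bar>" for n
      proof (rule AE_I2)
        fix t
        have "\<bar>?\<phi> n t\<bar> \<le> 1"
          using smooth_step_bounds[of "real n * (t - a) - 1"] smooth_step_bounds[of "real n * (t - b) - 1"]
          by (auto simp: step_at_def)
        then have "\<bar>?\<phi> n t\<bar> * \<bar>k t\<bar> \<le> 1 * \<bar>k t\<bar>" by (intro mult_right_mono) auto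
        then show "norm (?\<phi> n t * k t) \<le> \<bar>k t\<bar>" by (simp add: abs_mult)
      qed
      show "(\<lambda>t. ?\<phi> n t * k t) \<in> borel_measurable ?M" for n
      proof -
        have "continuous_on {0<..<T} (step_at c n)" for c
          using step_at_has_deriv[of c n] DERIV_isCont continuous_at_imp_continuous_on by blast
        then have "step_at c n \<in> borel_measurable ?M" for c
          by (intro continuous_imp_measurable_on_sets_lebesgue) auto
        then show ?thesis using k by (intro borel_measurable_times borel_measurable_diff) auto
      qed
    qed (use k integrable_indicator_interval[OF k] in auto)
    \<comment> \<open>The difference of the steps is supported between \<open>a + 1/n\<close> and
      \<open>b + 2/n\<close>. The lower end is positive even for \<open>a = 0\<close>, while the
      upper end stays below \<open>T\<close> only for large \<open>n\<close> and needs
      \<open>b < T\<close>.\<close>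
    have ev: "eventually (\<lambda>n. (\<integral>t. deriv (?\<phi> n) t * g t \<partial>?M) = - (\<integral>t. ?\<phi> n t * k t \<partial>?M)) sequentially"
    proof -
      obtain m where m: "2 / (T - b) < real m" using reals_Archimedean2 by blast
      show ?thesis
      proof (rule eventually_sequentiallyI[of m], rule weak)
        fix n assume "m \<le> n"
        with m have n: "2 / (T - b) < real n" by linarith
        then have "0 < real n" using \<open>b < T\<close> by (smt (verit) divide_pos_pos)
        have b: "b + 2 / real n < T"
          using n \<open>0 < real n\<close> \<open>b < T\<close> by (simp add: pos_divide_less_eq field_simps)
        have "?\<phi> n t = 0" if "t \<notin> {a + 1 / real n..b + 2 / real n}" for t
        proof -
          from that consider "t < a + 1 / real n" | "b + 2 / real n < t" by fastforce
          then show ?thesis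
          proof cases
            case 1
            then have *: "real n * (t - a) \<le> 1" using \<open>0 < real n\<close> by (simp add: field_simps)
            moreover have "real n * (t - b) \<le> real n * (t - a)"
              using \<open>a \<le> b\<close> by (intro mult_left_mono) auto
            ultimately show ?thesis by (simp add: step_at_def smooth_step_eq_0)
          next
            case 2
            then have "2 \<le> real n * (t - b)" using \<open>0 < real n\<close> by (simp add: field_simps)
            moreover have "real n * (t - b) \<le> real n * (t - a)"
              using \<open>a \<le> b\<close> by (intro mult_left_mono) auto
            ultimately show ?thesis by (simp add: step_at_def smooth_step_eq_1)
          qed
        qed
        moreover have "{a + 1 / real n..b + 2 / real n} \<subseteq> {0<..<T}"
        proof -
          have "0 < a + 1 / real n" using ab \<open>0 < real n\<close> by (intro add_nonneg_pos) auto
          then show ?thesis using b by auto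
        qed
        moreover have "smooth (?\<phi> n)"
          unfolding smooth_def using Ck_add[OF Ck_step_at Ck_uminus[OF Ck_step_at]] by simp
        ultimately show "?\<phi> n \<in> test_functions {0<..<T}"
          unfolding test_functions_def by blast
      qed
    qed
    have "g a - g b = - (\<integral>t. indicator {a<..b} t * k t \<partial>?M)"
      using LIMSEQ_unique[OF Lim_transform_eventually[OF lhs ev] rhs] .
    then show ?thesis by simp
  qed
  show ?thesis
  proof (cases "a = b \<or> b < T")
    case True
    then show ?thesis using interior ab by auto
  next
    case False
    \<comment> \<open>A step based at \<open>T\<close> leaves no room to its right, so the final
      time is reached by closedness: both sides are continuous in the upper limit.\<close>
    with ab have "a < T" "b = T" by auto
    have closed: "closed {x \<in> {a..T}. g x - g a - (\<integral>t. indicator {a<..x} t * k t \<partial>?M) = 0}"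
      using ab by (intro continuous_closed_preimage_constant continuous_intros
          continuous_on_indefinite_integral k continuous_on_subset[OF g]) auto
    have "closure {a<..<T} \<subseteq> {x \<in> {a..T}. g x - g a - (\<integral>t. indicator {a<..x} t * k t \<partial>?M) = 0}"
      using interior by (intro closure_minimal closed) auto
    moreover have "T \<in> closure {a<..<T}"
      using \<open>a < T\<close> by (simp add: closure_greaterThanLessThan)
    ultimately have "T \<in> {x \<in> {a..T}. g x - g a - (\<integral>t. indicator {a<..x} t * k t \<partial>?M) = 0}"
      by (rule subsetD)
    then show ?thesis using \<open>b = T\<close> by simp
  qed
qed

subsection \<open>The energy identity\<close>

lemma seminormed_group_L2: "seminormed_group (L2 M) (L2_norm M)"
  by unfold_locales (auto intro: L2_diff L2_norm_triangle_diff)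

lemma bounded_pairing_L2:
  fixes M :: "'c measure"
  shows "bounded_pairing (L2 M :: ('c \<Rightarrow> 'b::euclidean_space) set) (L2_norm M) (L2 M) (L2_norm M)
    (\<lambda>f g. \<integral>x. f x \<bullet> g x \<partial>M)"
proof (intro bounded_pairing.intro seminormed_group_L2 bounded_pairing_axioms.intro L2_Cauchy_Schwarz)
  fix f f' g :: "'c \<Rightarrow> 'b" assume "f \<in> L2 M" "f' \<in> L2 M" "g \<in> L2 M"
  then show "(\<integral>x. (f - f') x \<bullet> g x \<partial>M) = (\<integral>x. f x \<bullet> g x \<partial>M) - (\<integral>x. f' x \<bullet> g x \<partial>M)"
    by (simp add: inner_diff_left L2_inner_integrable)
next
  fix f g g' :: "'c \<Rightarrow> 'b" assume "f \<in> L2 M" "g \<in> L2 M" "g' \<in> L2 M"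
  then show "(\<integral>x. f x \<bullet> (g - g') x \<partial>M) = (\<integral>x. f x \<bullet> g x \<partial>M) - (\<integral>x. f x \<bullet> g' x \<partial>M)"
    by (simp add: inner_diff_right L2_inner_integrable)
qed

section \<open>Continuous curves with values in \<open>L2\<close>\<close>

lemma C0H_L2: "v \<in> C0H T \<Omega> \<Longrightarrow> t \<in> {0..T} \<Longrightarrow> v t \<in> L2 (lebesgue_on \<Omega>)"
  by (simp add: C0H_def)

lemma C0H_tendsto:
  assumes v: "v \<in> C0H T \<Omega>" and s: "\<And>n. s n \<in> {0..T}" "t \<in> {0..T}" "s \<longlonglongrightarrow> t"
  shows "(\<lambda>n. L2_norm (lebesgue_on \<Omega>) (v t - v (s n))) \<longlonglongrightarrow> 0"
proof -
  have "((\<lambda>s. L2_norm (lebesgue_on \<Omega>) (v s - v t)) \<longlongrightarrow> L2_norm (lebesgue_on \<Omega>) (v t - v t)) (at t within {0..T})"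
    using v s(2) by (simp add: C0H_def)
  then have "continuous (at t within {0..T}) (\<lambda>s. L2_norm (lebesgue_on \<Omega>) (v s - v t))"
    by (simp add: continuous_within)
  then have "(\<lambda>n. L2_norm (lebesgue_on \<Omega>) (v (s n) - v t)) \<longlonglongrightarrow> L2_norm (lebesgue_on \<Omega>) (v t - v t)"
    using s unfolding continuous_within_sequentially by (auto simp: o_def)
  then show ?thesis by (simp add: L2_norm_minus_commute)
qed

lemma C0H_diff:
  assumes v: "v \<in> C0H T \<Omega>" and w: "w \<in> C0H T \<Omega>"
  shows "v - w \<in> C0H T \<Omega>"
  unfolding C0H_def
proof (intro CollectI ballI conjI)
  let ?M = "lebesgue_on \<Omega>"
  fix t assume t: "t \<in> {0..T}"
  show "(v - w) t \<in> L2 ?M" using C0H_L2[OF v t] C0H_L2[OF w t] by (simp add: L2_diff)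
  show "((\<lambda>s. L2_norm ?M ((v - w) s - (v - w) t)) \<longlongrightarrow> 0) (at t within {0..T})"
  proof (rule tendsto_sandwich[where f = "\<lambda>s. 0"])
    show "((\<lambda>s. L2_norm ?M (v s - v t) + L2_norm ?M (w s - w t)) \<longlongrightarrow> 0) (at t within {0..T})"
      using v w t by (intro tendsto_add_zero) (auto simp: C0H_def)
    show "\<forall>\<^sub>F s in at t within {0..T}. L2_norm ?M ((v - w) s - (v - w) t) \<le> L2_norm ?M (v s - v t) + L2_norm ?M (w s - w t)"
    proof (unfold eventually_at_filter, intro always_eventually allI impI)
      fix s assume s: "s \<in> {0..T}"
      have eq: "(v - w) s - (v - w) t = (v s - v t) - (w s - w t)" by auto
      show "L2_norm ?M ((v - w) s - (v - w) t) \<le> L2_norm ?M (v s - v t) + L2_norm ?M (w s - w t)"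
        unfolding eq using s t by (intro L2_norm_triangle_diff L2_diff C0H_L2[OF v] C0H_L2[OF w])
    qed
  qed auto
qed

lemma C0H_inner_continuous:
  assumes v: "v \<in> C0H T \<Omega>" and z: "z \<in> L2 (lebesgue_on \<Omega>)"
  shows "continuous_on {0..T} (\<lambda>t. \<integral>x. v t x \<bullet> z x \<partial>lebesgue_on \<Omega>)"
  unfolding continuous_on_sequentially o_def
proof (intro allI ballI impI)
  interpret bounded_pairing "L2 (lebesgue_on \<Omega>)" "L2_norm (lebesgue_on \<Omega>)" "L2 (lebesgue_on \<Omega>)"
    "L2_norm (lebesgue_on \<Omega>)" "\<lambda>f g::'a \<Rightarrow> real. \<integral>x. f x \<bullet> g x \<partial>lebesgue_on \<Omega>"
    by (rule bounded_pairing_L2)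
  fix s t assume "t \<in> {0..T}" "(\<forall>n. s n \<in> {0..T}) \<and> s \<longlonglongrightarrow> t"
  then show "(\<lambda>n. \<integral>x. v (s n) x \<bullet> z x \<partial>lebesgue_on \<Omega>) \<longlonglongrightarrow> (\<integral>x. v t x \<bullet> z x \<partial>lebesgue_on \<Omega>)"
    using z by (intro B_tendsto[where ys = "\<lambda>n. z"] C0H_L2[OF v] C0H_tendsto[OF v]) auto
qed

lemma C0H_norm_continuous:
  assumes v: "v \<in> C0H T \<Omega>"
  shows "continuous_on {0..T} (\<lambda>t. L2_norm (lebesgue_on \<Omega>) (v t))"
  unfolding continuous_on_sequentially o_def
proof (intro allI ballI impI)
  interpret seminormed_group "L2 (lebesgue_on \<Omega>) :: ('a \<Rightarrow> real) set" "L2_norm (lebesgue_on \<Omega>)"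
    by (rule seminormed_group_L2)
  fix s t assume "t \<in> {0..T}" "(\<forall>n. s n \<in> {0..T}) \<and> s \<longlonglongrightarrow> t"
  then show "(\<lambda>n. L2_norm (lebesgue_on \<Omega>) (v (s n))) \<longlonglongrightarrow> L2_norm (lebesgue_on \<Omega>) (v t)"
    by (intro N_tendsto C0H_L2[OF v] C0H_tendsto[OF v]) auto
qed

context sobolev_space
begin

lemma seminormed_group_V: "seminormed_group VD (V_norm \<Omega>)"
  by unfold_locales (auto intro: V_0 V_diff V_norm_diff_le)

lemma seminormed_group_V_dual: "seminormed_group VD' (dual_norm)"
  by unfold_locales (auto intro: V_dual_0 V_dual_diff V_dual_norm_diff_le V_dual_norm_0)

lemma bounded_pairing_V_dual:
  "bounded_pairing VD' (dual_norm) VD (V_norm \<Omega>) (\<lambda>F v. F v)"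
  by (intro bounded_pairing.intro seminormed_group_V seminormed_group_V_dual bounded_pairing_axioms.intro
      V_dual_apply_le V_dual_diff_arg) simp_all

sublocale V: seminormed_group "VD" "V_norm \<Omega>"
  by (rule seminormed_group_V)

sublocale V_dual: seminormed_group "VD'" "dual_norm"
  by (rule seminormed_group_V_dual)

sublocale duality: bounded_pairing "VD'" "dual_norm" "VD" "V_norm \<Omega>" "\<lambda>F v. F v"
  by (rule bounded_pairing_V_dual)

lemma duality_integrable:
  "F \<in> L2V_dual T \<Omega> \<Gamma>D \<Longrightarrow> v \<in> L2V T \<Omega> \<Gamma>D \<Longrightarrow> integrable (\<I> T) (\<lambda>t. F t (v t))"
  unfolding L2V_dual_def L2V_def by (rule duality.pairing_integrable)

lemma L2V_const:
  assumes "z \<in> VD"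
  shows "(\<lambda>t. z) \<in> L2V T \<Omega> \<Gamma>D"
proof -
  interpret finite_measure "\<I> T" by (rule finite_measure_interval)
  show ?thesis
    unfolding L2V_def bochner_L2_def strongly_measurable_def using assms V.N_zero
    by (auto intro!: exI[of _ "\<lambda>n t. z"])
qed

text \<open>For fixed \<open>z\<close> the inner product with \<open>v t\<close> is a scalar
  function of time, continuous on the closed interval, and \<open>v' t z\<close> is its weak
  derivative; the scalar result applies, end points included.\<close>

lemma time_deriv_increment:
  assumes v: "v \<in> C0H T \<Omega>" and v': "is_time_deriv T \<Omega> \<Gamma>D v v'" and z: "z \<in> VD"
    and ab: "0 \<le> a" "a \<le> b" "b \<le> T"
  shows "(\<integral>x. v b x \<bullet> z x \<partial>M\<Omega>) - (\<integral>x. v a x \<bullet> z x \<partial>M\<Omega>)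
    = (\<integral>t. indicator {a<..b} t * v' t z \<partial>\<I> T)"
proof (rule weak_derivative_increment[OF C0H_inner_continuous[OF v V_L2[OF z]] _ _ ab])
  have "v' \<in> L2V_dual T \<Omega> \<Gamma>D" using v' by (simp add: is_time_deriv_def)
  from duality_integrable[OF this L2V_const[OF z]]
  show "integrable (\<I> T) (\<lambda>t. v' t z)" .
next
  fix \<phi> assume "\<phi> \<in> test_functions {0<..<T}"
  with v' z show "(\<integral>t. deriv \<phi> t * (\<integral>x. v t x \<bullet> z x \<partial>M\<Omega>) \<partial>\<I> T)
      = - (\<integral>t. \<phi> t * v' t z \<partial>\<I> T)"
    by (simp add: is_time_deriv_def)
qed

text \<open>The derivative enters in the integrated form \<open>incr\<close>, which passes directly
  to differences of curves. As \<open>z\<close> must lie in \<open>V\<close>, increments are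
  compared only between times at which \<open>w\<close> takes values in \<open>V\<close>; these are
  almost all, and continuity of the norm in \<open>L2\<close> covers both end points.\<close>

lemma energy_identity:
  assumes "0 < T" and w: "w \<in> L2V T \<Omega> \<Gamma>D" "w \<in> C0H T \<Omega>" and w': "w' \<in> L2V_dual T \<Omega> \<Gamma>D"
    and incr: "\<And>z a b. \<lbrakk>z \<in> VD; 0 \<le> a; a \<le> b; b \<le> T\<rbrakk> \<Longrightarrow>
      (\<integral>x. w b x \<bullet> z x \<partial>M\<Omega>) - (\<integral>x. w a x \<bullet> z x \<partial>M\<Omega>)
        = (\<integral>t. indicator {a<..b} t * w' t z \<partial>\<I> T)"
  shows "(L2_norm M\<Omega> (w T))\<^sup>2 - (L2_norm M\<Omega> (w 0))\<^sup>2 = 2 * pairing T w' w"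
proof -
  let ?M = "\<I> T"
  define C where "C t = (\<integral>s. indicator {0<..t} s * w' s (w s) \<partial>?M)" for t
  define \<Phi> where "\<Phi> t = (L2_norm M\<Omega> (w t))\<^sup>2 - 2 * C t" for t
  define A where "A s = dual_norm (w' s)" for s
  define F where "F s t = A s * V_norm \<Omega> (w s - w t)" for s t
  have int: "integrable ?M (\<lambda>s. w' s (w s))"
    by (rule duality_integrable[OF w' w(1)])
  have w'B: "w' \<in> bochner_L2 T VD' (dual_norm)" and wB: "w \<in> bochner_L2 T VD (V_norm \<Omega>)"
    using w' w(1) by (auto simp: L2V_dual_def L2V_def)
  have wV: "AE t in ?M. w t \<in> VD" by (rule V.bochner_L2D(1)[OF wB])
  have w'V: "AE t in ?M. w' t \<in> VD'" by (rule V_dual.bochner_L2D(1)[OF w'B])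
  have Am: "A \<in> borel_measurable ?M"
    unfolding A_def[abs_def] by (rule V_dual.bochner_L2_N_measurable[OF w'B])
  have "\<Phi> T = \<Phi> 0"
  proof (rule endpoints_eq_if_vanishing_average[OF \<open>0 < T\<close>, where G = "{t. w t \<in> VD}" and F = F])
    show "continuous_on {0..T} \<Phi>"
      unfolding \<Phi>_def[abs_def] C_def
      by (intro continuous_intros C0H_norm_continuous w continuous_on_indefinite_integral int)
    show "vanishing_average T F"
      unfolding F_def[abs_def] A_def
      by (intro V.vanishing_average_product wB V_dual.bochner_L2D(3)[OF w'B])
    show "AE t in ?M. t \<in> {t. w t \<in> VD}" using wV by simp
  next
    fix h t t' assume tV: "t \<in> {t. w t \<in> VD}" "t' \<in> {t. w t \<in> VD}"
      and t: "0 < t" "t < t'" "t' < T" "t' - t < h"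
    \<comment> \<open>The difference of two squares: pairing \<open>w t' - w t\<close> with this sum
      gives the increment of the squared norm.\<close>
    define z where "z = w t' + w t"
    have z: "z \<in> VD" using tV by (simp add: z_def V_add)
    have L2: "w t \<in> L2 M\<Omega>" "w t' \<in> L2 M\<Omega>" using tV V_L2 by auto
    have "(L2_norm M\<Omega> (w t'))\<^sup>2 - (L2_norm M\<Omega> (w t))\<^sup>2 = (\<integral>x. w t' x \<bullet> z x \<partial>M\<Omega>) - (\<integral>x. w t x \<bullet> z x \<partial>M\<Omega>)"
    proof -
      have "(\<integral>x. w t' x \<bullet> z x \<partial>M\<Omega>) = (L2_norm M\<Omega> (w t'))\<^sup>2 + (\<integral>x. w t' x \<bullet> w t x \<partial>M\<Omega>)"
        unfolding z_def L2_norm_power2 power2_norm_eq_inner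
        using L2_inner_integrable[OF L2(2,2)] L2_inner_integrable[OF L2(2,1)]
        by (simp add: distrib_left)
      moreover have "(\<integral>x. w t x \<bullet> z x \<partial>M\<Omega>) = (\<integral>x. w t' x \<bullet> w t x \<partial>M\<Omega>) + (L2_norm M\<Omega> (w t))\<^sup>2"
        unfolding z_def L2_norm_power2 power2_norm_eq_inner inner_commute[of "w t' _" "w t _"]
        using L2_inner_integrable[OF L2(1,1)] L2_inner_integrable[OF L2(1,2)]
        by (simp add: distrib_left)
      ultimately show ?thesis by simp
    qed
    also have "\<dots> = (\<integral>s. indicator {t<..t'} s * w' s z \<partial>?M)"
      using t by (intro incr z) auto
    finally have E: "(L2_norm M\<Omega> (w t'))\<^sup>2 - (L2_norm M\<Omega> (w t))\<^sup>2 = (\<integral>s. indicator {t<..t'} s * w' s z \<partial>?M)" .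
    have "C t' - C t = (\<integral>s. indicator {0<..t'} s * w' s (w s) - indicator {0<..t} s * w' s (w s) \<partial>?M)"
      unfolding C_def by (intro Bochner_Integration.integral_diff[symmetric] integrable_indicator_interval int)
    also have "\<dots> = (\<integral>s. indicator {t<..t'} s * w' s (w s) \<partial>?M)"
      using t by (intro Bochner_Integration.integral_cong) (auto simp: indicator_def)
    finally have Cd: "C t' - C t = (\<integral>s. indicator {t<..t'} s * w' s (w s) \<partial>?M)" .
    have int1: "integrable ?M (\<lambda>s. indicator {t<..t'} s * w' s z)"
      by (intro integrable_indicator_interval duality_integrable[OF w' L2V_const[OF z]])
    have int2: "integrable ?M (\<lambda>s. indicator {t<..t'} s * w' s (w s))"
      by (intro integrable_indicator_interval int)
    have "\<Phi> t' - \<Phi> t = (\<integral>s. indicator {t<..t'} s * w' s z - 2 * (indicator {t<..t'} s * w' s (w s)) \<partial>?M)"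
      using int1 int2 E Cd by (simp add: \<Phi>_def)
    then have "ennreal \<bar>\<Phi> t' - \<Phi> t\<bar> = ennreal (norm (\<integral>s. indicator {t<..t'} s * w' s z - 2 * (indicator {t<..t'} s * w' s (w s)) \<partial>?M))"
      by (simp only: real_norm_def)
    also have "\<dots> \<le> (\<integral>\<^sup>+s. ennreal (norm (indicator {t<..t'} s * w' s z - 2 * (indicator {t<..t'} s * w' s (w s)))) \<partial>?M)"
      using int1 int2 by (intro integral_norm_bound_ennreal) auto
    also have "\<dots> \<le> (\<integral>\<^sup>+s. ennreal (if \<bar>s - t\<bar> < h then F s t else 0) + ennreal (if \<bar>s - t'\<bar> < h then F s t' else 0) \<partial>?M)"
    proof (rule nn_integral_mono_AE, rule eventually_mono[OF eventually_conj[OF wV w'V]], elim conjE)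
      fix s assume s: "w s \<in> VD" "w' s \<in> VD'"
      have F0: "0 \<le> F s r" for r
        using V_dual.N_nonneg[OF s(2)] by (simp add: F_def A_def)
      show "ennreal (norm (indicator {t<..t'} s * w' s z - 2 * (indicator {t<..t'} s * w' s (w s))))
          \<le> ennreal (if \<bar>s - t\<bar> < h then F s t else 0) + ennreal (if \<bar>s - t'\<bar> < h then F s t' else 0)"
      proof (cases "s \<in> {t<..t'}")
        case True
        then have h: "\<bar>s - t\<bar> < h" "\<bar>s - t'\<bar> < h" using t by auto
        \<comment> \<open>The symmetric \<open>z\<close> splits the error into the deviations of
          \<open>w s\<close> from the two end values, one for each of the two windows.\<close>
        have "w' s z - 2 * w' s (w s) = - w' s (w s - w t') - w' s (w s - w t)"
          using tV s by (simp add: z_def V_dual_add_arg V_dual_diff_arg)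
        then have "\<bar>w' s z - 2 * w' s (w s)\<bar> \<le> \<bar>w' s (w s - w t)\<bar> + \<bar>w' s (w s - w t')\<bar>"
          by simp
        also have "\<dots> \<le> F s t + F s t'"
          unfolding F_def A_def using tV s by (intro add_mono V_dual_apply_le V_diff) auto
        finally have "ennreal \<bar>w' s z - 2 * w' s (w s)\<bar> \<le> ennreal (F s t + F s t')"
          by (rule ennreal_leI)
        then show ?thesis using True h F0 by simp
      next
        case False
        then have "indicator {t<..t'} s = (0::real)" by (rule indicator_simps(2))
        then show ?thesis by simp
      qed
    qed
    also have "\<dots> = window_integral T h (\<lambda>s. F s t) t + window_integral T h (\<lambda>s. F s t') t'"
    proof -
      have "(\<lambda>s. F s r) \<in> borel_measurable ?M" if "w r \<in> VD" for r
        unfolding F_def by (intro borel_measurable_times Am V.N_diff_const_measurable[OF wB that])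
      then show ?thesis
        unfolding window_integral_def using tV by (intro nn_integral_add window_measurable) auto
    qed
    finally show "ennreal \<bar>\<Phi> t' - \<Phi> t\<bar> \<le> window_integral T h (\<lambda>s. F s t) t + window_integral T h (\<lambda>s. F s t') t'" .
  qed
  moreover have "C T = pairing T w' w"
    unfolding C_def pairing_def by (intro Bochner_Integration.integral_cong) (auto simp: indicator_def)
  moreover have "C 0 = 0" by (simp add: C_def)
  ultimately show ?thesis by (simp add: \<Phi>_def)
qed

end

subsection \<open>Riesz representation by gradients\<close>

text \<open>
  Representing a functional by an element of the closure of \<open>\<nabla>V\<close> in \<open>L\<^sup>2\<close>, instead of by an element
  of \<open>V\<close>, avoids the completeness of \<open>V\<close> and thus Poincare's inequality.
\<close>

context sobolev_space
begin

definition represents :: "(('a \<Rightarrow> real) \<Rightarrow> real) \<Rightarrow> ('a \<Rightarrow> 'a) \<Rightarrow> bool" where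
  "represents F g \<longleftrightarrow> g \<in> L2 M\<Omega> \<and> (\<forall>v\<in>VD. F v = Lstar \<Omega> g v) \<and>
     (\<exists>w. (\<forall>n. w n \<in> VD) \<and> (\<lambda>n. L2_norm M\<Omega> (g - wgrad \<Omega> (w n))) \<longlonglongrightarrow> 0)"

text \<open>The upper bound for the dual norm is the Cauchy-Schwarz inequality. The reverse bound
  needs \<open>g\<close> to be a limit of gradients: testing \<open>F\<close> with the approximating
  functions recovers the squared norm of \<open>g\<close> in the limit.\<close>

lemma represents_norm:
  assumes F: "F \<in> VD'" and g: "represents F g"
  shows "L2_norm M\<Omega> g = dual_norm F"
proof (rule antisym)
  interpret L2: bounded_pairing "L2 M\<Omega> :: ('a \<Rightarrow> 'a) set" "L2_norm M\<Omega>" "L2 M\<Omega>" "L2_norm M\<Omega>"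
    "\<lambda>f g. \<integral>x. f x \<bullet> g x \<partial>M\<Omega>"
    by (rule bounded_pairing_L2)
  have gL2: "g \<in> L2 M\<Omega>" and Fg: "\<And>v. v \<in> VD \<Longrightarrow> F v = Lstar \<Omega> g v"
    using g by (auto simp: represents_def)
  obtain w where w: "\<And>n. w n \<in> VD" and lim: "(\<lambda>n. L2_norm M\<Omega> (g - wgrad \<Omega> (w n))) \<longlonglongrightarrow> 0"
    using g by (auto simp: represents_def)
  have "dual_norm F = dual_norm (Lstar \<Omega> g)"
    by (rule V_dual_norm_cong[OF Fg])
  then show "dual_norm F \<le> L2_norm M\<Omega> g"
    using V_dual_norm_Lstar_le[OF gL2] by simp
  have "(\<lambda>n. \<integral>x. g x \<bullet> wgrad \<Omega> (w n) x \<partial>M\<Omega>) \<longlonglongrightarrow> (\<integral>x. g x \<bullet> g x \<partial>M\<Omega>)"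
    using w lim by (intro L2.B_tendsto[where xs = "\<lambda>n. g"] gL2 wgrad_V) auto
  then have lim1: "(\<lambda>n. F (w n)) \<longlonglongrightarrow> (L2_norm M\<Omega> g)\<^sup>2"
    using w by (simp add: Fg Lstar_def L2_norm_power2 power2_norm_eq_inner)
  have lim2: "(\<lambda>n. dual_norm F * V_norm \<Omega> (w n)) \<longlonglongrightarrow> dual_norm F * L2_norm M\<Omega> g"
    unfolding V_norm_def using w lim by (intro tendsto_mult tendsto_const L2.X.N_tendsto gL2 wgrad_V) auto
  have "(L2_norm M\<Omega> g)\<^sup>2 \<le> dual_norm F * L2_norm M\<Omega> g"
  proof (rule LIMSEQ_le[OF lim1 lim2], intro exI allI impI)
    fix n
    show "F (w n) \<le> dual_norm F * V_norm \<Omega> (w n)"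
      using V_dual_apply_le[OF F w, of n] by simp
  qed
  then show "L2_norm M\<Omega> g \<le> dual_norm F"
    using V_dual_norm_nonneg[OF F] L2_norm_nonneg[of M\<Omega> g]
    by (cases "L2_norm M\<Omega> g = 0") (auto simp: power2_eq_square)
qed

lemma represents_diff:
  assumes F: "represents F f" and G: "represents G g"
  shows "represents (F - G) (f - g)"
proof -
  obtain u where u: "\<And>n. u n \<in> VD" and limu: "(\<lambda>n. L2_norm M\<Omega> (f - wgrad \<Omega> (u n))) \<longlonglongrightarrow> 0"
    using F by (auto simp: represents_def)
  obtain w where w: "\<And>n. w n \<in> VD" and limw: "(\<lambda>n. L2_norm M\<Omega> (g - wgrad \<Omega> (w n))) \<longlonglongrightarrow> 0"
    using G by (auto simp: represents_def)
  have L2: "f \<in> L2 M\<Omega>" "g \<in> L2 M\<Omega>" using F G by (auto simp: represents_def)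
  have "(\<lambda>n. L2_norm M\<Omega> ((f - g) - wgrad \<Omega> (u n - w n))) \<longlonglongrightarrow> 0"
  proof (rule tendsto_sandwich[where f = "\<lambda>n. 0"])
    show "(\<lambda>n. L2_norm M\<Omega> (f - wgrad \<Omega> (u n)) + L2_norm M\<Omega> (g - wgrad \<Omega> (w n))) \<longlonglongrightarrow> 0"
      using tendsto_add[OF limu limw] by simp
    have "L2_norm M\<Omega> ((f - g) - wgrad \<Omega> (u n - w n)) \<le> L2_norm M\<Omega> (f - wgrad \<Omega> (u n)) + L2_norm M\<Omega> (g - wgrad \<Omega> (w n))" for n
    proof -
      have "L2_norm M\<Omega> ((f - g) - wgrad \<Omega> (u n - w n)) = L2_norm M\<Omega> ((f - wgrad \<Omega> (u n)) - (g - wgrad \<Omega> (w n)))"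
      proof (rule L2_norm_cong_AE)
        show "AE x in M\<Omega>. ((f - g) - wgrad \<Omega> (u n - w n)) x = ((f - wgrad \<Omega> (u n)) - (g - wgrad \<Omega> (w n))) x"
          using wgrad_diff[OF V_W12[OF u] V_W12[OF w], of n n] by eventually_elim simp
      qed (intro L2_measurable L2_diff L2 wgrad_V V_diff u w)+
      also have "\<dots> \<le> L2_norm M\<Omega> (f - wgrad \<Omega> (u n)) + L2_norm M\<Omega> (g - wgrad \<Omega> (w n))"
        by (intro L2_norm_triangle_diff L2_diff L2 wgrad_V u w)
      finally show ?thesis .
    qed
    then show "\<forall>\<^sub>F n in sequentially. L2_norm M\<Omega> ((f - g) - wgrad \<Omega> (u n - w n))
        \<le> L2_norm M\<Omega> (f - wgrad \<Omega> (u n)) + L2_norm M\<Omega> (g - wgrad \<Omega> (w n))"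
      by (intro always_eventually allI)
  qed simp_all
  then have "\<exists>w. (\<forall>n. w n \<in> VD) \<and> (\<lambda>n. L2_norm M\<Omega> ((f - g) - wgrad \<Omega> (w n))) \<longlonglongrightarrow> 0"
    using u w by (intro exI[of _ "\<lambda>n. u n - w n"]) (simp add: V_diff)
  moreover have "(F - G) v = Lstar \<Omega> (f - g) v" if "v \<in> VD" for v
    using F G that by (simp add: represents_def Lstar_diff)
  ultimately show ?thesis
    unfolding represents_def using L2_diff[OF L2] by blast
qed

text \<open>The direct method for the functional \<open>J\<close>. By the parallelogram identity the
  gradients of a minimising sequence are Cauchy in \<open>L2\<close>; their limit \<open>g\<close>
  satisfies the Euler equation \<open>F v = Lstar \<Omega> g v\<close>, obtained by varying the
  sequence rather than a minimiser.\<close>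

lemma represents_exists:
  assumes F: "F \<in> VD'"
  shows "\<exists>g. represents F g"
proof -
  define J where "J v = 1/2 * (V_norm \<Omega> v)\<^sup>2 - F v" for v
  define m where "m = (INF v\<in>VD. J v)"
  let ?A = "dual_norm F"
  \<comment> \<open>Completing the square with the dual norm of \<open>F\<close> keeps the infimum
    finite.\<close>
  have "- (?A\<^sup>2 / 2) \<le> J v" if "v \<in> VD" for v
  proof -
    have "F v \<le> ?A * V_norm \<Omega> v" using V_dual_apply_le[OF F that] by simp
    moreover have "0 \<le> (?A - V_norm \<Omega> v)\<^sup>2" by simp
    ultimately show ?thesis by (simp add: J_def power2_diff)
  qed
  then have "bdd_below (J ` VD)" by (auto intro!: bdd_belowI2)
  then have m_le: "m \<le> J v" if "v \<in> VD" for v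
    unfolding m_def using that by (rule cINF_lower)
  have "\<exists>v\<in>VD. J v < m + 1 / real (Suc n)" for n
  proof (rule ccontr)
    assume "\<not> ?thesis"
    then have "m + 1 / real (Suc n) \<le> m"
      using V_0 unfolding m_def by (intro cINF_greatest) (auto simp: not_less)
    then show False by simp
  qed
  then have "\<forall>n. \<exists>v. v \<in> VD \<and> J v < m + 1 / real (Suc n)" by blast
  from choice[OF this] obtain w where w: "\<And>n. w n \<in> VD" and Jw: "\<And>n. J (w n) < m + 1 / real (Suc n)"
    by blast
  \<comment> \<open>The linear part of \<open>J\<close> cancels in the midpoint combination, so what
    remains is the parallelogram identity for the gradients.\<close>
  have par: "(V_norm \<Omega> (u - v))\<^sup>2 = 4 * (J u + J v - 2 * J (\<lambda>x. 1/2 * (u + v) x))"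
    if "u \<in> VD" "v \<in> VD" for u v
  proof -
    note L2 = wgrad_V[OF that(1)] wgrad_V[OF that(2)]
    have "(V_norm \<Omega> (\<lambda>x. 1/2 * (u + v) x))\<^sup>2 = 1/4 * (V_norm \<Omega> (u + v))\<^sup>2"
      unfolding V_norm_cmult[OF V_add[OF that]] by (simp add: power_mult_distrib power2_eq_square)
    moreover have "F (\<lambda>x. 1/2 * (u + v) x) = 1/2 * (F u + F v)"
      unfolding V_dual_cmult_arg[OF F V_add[OF that]] V_dual_add_arg[OF F that] ..
    ultimately show ?thesis
      unfolding J_def L2_norm_wgrad_diff[OF that] L2_norm_wgrad_add[OF that]
        L2_norm_diff_power2[OF L2] L2_norm_add_power2[OF L2]
      by (simp add: V_norm_def field_simps)
  qed
  have Cauchy: "\<exists>N. \<forall>i\<ge>N. \<forall>j\<ge>N. L2_norm M\<Omega> (wgrad \<Omega> (w i) - wgrad \<Omega> (w j)) < e" if "0 < e" for e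
  proof -
    \<comment> \<open>Beyond \<open>N\<close> both values of \<open>J\<close> are within
      \<open>e^2 / 8\<close> of the infimum; \<open>par\<close> multiplies the total excess by 4,
      which gives exactly \<open>e^2\<close>.\<close>
    obtain N where N: "8 / e\<^sup>2 < real N" using reals_Archimedean2 by blast
    have "L2_norm M\<Omega> (wgrad \<Omega> (w i) - wgrad \<Omega> (w j)) < e" if "i \<ge> N" "j \<ge> N" for i j
    proof -
      have small: "1 / real (Suc k) < e\<^sup>2 / 8" if "k \<ge> N" for k
      proof -
        have "8 / e\<^sup>2 < real (Suc k)" using N that by simp
        then have "8 < real (Suc k) * e\<^sup>2" using \<open>0 < e\<close> by (simp only: pos_divide_less_eq zero_less_power)
        then show ?thesis by (simp add: field_simps)
      qed
      have gap: "4 * (a + b - 2 * c) < 4 * (d + d)" if "a < m + d" "b < m + d" "m \<le> c" for a b c d :: real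
      proof -
        have "a + b - 2 * c < d + d" using that by linarith
        then show ?thesis by (rule mult_strict_left_mono) simp
      qed
      have "J (w k) < m + e\<^sup>2 / 8" if "k \<ge> N" for k
        using Jw[of k] small[OF that] by (rule less_trans[OF _ add_strict_left_mono])
      then have "(V_norm \<Omega> (w i - w j))\<^sup>2 < 4 * (e\<^sup>2 / 8 + e\<^sup>2 / 8)"
        unfolding par[OF w w] using that by (intro gap m_le V_cmult V_add w) auto
      then have "(V_norm \<Omega> (w i - w j))\<^sup>2 < e\<^sup>2" by simp
      then show ?thesis
        unfolding L2_norm_wgrad_diff[OF w w]
        by (rule power2_less_imp_less) (use \<open>0 < e\<close> in simp)
    qed
    then show ?thesis by blast
  qed
  obtain g where g: "g \<in> L2 M\<Omega>" and lim: "(\<lambda>n. L2_norm M\<Omega> (wgrad \<Omega> (w n) - g)) \<longlonglongrightarrow> 0"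
    using L2_complete[OF finite_M wgrad_V[OF w] Cauchy] by blast
  then have lim': "(\<lambda>n. L2_norm M\<Omega> (g - wgrad \<Omega> (w n))) \<longlonglongrightarrow> 0"
    by (simp add: L2_norm_minus_commute)
  interpret L2: bounded_pairing "L2 M\<Omega> :: ('a \<Rightarrow> 'a) set" "L2_norm M\<Omega>" "L2 M\<Omega>" "L2_norm M\<Omega>"
    "\<lambda>f g. \<integral>x. f x \<bullet> g x \<partial>M\<Omega>"
    by (rule bounded_pairing_L2)
  have "F v = Lstar \<Omega> g v" if v: "v \<in> VD" for v
  proof -
    \<comment> \<open>Obtained by letting \<open>n\<close> tend to infinity in
      \<open>J (w n) < J (w n + s v) + 1 / (n + 1)\<close>. The explicit 0 is the constant
      coefficient in the discriminant criterion, which therefore makes the linear coefficient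
      vanish.\<close>
    have nonneg: "0 \<le> 0 + 2 * s * ((Lstar \<Omega> g v - F v) / 2) + s\<^sup>2 * ((V_norm \<Omega> v)\<^sup>2 / 2)" for s
    proof -
      have "(\<lambda>n. \<integral>x. wgrad \<Omega> (w n) x \<bullet> wgrad \<Omega> v x \<partial>M\<Omega>) \<longlonglongrightarrow> Lstar \<Omega> g v"
        unfolding Lstar_def using w lim' v
        by (intro L2.B_tendsto[where ys = "\<lambda>n. wgrad \<Omega> v"] g wgrad_V) auto
      then have "(\<lambda>n. 1 / real (Suc n) + s * (\<integral>x. wgrad \<Omega> (w n) x \<bullet> wgrad \<Omega> v x \<partial>M\<Omega>) + s\<^sup>2 * (V_norm \<Omega> v)\<^sup>2 / 2 - s * F v)
          \<longlonglongrightarrow> 0 + s * Lstar \<Omega> g v + s\<^sup>2 * (V_norm \<Omega> v)\<^sup>2 / 2 - s * F v"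
        by (intro tendsto_intros LIMSEQ_Suc[OF lim_1_over_n])
      then have "0 \<le> 0 + s * Lstar \<Omega> g v + s\<^sup>2 * (V_norm \<Omega> v)\<^sup>2 / 2 - s * F v"
      proof (rule LIMSEQ_le_const, intro exI allI impI)
        fix n
        have sv: "(\<lambda>x. s * v x) \<in> VD" by (rule V_cmult[OF v])
        have L2: "wgrad \<Omega> (w n) \<in> L2 M\<Omega>" "wgrad \<Omega> (\<lambda>x. s * v x) \<in> L2 M\<Omega>" by (intro wgrad_V w sv)+
        have "(\<integral>x. wgrad \<Omega> (w n) x \<bullet> wgrad \<Omega> (\<lambda>x. s * v x) x \<partial>M\<Omega>) = s * (\<integral>x. wgrad \<Omega> (w n) x \<bullet> wgrad \<Omega> v x \<partial>M\<Omega>)"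
          using V_dual_cmult_arg[OF Lstar_V_dual[OF L2(1)] v, of s] by (simp add: Lstar_def)
        then have "(V_norm \<Omega> (w n + (\<lambda>x. s * v x)))\<^sup>2 =
            (V_norm \<Omega> (w n))\<^sup>2 + 2 * (s * (\<integral>x. wgrad \<Omega> (w n) x \<bullet> wgrad \<Omega> v x \<partial>M\<Omega>)) + s\<^sup>2 * (V_norm \<Omega> v)\<^sup>2"
          unfolding L2_norm_wgrad_add[OF w sv] L2_norm_add_power2[OF L2]
          by (simp add: V_norm_def[symmetric] V_norm_cmult[OF v] power_mult_distrib)
        moreover have "F (w n + (\<lambda>x. s * v x)) = F (w n) + s * F v"
          using V_dual_add_arg[OF F w sv] V_dual_cmult_arg[OF F v] by simp
        moreover have "m \<le> J (w n + (\<lambda>x. s * v x))" by (intro m_le V_add w sv)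
        ultimately show "0 \<le> 1 / real (Suc n) + s * (\<integral>x. wgrad \<Omega> (w n) x \<bullet> wgrad \<Omega> v x \<partial>M\<Omega>)
            + s\<^sup>2 * (V_norm \<Omega> v)\<^sup>2 / 2 - s * F v"
          using Jw[of n] by (simp add: J_def add_divide_distrib)
      qed
      then show ?thesis by (simp add: field_simps)
    qed
    from quadratic_nonneg_imp_le[OF _ _ nonneg] show ?thesis by simp
  qed
  then have "represents F g"
    unfolding represents_def using g w lim' by blast
  then show ?thesis by blast
qed

definition riesz :: "(('a \<Rightarrow> real) \<Rightarrow> real) \<Rightarrow> 'a \<Rightarrow> 'a" where
  "riesz F = (SOME g. represents F g)"

lemma represents_riesz: "F \<in> VD' \<Longrightarrow> represents F (riesz F)"
  unfolding riesz_def by (rule someI_ex[OF represents_exists])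

lemma riesz_L2: "F \<in> VD' \<Longrightarrow> riesz F \<in> L2 M\<Omega>"
  using represents_riesz by (simp add: represents_def)

lemma Lstar_riesz: "F \<in> VD' \<Longrightarrow> v \<in> VD \<Longrightarrow> Lstar \<Omega> (riesz F) v = F v"
  using represents_riesz by (simp add: represents_def)

lemma L2_norm_riesz: "F \<in> VD' \<Longrightarrow> L2_norm M\<Omega> (riesz F) = dual_norm F"
  by (rule represents_norm[OF _ represents_riesz])

text \<open>Shows that the choices made separately for each functional form an isometry, the
  property by which \<open>riesz\<close> carries strong measurability in time from the dual space to
  \<open>L2\<close>.\<close>

lemma L2_norm_riesz_diff:
  "F \<in> VD' \<Longrightarrow> G \<in> VD' \<Longrightarrow> L2_norm M\<Omega> (riesz F - riesz G) = dual_norm (F - G)"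
  by (intro represents_norm V_dual_diff represents_diff represents_riesz)

subsection \<open>Gap identities\<close>

lemma L2V_wgrad: "v \<in> L2V T \<Omega> \<Gamma>D \<Longrightarrow> (\<lambda>t. wgrad \<Omega> (v t)) \<in> L2Y T \<Omega>"
  unfolding L2V_def L2Y_def
  by (erule bochner_L2_map[OF seminormed_group_V seminormed_group_L2])
    (auto simp: wgrad_V V_norm_def L2_norm_wgrad_diff[symmetric])

lemma L2Y_Lstar: "y \<in> L2Y T \<Omega> \<Longrightarrow> (\<lambda>t. Lstar \<Omega> (y t)) \<in> L2V_dual T \<Omega> \<Gamma>D"
  unfolding L2Y_def L2V_dual_def
proof (erule bochner_L2_map[OF seminormed_group_L2 seminormed_group_V_dual])
  fix y z :: "'a \<Rightarrow> 'a" assume yz: "y \<in> L2 M\<Omega>" "z \<in> L2 M\<Omega>"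
  have "dual_norm (Lstar \<Omega> y - Lstar \<Omega> z) = dual_norm (Lstar \<Omega> (y - z))"
    by (rule V_dual_norm_cong) (simp add: Lstar_diff yz)
  also have "\<dots> \<le> L2_norm M\<Omega> (y - z)"
    by (intro V_dual_norm_Lstar_le L2_diff yz)
  finally show "dual_norm (Lstar \<Omega> y - Lstar \<Omega> z) \<le> L2_norm M\<Omega> (y - z)" .
qed (auto intro: Lstar_V_dual V_dual_norm_Lstar_le)

lemma L2V_dual_riesz: "F \<in> L2V_dual T \<Omega> \<Gamma>D \<Longrightarrow> (\<lambda>t. riesz (F t)) \<in> L2Y T \<Omega>"
  unfolding L2Y_def L2V_dual_def
  by (erule bochner_L2_map[OF seminormed_group_V_dual seminormed_group_L2])
    (auto simp: riesz_L2 L2_norm_riesz L2_norm_riesz_diff)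

lemma L2Y_diff: "y \<in> L2Y T \<Omega> \<Longrightarrow> z \<in> L2Y T \<Omega> \<Longrightarrow> y - z \<in> L2Y T \<Omega>"
  unfolding L2Y_def by (rule seminormed_group.bochner_L2_diff[OF seminormed_group_L2])

lemma L2V_diff: "u \<in> L2V T \<Omega> \<Gamma>D \<Longrightarrow> v \<in> L2V T \<Omega> \<Gamma>D \<Longrightarrow> u - v \<in> L2V T \<Omega> \<Gamma>D"
  unfolding L2V_def by (rule V.bochner_L2_diff)

lemma L2V_dual_diff: "F \<in> L2V_dual T \<Omega> \<Gamma>D \<Longrightarrow> G \<in> L2V_dual T \<Omega> \<Gamma>D \<Longrightarrow> F - G \<in> L2V_dual T \<Omega> \<Gamma>D"
  unfolding L2V_dual_def by (rule V_dual.bochner_L2_diff)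

lemma L2V_dual_add: "F \<in> L2V_dual T \<Omega> \<Gamma>D \<Longrightarrow> G \<in> L2V_dual T \<Omega> \<Gamma>D \<Longrightarrow> F + G \<in> L2V_dual T \<Omega> \<Gamma>D"
  unfolding L2V_dual_def by (rule V_dual.bochner_L2_add)

lemma L2V_dual_uminus: "F \<in> L2V_dual T \<Omega> \<Gamma>D \<Longrightarrow> - F \<in> L2V_dual T \<Omega> \<Gamma>D"
  unfolding L2V_dual_def by (rule V_dual.bochner_L2_uminus)

lemma L2V_AE: "v \<in> L2V T \<Omega> \<Gamma>D \<Longrightarrow> AE t in \<I> T. v t \<in> VD"
  unfolding L2V_def by (rule V.bochner_L2D)

lemma L2V_dual_AE: "F \<in> L2V_dual T \<Omega> \<Gamma>D \<Longrightarrow> AE t in \<I> T. F t \<in> VD'"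
  unfolding L2V_dual_def by (rule V_dual.bochner_L2D)

lemma L2Y_AE: "y \<in> L2Y T \<Omega> \<Longrightarrow> AE t in \<I> T. y t \<in> L2 M\<Omega>"
  unfolding L2Y_def by (rule seminormed_group.bochner_L2D[OF seminormed_group_L2])

lemma L2Y_integrable: "y \<in> L2Y T \<Omega> \<Longrightarrow> integrable (\<I> T) (\<lambda>t. (L2_norm M\<Omega> (y t))\<^sup>2)"
  unfolding L2Y_def by (rule seminormed_group.bochner_L2D[OF seminormed_group_L2])

lemma L2V_integrable: "v \<in> L2V T \<Omega> \<Gamma>D \<Longrightarrow> integrable (\<I> T) (\<lambda>t. (V_norm \<Omega> (v t))\<^sup>2)"
  unfolding L2V_def by (rule V.bochner_L2D)

lemma L2V_dual_integrable:
  "F \<in> L2V_dual T \<Omega> \<Gamma>D \<Longrightarrow> integrable (\<I> T) (\<lambda>t. (dual_norm (F t))\<^sup>2)"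
  unfolding L2V_dual_def by (rule V_dual.bochner_L2D)

lemma W_D:
  assumes "v \<in> W T \<Omega> \<Gamma>D"
  shows "v \<in> L2V T \<Omega> \<Gamma>D" "v \<in> C0H T \<Omega>" "is_time_deriv T \<Omega> \<Gamma>D v (time_deriv T \<Omega> \<Gamma>D v)"
    "time_deriv T \<Omega> \<Gamma>D v \<in> L2V_dual T \<Omega> \<Gamma>D"
proof -
  show "v \<in> L2V T \<Omega> \<Gamma>D" "v \<in> C0H T \<Omega>" using assms by (auto simp: W_def)
  have "\<exists>v'. is_time_deriv T \<Omega> \<Gamma>D v v'" using assms by (simp add: W_def)
  then show "is_time_deriv T \<Omega> \<Gamma>D v (time_deriv T \<Omega> \<Gamma>D v)"
    unfolding time_deriv_def by (rule someI_ex)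
  then show "time_deriv T \<Omega> \<Gamma>D v \<in> L2V_dual T \<Omega> \<Gamma>D"
    by (simp add: is_time_deriv_def)
qed

lemma energy_identity_diff:
  assumes "0 < T" and u: "u \<in> W T \<Omega> \<Gamma>D" and v: "v \<in> W T \<Omega> \<Gamma>D"
    and init: "AE x in M\<Omega>. v 0 x = u 0 x"
  shows "(L2_norm M\<Omega> (v T - u T))\<^sup>2 = 2 * pairing T (time_deriv T \<Omega> \<Gamma>D v - time_deriv T \<Omega> \<Gamma>D u) (v - u)"
proof -
  let ?u' = "time_deriv T \<Omega> \<Gamma>D u" and ?v' = "time_deriv T \<Omega> \<Gamma>D v" and ?M = "\<I> T"
  note U = W_D[OF u] and V = W_D[OF v]
  have L2: "u t \<in> L2 M\<Omega>" "v t \<in> L2 M\<Omega>" if "t \<in> {0..T}" for t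
    using that C0H_L2[OF U(2)] C0H_L2[OF V(2)] by auto
  have "(L2_norm M\<Omega> ((v - u) T))\<^sup>2 - (L2_norm M\<Omega> ((v - u) 0))\<^sup>2 = 2 * pairing T (?v' - ?u') (v - u)"
  proof (rule energy_identity[OF \<open>0 < T\<close> L2V_diff[OF V(1) U(1)] C0H_diff[OF V(2) U(2)] L2V_dual_diff[OF V(4) U(4)]])
    fix z a b assume z: "z \<in> VD" and ab: "0 \<le> a" "a \<le> b" "b \<le> T"
    have *: "(\<integral>x. (v - u) c x \<bullet> z x \<partial>M\<Omega>) = (\<integral>x. v c x \<bullet> z x \<partial>M\<Omega>) - (\<integral>x. u c x \<bullet> z x \<partial>M\<Omega>)" if "c \<in> {0..T}" for c
      using L2_inner_integrable[OF L2(1)[OF that] V_L2[OF z]] L2_inner_integrable[OF L2(2)[OF that] V_L2[OF z]]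
      by (simp add: left_diff_distrib)
    have int: "integrable ?M (\<lambda>t. indicator {a<..b} t * F t z)" if "F \<in> L2V_dual T \<Omega> \<Gamma>D" for F
      by (intro integrable_indicator_interval duality_integrable[OF that L2V_const[OF z]])
    have "(\<integral>t. indicator {a<..b} t * (?v' - ?u') t z \<partial>?M)
        = (\<integral>t. indicator {a<..b} t * ?v' t z \<partial>?M) - (\<integral>t. indicator {a<..b} t * ?u' t z \<partial>?M)"
      using int[OF U(4)] int[OF V(4)] by (simp add: right_diff_distrib)
    then show "(\<integral>x. (v - u) b x \<bullet> z x \<partial>M\<Omega>) - (\<integral>x. (v - u) a x \<bullet> z x \<partial>M\<Omega>)
        = (\<integral>t. indicator {a<..b} t * (?v' - ?u') t z \<partial>?M)"
      using time_deriv_increment[OF U(2,3) z ab] time_deriv_increment[OF V(2,3) z ab] *[of a] *[of b] ab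
      by simp
  qed
  \<comment> \<open>The common initial value removes the contribution at time 0.\<close>
  moreover have "L2_norm M\<Omega> ((v - u) 0) = L2_norm M\<Omega> (0 :: 'a \<Rightarrow> real)"
    using init L2[of 0] \<open>0 < T\<close>
    by (intro L2_norm_cong_AE) (auto intro!: L2_measurable L2_diff elim: eventually_mono)
  ultimately show ?thesis by simp
qed

text \<open>Subtracting the pairing of \<open>f - v' - Lstar \<Omega> y\<close> with
  \<open>z\<close> adds \<open>Lstar \<Omega> y z\<close>, which cancels the mixed term in half the
  square of \<open>y - wgrad \<Omega> z\<close>. Taken for \<open>z = u\<close> on one side and
  \<open>z = v\<close> on the other, this leaves \<open>y\<close> only through half its squared
  norm, the same on both sides.\<close>

lemma gap_identity_pointwise:
  assumes u: "u \<in> VD" and v: "v \<in> VD" and y: "y \<in> L2 M\<Omega>"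
    and f: "f \<in> VD'" and u': "u' \<in> VD'" and v': "v' \<in> VD'"
  shows "1/2 * (V_norm \<Omega> (v - u))\<^sup>2 + (- (f - u' - Lstar \<Omega> (wgrad \<Omega> u))) (v - u)
      + 1/2 * (L2_norm M\<Omega> (y - wgrad \<Omega> u))\<^sup>2 - (f - v' - Lstar \<Omega> y) u
    = 1/2 * (L2_norm M\<Omega> (y - wgrad \<Omega> v))\<^sup>2 - (f - v' - Lstar \<Omega> y) v - (v' - u') (v - u)"
proof -
  note L2 = wgrad_V[OF u] wgrad_V[OF v]
  have 1: "(V_norm \<Omega> (v - u))\<^sup>2 = (L2_norm M\<Omega> (wgrad \<Omega> v))\<^sup>2 - 2 * Lstar \<Omega> (wgrad \<Omega> u) v + (L2_norm M\<Omega> (wgrad \<Omega> u))\<^sup>2"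
    unfolding L2_norm_wgrad_diff[OF v u] L2_norm_diff_power2[OF L2(2,1)] Lstar_def
    by (simp add: inner_commute)
  have 2: "Lstar \<Omega> (wgrad \<Omega> u) u = (L2_norm M\<Omega> (wgrad \<Omega> u))\<^sup>2"
    by (simp add: Lstar_def L2_norm_power2 power2_norm_eq_inner)
  have 3: "(L2_norm M\<Omega> (y - wgrad \<Omega> z))\<^sup>2 = (L2_norm M\<Omega> y)\<^sup>2 - 2 * Lstar \<Omega> y z + (L2_norm M\<Omega> (wgrad \<Omega> z))\<^sup>2"
    if "z \<in> VD" for z
    unfolding L2_norm_diff_power2[OF y wgrad_V[OF that]] Lstar_def ..
  have 4: "F (v - u) = F v - F u" if "F \<in> VD'" for F
    by (rule V_dual_diff_arg[OF that v u])
  show ?thesis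
    using 1 2 3[OF u] 3[OF v] 4[OF f] 4[OF u'] 4[OF v'] 4[OF Lstar_V_dual[OF L2(1)]]
    by (simp add: algebra_simps)
qed

lemma Q_norm_power2: "(Q_norm T \<Omega> y)\<^sup>2 = (\<integral>t. (L2_norm M\<Omega> (y t))\<^sup>2 \<partial>\<I> T)"
  by (simp add: Q_norm_def bochner_norm_def)

lemma gap_identity:
  assumes "0 < T" and u: "u \<in> W T \<Omega> \<Gamma>D" and v: "v \<in> W T \<Omega> \<Gamma>D"
    and init: "AE x in M\<Omega>. v 0 x = u 0 x"
    and f: "f \<in> L2V_dual T \<Omega> \<Gamma>D" and y: "y \<in> L2Y T \<Omega>"
  defines "\<Lambda> \<equiv> f - time_deriv T \<Omega> \<Gamma>D u - (\<lambda>t. Lstar \<Omega> (wgrad \<Omega> (u t)))"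
    and "F \<equiv> f - time_deriv T \<Omega> \<Gamma>D v - (\<lambda>t. Lstar \<Omega> (y t))"
  shows "1/2 * (Q_norm T \<Omega> (\<lambda>t. wgrad \<Omega> (v t - u t)))\<^sup>2 + pairing T (- \<Lambda>) (v - u)
      + 1/2 * (L2_norm M\<Omega> (v T - u T))\<^sup>2
      + 1/2 * (Q_norm T \<Omega> (y - (\<lambda>t. wgrad \<Omega> (u t))))\<^sup>2 - pairing T F u
    = 1/2 * (Q_norm T \<Omega> (y - (\<lambda>t. wgrad \<Omega> (v t))))\<^sup>2 - pairing T F v"
proof -
  let ?u' = "time_deriv T \<Omega> \<Gamma>D u" and ?v' = "time_deriv T \<Omega> \<Gamma>D v" and ?M = "\<I> T"
  note U = W_D[OF u] and V = W_D[OF v]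
  note vu = L2V_diff[OF V(1) U(1)] and gu = L2V_wgrad[OF U(1)] and gv = L2V_wgrad[OF V(1)]
  have \<Lambda>: "\<Lambda> \<in> L2V_dual T \<Omega> \<Gamma>D"
    unfolding \<Lambda>_def by (intro L2V_dual_diff f U L2Y_Lstar gu)
  have F: "F \<in> L2V_dual T \<Omega> \<Gamma>D"
    unfolding F_def by (intro L2V_dual_diff f V L2Y_Lstar y)
  have i1: "integrable ?M (\<lambda>t. (L2_norm M\<Omega> (wgrad \<Omega> (v t - u t)))\<^sup>2)"
    using L2V_integrable[OF vu] by (simp add: V_norm_def)
  have i2: "integrable ?M (\<lambda>t. (- \<Lambda>) t ((v - u) t))"
    by (intro duality_integrable L2V_dual_uminus \<Lambda> vu)
  have i3: "integrable ?M (\<lambda>t. (L2_norm M\<Omega> ((y - (\<lambda>t. wgrad \<Omega> (u t))) t))\<^sup>2)"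
    by (intro L2Y_integrable L2Y_diff y gu)
  have i4: "integrable ?M (\<lambda>t. F t (u t))" by (intro duality_integrable F U)
  have i5: "integrable ?M (\<lambda>t. (L2_norm M\<Omega> ((y - (\<lambda>t. wgrad \<Omega> (v t))) t))\<^sup>2)"
    by (intro L2Y_integrable L2Y_diff y gv)
  have i6: "integrable ?M (\<lambda>t. F t (v t))" by (intro duality_integrable F V)
  have i7: "integrable ?M (\<lambda>t. (?v' - ?u') t ((v - u) t))"
    by (intro duality_integrable L2V_dual_diff U V vu)
  let ?L = "\<lambda>t. 1/2 * (L2_norm M\<Omega> (wgrad \<Omega> (v t - u t)))\<^sup>2 + (- \<Lambda>) t ((v - u) t)
      + 1/2 * (L2_norm M\<Omega> ((y - (\<lambda>t. wgrad \<Omega> (u t))) t))\<^sup>2 - F t (u t)"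
  let ?R = "\<lambda>t. 1/2 * (L2_norm M\<Omega> ((y - (\<lambda>t. wgrad \<Omega> (v t))) t))\<^sup>2 - F t (v t) - (?v' - ?u') t ((v - u) t)"
  have "AE t in ?M. ?L t = ?R t"
    using L2V_AE[OF U(1)] L2V_AE[OF V(1)] L2Y_AE[OF y] L2V_dual_AE[OF f] L2V_dual_AE[OF U(4)] L2V_dual_AE[OF V(4)]
  proof eventually_elim
    case (elim t)
    from gap_identity_pointwise[OF this] show ?case
      by (simp only: \<Lambda>_def F_def fun_diff_def fun_Compl_def V_norm_def minus_apply uminus_apply)
  qed
  then have "(\<integral>t. ?L t \<partial>?M) = (\<integral>t. ?R t \<partial>?M)"
    by (intro integral_cong_AE borel_measurable_integrable Bochner_Integration.integrable_add
        Bochner_Integration.integrable_diff integrable_mult_right i1 i2 i3 i4 i5 i6 i7)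
  moreover have "(\<integral>t. ?L t \<partial>?M) = 1/2 * (Q_norm T \<Omega> (\<lambda>t. wgrad \<Omega> (v t - u t)))\<^sup>2 + pairing T (- \<Lambda>) (v - u)
      + 1/2 * (Q_norm T \<Omega> (y - (\<lambda>t. wgrad \<Omega> (u t))))\<^sup>2 - pairing T F u"
    unfolding Q_norm_power2 pairing_def
    by (simp only: Bochner_Integration.integral_add Bochner_Integration.integral_diff integral_mult_right_zero
        Bochner_Integration.integrable_add Bochner_Integration.integrable_diff integrable_mult_right i1 i2 i3 i4)
  moreover have "(\<integral>t. ?R t \<partial>?M) = 1/2 * (Q_norm T \<Omega> (y - (\<lambda>t. wgrad \<Omega> (v t))))\<^sup>2 - pairing T F v
      - pairing T (?v' - ?u') (v - u)"
    unfolding Q_norm_power2 pairing_def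
    by (simp only: Bochner_Integration.integral_add Bochner_Integration.integral_diff integral_mult_right_zero
        Bochner_Integration.integrable_add Bochner_Integration.integrable_diff integrable_mult_right i5 i6 i7)
  ultimately show ?thesis
    using energy_identity_diff[OF \<open>0 < T\<close> u v init] by simp
qed

text \<open>The conjugate evaluates functionals on \<open>V\<close> only and so respects the
  equality of the dual space; the Riesz construction reproduces a functional just in this
  sense.\<close>

lemma I_conj_cong:
  assumes "AE t in \<I> T. \<forall>z\<in>VD. F t z = G t z"
  shows "I_conj T \<Omega> \<Gamma>D \<zeta> F = I_conj T \<Omega> \<Gamma>D \<zeta> G"
proof -
  have eq: "fenchel_conj VD \<Phi> F = fenchel_conj VD \<Phi> G"
    if "\<forall>z\<in>VD. F z = G z" for \<Phi> and F G :: "('a \<Rightarrow> real) \<Rightarrow> real"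
    unfolding fenchel_conj_def using that by (intro SUP_cong) auto
  have "AE t in \<I> T.
      fenchel_conj VD (chi (obstacle_set \<Omega> \<Gamma>D (\<zeta> t))) (F t) =
      fenchel_conj VD (chi (obstacle_set \<Omega> \<Gamma>D (\<zeta> t))) (G t)"
    using assms by eventually_elim (rule eq)
  then show ?thesis
    unfolding I_conj_def ext_integral_def
    by (intro arg_cong2[where f = "(-)"] arg_cong[where f = enn2ereal] nn_integral_cong_AE)
      (auto elim!: eventually_mono)
qed

lemma L2V_dual_norm_power2:
  "(L2V_dual_norm T \<Omega> \<Gamma>D F)\<^sup>2 = (\<integral>t. (dual_norm (F t))\<^sup>2 \<partial>\<I> T)"
  by (simp add: L2V_dual_norm_def bochner_norm_def)

text \<open>Correct the gradient of \<open>v\<close> by the Riesz representative of the residual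
  \<open>G\<close>. Applying the adjoint of the gradient subtracts exactly \<open>G\<close>, so the
  remaining functional is \<open>\<eta>\<close>, and the isometry turns the norm of the correction
  into the dual norm of the residual.\<close>

lemma gap_flux_le:
  assumes v: "v \<in> L2V T \<Omega> \<Gamma>D" and v': "v' \<in> L2V_dual T \<Omega> \<Gamma>D" and f: "f \<in> L2V_dual T \<Omega> \<Gamma>D"
    and \<eta>: "\<eta> \<in> L2V_dual T \<Omega> \<Gamma>D"
  obtains y where "y \<in> L2Y T \<Omega>"
    "(Q_norm T \<Omega> (y - (\<lambda>t. wgrad \<Omega> (v t))))\<^sup>2
      = (L2V_dual_norm T \<Omega> \<Gamma>D (v' + (\<lambda>t. neg_laplace \<Omega> (v t)) + \<eta> - f))\<^sup>2"
    "AE t in \<I> T. \<forall>z\<in>VD. (f - v' - (\<lambda>t. Lstar \<Omega> (y t))) t z = \<eta> t z"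
proof -
  let ?M = "\<I> T"
  define G where "G = v' + (\<lambda>t. neg_laplace \<Omega> (v t)) + \<eta> - f"
  have G: "G \<in> L2V_dual T \<Omega> \<Gamma>D"
    unfolding G_def neg_laplace_def by (intro L2V_dual_diff L2V_dual_add f v' \<eta> L2Y_Lstar L2V_wgrad v)
  define y where "y = (\<lambda>t. wgrad \<Omega> (v t)) - (\<lambda>t. riesz (G t))"
  have y: "y \<in> L2Y T \<Omega>"
    unfolding y_def by (intro L2Y_diff L2V_wgrad v L2V_dual_riesz G)
  have yv: "(L2_norm M\<Omega> ((y - (\<lambda>t. wgrad \<Omega> (v t))) t))\<^sup>2 = (L2_norm M\<Omega> (riesz (G t)))\<^sup>2" for t
    using L2_norm_uminus[of M\<Omega> "riesz (G t)"] by (simp add: y_def)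
  have "(Q_norm T \<Omega> (y - (\<lambda>t. wgrad \<Omega> (v t))))\<^sup>2 = (L2V_dual_norm T \<Omega> \<Gamma>D G)\<^sup>2"
    unfolding Q_norm_power2 L2V_dual_norm_power2 yv
  proof (rule integral_cong_AE)
    show "AE t in ?M. (L2_norm M\<Omega> (riesz (G t)))\<^sup>2 = (dual_norm (G t))\<^sup>2"
      using L2V_dual_AE[OF G] by eventually_elim (simp add: L2_norm_riesz)
  qed (intro borel_measurable_integrable L2Y_integrable L2V_dual_riesz L2V_dual_integrable G)+
  moreover have "AE t in ?M. \<forall>z\<in>VD. (f - v' - (\<lambda>t. Lstar \<Omega> (y t))) t z = \<eta> t z"
    using L2V_dual_AE[OF G] L2V_AE[OF v]
  proof eventually_elim
    case (elim t)
    show ?case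
    proof
      fix z assume z: "z \<in> VD"
      have "Lstar \<Omega> (y t) z = neg_laplace \<Omega> (v t) z - G t z"
        using Lstar_diff[OF wgrad_V[OF elim(2)] riesz_L2[OF elim(1)] z] Lstar_riesz[OF elim(1) z]
        by (simp add: y_def neg_laplace_def)
      then show "(f - v' - (\<lambda>t. Lstar \<Omega> (y t))) t z = \<eta> t z"
        by (simp add: G_def)
    qed
  qed
  ultimately show ?thesis using that y by (simp add: G_def)
qed

text \<open>For this \<open>\<eta>\<close> the residual collapses to \<open>Lstar\<close> of
  \<open>wgrad \<Omega> (v t) - y t\<close>, and \<open>Lstar\<close> does not increase
  norms.\<close>

lemma gap_functional_le:
  assumes v: "v \<in> L2V T \<Omega> \<Gamma>D" and v': "v' \<in> L2V_dual T \<Omega> \<Gamma>D" and f: "f \<in> L2V_dual T \<Omega> \<Gamma>D"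
    and y: "y \<in> L2Y T \<Omega>"
  defines "\<eta> \<equiv> f - v' - (\<lambda>t. Lstar \<Omega> (y t))"
  shows "(L2V_dual_norm T \<Omega> \<Gamma>D (v' + (\<lambda>t. neg_laplace \<Omega> (v t)) + \<eta> - f))\<^sup>2
    \<le> (Q_norm T \<Omega> (y - (\<lambda>t. wgrad \<Omega> (v t))))\<^sup>2"
  unfolding Q_norm_power2 L2V_dual_norm_power2
proof (rule integral_mono_AE)
  have \<eta>: "\<eta> \<in> L2V_dual T \<Omega> \<Gamma>D"
    unfolding \<eta>_def by (intro L2V_dual_diff f v' L2Y_Lstar y)
  show "integrable (\<I> T)
      (\<lambda>t. (dual_norm ((v' + (\<lambda>t. neg_laplace \<Omega> (v t)) + \<eta> - f) t))\<^sup>2)"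
    unfolding neg_laplace_def
    by (intro L2V_dual_integrable L2V_dual_diff L2V_dual_add f v' \<eta> L2Y_Lstar L2V_wgrad v)
  show "integrable (\<I> T) (\<lambda>t. (L2_norm M\<Omega> ((y - (\<lambda>t. wgrad \<Omega> (v t))) t))\<^sup>2)"
    by (intro L2Y_integrable L2Y_diff y L2V_wgrad v)
  show "AE t in \<I> T. (dual_norm ((v' + (\<lambda>t. neg_laplace \<Omega> (v t)) + \<eta> - f) t))\<^sup>2
      \<le> (L2_norm M\<Omega> ((y - (\<lambda>t. wgrad \<Omega> (v t))) t))\<^sup>2"
    using L2V_AE[OF v] L2Y_AE[OF y]
  proof eventually_elim
    case (elim t)
    note L2 = wgrad_V[OF elim(1)] elim(2)
    have "dual_norm ((v' + (\<lambda>t. neg_laplace \<Omega> (v t)) + \<eta> - f) t) = dual_norm (Lstar \<Omega> (wgrad \<Omega> (v t) - y t))"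
      by (rule V_dual_norm_cong) (simp add: \<eta>_def neg_laplace_def Lstar_diff[OF L2])
    moreover have "dual_norm (Lstar \<Omega> (wgrad \<Omega> (v t) - y t)) \<le> L2_norm M\<Omega> (y t - wgrad \<Omega> (v t))"
      using V_dual_norm_Lstar_le[OF L2_diff[OF L2]] by (simp add: L2_norm_minus_commute)
    ultimately show ?case
      using V_dual_norm_nonneg[OF Lstar_V_dual[OF L2_diff[OF L2]]] by (simp add: power_mono)
  qed
qed

lemma pairing_cong:
  assumes "AE t in \<I> T. \<forall>z\<in>VD. F t z = G t z"
    and F: "F \<in> L2V_dual T \<Omega> \<Gamma>D" and G: "G \<in> L2V_dual T \<Omega> \<Gamma>D" and v: "v \<in> L2V T \<Omega> \<Gamma>D"
  shows "pairing T F v = pairing T G v"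
  unfolding pairing_def
proof (rule integral_cong_AE)
  show "AE t in \<I> T. F t (v t) = G t (v t)"
    using assms(1) L2V_AE[OF v] by eventually_elim blast
qed (intro borel_measurable_integrable duality_integrable F G v)+

end

text \<open>Adding a real number is an order isomorphism of \<open>ereal\<close> with inverse
  \<open>- c\<close>; infinite values and an empty index set are covered by the same
  argument.\<close>

lemma ereal_add_INF:
  fixes g :: "'b \<Rightarrow> ereal"
  shows "ereal c + (INF y\<in>A. g y) = (INF y\<in>A. ereal c + g y)"
proof (rule antisym)
  show "ereal c + (INF y\<in>A. g y) \<le> (INF y\<in>A. ereal c + g y)"
    by (intro INF_greatest add_left_mono INF_lower)
  have cancel: "ereal (- c) + (ereal c + x) = x" "ereal c + (ereal (- c) + x) = x" for x
    by (cases x; simp)+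
  have "ereal (- c) + (INF y\<in>A. ereal c + g y) \<le> (INF y\<in>A. g y)"
  proof (rule INF_greatest)
    fix y assume "y \<in> A"
    then have "ereal (- c) + (INF y\<in>A. ereal c + g y) \<le> ereal (- c) + (ereal c + g y)"
      by (intro add_left_mono INF_lower)
    then show "ereal (- c) + (INF y\<in>A. ereal c + g y) \<le> g y" by (simp only: cancel)
  qed
  then have "ereal c + (ereal (- c) + (INF y\<in>A. ereal c + g y)) \<le> ereal c + (INF y\<in>A. g y)"
    by (rule add_left_mono)
  then show "(INF y\<in>A. ereal c + g y) \<le> ereal c + (INF y\<in>A. g y)"
    by (simp only: cancel)
qed

text \<open>Here \<open>I\<close> stands for the conjugate term, possibly infinite, that both
  functionals share; if it is infinite, both sides are equal to it.\<close>

lemma ereal_add_diff_shift: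
  assumes "c + a - b = a' - b'"
  shows "ereal c + (ereal a + I - ereal b) = ereal a' + I - ereal b'"
  using assms by (cases I) auto

theorem lemma5p10:
  fixes T :: real and \<Omega> \<Gamma>D \<Gamma>N :: "'a::euclidean_space set"
    and \<zeta> u v :: "real \<Rightarrow> 'a \<Rightarrow> real" and u0 :: "'a \<Rightarrow> real"
    and f \<Lambda> :: "real \<Rightarrow> ('a \<Rightarrow> real) \<Rightarrow> real"
  assumes "bounded_lipschitz_domain \<Omega>"
    and "boundary_split \<Omega> \<Gamma>D \<Gamma>N"
    and "0 < T"
    and "\<zeta> \<in> L2V T \<Omega> \<Gamma>D \<inter> C0H T \<Omega>"
    and "f \<in> L2V_dual T \<Omega> \<Gamma>D"
    and "u0 \<in> obstacle_set \<Omega> \<Gamma>D (\<zeta> 0)"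
    and "obstacle_solution T \<Omega> \<Gamma>D \<zeta> f u0 u"
    and "\<Lambda> = f - time_deriv T \<Omega> \<Gamma>D u - (\<lambda>t. Lstar \<Omega> (wgrad \<Omega> (u t)))"
    and "v \<in> W T \<Omega> \<Gamma>D"
    and "AE x in lebesgue_on \<Omega>. v 0 x = u0 x"
    and "AE t in lebesgue_on {0<..<T}. v t \<in> obstacle_set \<Omega> \<Gamma>D (\<zeta> t)"
  shows "\<Lambda> \<in> L2V_dual T \<Omega> \<Gamma>D \<and>
       ereal (1/2 * (Q_norm T \<Omega> (\<lambda>t. wgrad \<Omega> (v t - u t)))\<^sup>2 + pairing T (- \<Lambda>) (v - u)
           + 1/2 * (L2_norm (lebesgue_on \<Omega>) (v T - u T))\<^sup>2)
         + (INF y\<in>L2Y T \<Omega>.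
              ereal (1/2 * (Q_norm T \<Omega> (y - (\<lambda>t. wgrad \<Omega> (u t))))\<^sup>2)
              + I_conj T \<Omega> \<Gamma>D \<zeta> (f - time_deriv T \<Omega> \<Gamma>D v - (\<lambda>t. Lstar \<Omega> (y t)))
              - ereal (pairing T (f - time_deriv T \<Omega> \<Gamma>D v - (\<lambda>t. Lstar \<Omega> (y t))) u))
       = (INF y\<in>L2Y T \<Omega>.
              ereal (1/2 * (Q_norm T \<Omega> (y - (\<lambda>t. wgrad \<Omega> (v t))))\<^sup>2)
              + I_conj T \<Omega> \<Gamma>D \<zeta> (f - time_deriv T \<Omega> \<Gamma>D v - (\<lambda>t. Lstar \<Omega> (y t)))
              - ereal (pairing T (f - time_deriv T \<Omega> \<Gamma>D v - (\<lambda>t. Lstar \<Omega> (y t))) v)) \<and>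
       (INF y\<in>L2Y T \<Omega>.
              ereal (1/2 * (Q_norm T \<Omega> (y - (\<lambda>t. wgrad \<Omega> (v t))))\<^sup>2)
              + I_conj T \<Omega> \<Gamma>D \<zeta> (f - time_deriv T \<Omega> \<Gamma>D v - (\<lambda>t. Lstar \<Omega> (y t)))
              - ereal (pairing T (f - time_deriv T \<Omega> \<Gamma>D v - (\<lambda>t. Lstar \<Omega> (y t))) v))
       = (INF \<eta>\<in>L2V_dual T \<Omega> \<Gamma>D.
              ereal (1/2 * (L2V_dual_norm T \<Omega> \<Gamma>D
                (time_deriv T \<Omega> \<Gamma>D v + (\<lambda>t. neg_laplace \<Omega> (v t)) + \<eta> - f))\<^sup>2)
              + I_conj T \<Omega> \<Gamma>D \<zeta> \<eta>
              + ereal (pairing T (- \<eta>) v))"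
proof -
  interpret sobolev_space \<Omega> \<Gamma>D
    using assms(1) by unfold_locales (auto simp: bounded_lipschitz_domain_def)
  let ?v' = "time_deriv T \<Omega> \<Gamma>D v" and ?M = "lebesgue_on {0<..<T}"
  have u: "u \<in> W T \<Omega> \<Gamma>D" and u0: "AE x in lebesgue_on \<Omega>. u 0 x = u0 x"
    using assms(7) by (auto simp: obstacle_solution_def)
  have v: "v \<in> W T \<Omega> \<Gamma>D" by (rule assms(9))
  have f: "f \<in> L2V_dual T \<Omega> \<Gamma>D" by (rule assms(5))
  note U = W_D[OF u] and V = W_D[OF v]
  have init: "AE x in lebesgue_on \<Omega>. v 0 x = u 0 x"
    using u0 assms(10) by eventually_elim simp
  have \<Lambda>: "\<Lambda> \<in> L2V_dual T \<Omega> \<Gamma>D"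
    unfolding assms(8) by (intro L2V_dual_diff f U L2Y_Lstar L2V_wgrad)
  have Fy: "f - ?v' - (\<lambda>t. Lstar \<Omega> (y t)) \<in> L2V_dual T \<Omega> \<Gamma>D" if "y \<in> L2Y T \<Omega>" for y
    by (intro L2V_dual_diff f V L2Y_Lstar that)
  let ?P = "\<lambda>w y. ereal (1/2 * (Q_norm T \<Omega> (y - (\<lambda>t. wgrad \<Omega> (w t))))\<^sup>2)
              + I_conj T \<Omega> \<Gamma>D \<zeta> (f - ?v' - (\<lambda>t. Lstar \<Omega> (y t)))
              - ereal (pairing T (f - ?v' - (\<lambda>t. Lstar \<Omega> (y t))) w)"
  let ?D = "\<lambda>\<eta>. ereal (1/2 * (L2V_dual_norm T \<Omega> \<Gamma>D (?v' + (\<lambda>t. neg_laplace \<Omega> (v t)) + \<eta> - f))\<^sup>2)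
              + I_conj T \<Omega> \<Gamma>D \<zeta> \<eta> + ereal (pairing T (- \<eta>) v)"
  let ?c = "1/2 * (Q_norm T \<Omega> (\<lambda>t. wgrad \<Omega> (v t - u t)))\<^sup>2 + pairing T (- \<Lambda>) (v - u)
           + 1/2 * (L2_norm (lebesgue_on \<Omega>) (v T - u T))\<^sup>2"
  have "ereal ?c + (INF y\<in>L2Y T \<Omega>. ?P u y) = (INF y\<in>L2Y T \<Omega>. ?P v y)"
    \<comment> \<open>With the constant moved under the infimum, the two functionals agree for each
      single \<open>y\<close>.\<close>
    unfolding ereal_add_INF
  proof (rule INF_cong[OF refl], rule ereal_add_diff_shift)
    fix y assume "y \<in> L2Y T \<Omega>"
    from gap_identity[OF assms(3) u v init f this]
    show "?c + 1/2 * (Q_norm T \<Omega> (y - (\<lambda>t. wgrad \<Omega> (u t))))\<^sup>2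
        - pairing T (f - ?v' - (\<lambda>t. Lstar \<Omega> (y t))) u
      = 1/2 * (Q_norm T \<Omega> (y - (\<lambda>t. wgrad \<Omega> (v t))))\<^sup>2
        - pairing T (f - ?v' - (\<lambda>t. Lstar \<Omega> (y t))) v"
      unfolding assms(8) .
  qed
  moreover have "(INF y\<in>L2Y T \<Omega>. ?P v y) = (INF \<eta>\<in>L2V_dual T \<Omega> \<Gamma>D. ?D \<eta>)"
  \<comment> \<open>Every \<open>\<eta>\<close> is matched by some \<open>y\<close> with equal
    value, whereas a given \<open>y\<close> leads to an \<open>\<eta>\<close> whose value can be
    strictly smaller: the part of the flux that the adjoint does not see is dropped.\<close>
  proof (rule antisym; rule INF_mono)
    have minus: "x - ereal (pairing T F v) = x + ereal (pairing T (- F) v)" for x F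
      by (simp add: pairing_def minus_ereal_def)
    {
      fix \<eta> assume \<eta>: "\<eta> \<in> L2V_dual T \<Omega> \<Gamma>D"
      obtain y where y: "y \<in> L2Y T \<Omega>"
        and norm: "(Q_norm T \<Omega> (y - (\<lambda>t. wgrad \<Omega> (v t))))\<^sup>2
          = (L2V_dual_norm T \<Omega> \<Gamma>D (?v' + (\<lambda>t. neg_laplace \<Omega> (v t)) + \<eta> - f))\<^sup>2"
        and eq: "AE t in ?M. \<forall>z\<in>V \<Omega> \<Gamma>D. (f - ?v' - (\<lambda>t. Lstar \<Omega> (y t))) t z = \<eta> t z"
        by (rule gap_flux_le[OF V(1) V(4) f \<eta>])
      have "?P v y = ?D \<eta>"
        unfolding norm I_conj_cong[OF eq] pairing_cong[OF eq Fy[OF y] \<eta> V(1)] minus ..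
      then show "\<exists>y\<in>L2Y T \<Omega>. ?P v y \<le> ?D \<eta>" using y by (intro bexI[of _ y]) simp_all
    next
      fix y assume y: "y \<in> L2Y T \<Omega>"
      show "\<exists>\<eta>\<in>L2V_dual T \<Omega> \<Gamma>D. ?D \<eta> \<le> ?P v y"
      proof (intro bexI[OF _ Fy[OF y]], unfold minus, intro add_right_mono)
        show "ereal (1/2 * (L2V_dual_norm T \<Omega> \<Gamma>D
            (?v' + (\<lambda>t. neg_laplace \<Omega> (v t)) + (f - ?v' - (\<lambda>t. Lstar \<Omega> (y t))) - f))\<^sup>2)
          \<le> ereal (1/2 * (Q_norm T \<Omega> (y - (\<lambda>t. wgrad \<Omega> (v t))))\<^sup>2)"
          using gap_functional_le[OF V(1) V(4) f y] by simp
      qed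
    }
  qed
  ultimately show ?thesis using \<Lambda> by blast
qed

end
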